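(* Let $n\ge3$, $m\ge1$, and let $u=(u_1,\dots,u_m)$ be a classical solution of finite Morse index of $$-\Delta u_i=|u|^{p-1}u_i\quad\text{in }\mathbb{R}^n,\qquad i=1,\dots,m.$$ If either $1<p<\frac{n+2}{n-2}$ or $\frac{n+2}{n-2}<p<p_c(n)$, where $p_c(n)=\infty$ for $n\le10$ and $p_c(n)=\frac{(n-2)^2-4n+8\sqrt{n-1}}{(n-2)(n-10)}$ for $n\ge11$, then each $u_i$ is identically zero. If $p=\frac{n+2}{n-2}$, then $u$ has finite energy, namely $\int_{\mathbb{R}^n}|u|^{p+1}=\sum_{i=1}^m\int_{\mathbb{R}^n}|\nabla u_i|^2<\infty$; and if in this case $u$ is in addition stable, then each $u_i$ is identically zero.
   Context: $|u|=(\sum_iu_i^2)^{1/2}$. For $\phi=(\phi_i)\in C_c^\infty(\mathbb{R}^n;\mathbb{R}^m)$ let $Q_u(\phi)=\sum_i\int|\nabla\phi_i|^2-\sum_i\int|u|^{p-1}\phi_i^2-(p-1)\sum_{i,j}\int|u|^{p-3}u_iu_j\phi_i\phi_j$. The Morse index of $u$ is the supremum of the dimensions of linear subspaces of $C_c^\infty(\mathbb{R}^n;\mathbb{R}^m)$ on which $Q_u(\phi)<0$ for all $\phi\ne0$; $u$ is stable if $Q_u(\phi)\ge0$ for all $\phi$ (Morse index zero). *)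

theory Defs
  imports "HOL-Analysis.Analysis"
begin

primrec Ck :: "nat \<Rightarrow> ('a::real_normed_vector \<Rightarrow> 'b::real_normed_vector) \<Rightarrow> bool" where
  "Ck 0 f = continuous_on UNIV f"
| "Ck (Suc k) f = (f differentiable_on UNIV \<and> (\<forall>v. Ck k (\<lambda>x. frechet_derivative f (at x) v)))"

definition smooth :: "('a::real_normed_vector \<Rightarrow> 'b::real_normed_vector) \<Rightarrow> bool" where
  "smooth f \<longleftrightarrow> (\<forall>k. Ck k f)"

definition test_fun :: "(real^'n \<Rightarrow> real^'m) \<Rightarrow> bool" where
  "test_fun \<phi> \<longleftrightarrow> smooth \<phi> \<and> compact (closure {x. \<phi> x \<noteq> 0})"

definition partial :: "(real^'n \<Rightarrow> real) \<Rightarrow> 'n \<Rightarrow> real^'n \<Rightarrow> real" where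
  "partial f j x = frechet_derivative f (at x) (axis j 1)"

definition laplacian :: "(real^'n \<Rightarrow> real) \<Rightarrow> real^'n \<Rightarrow> real" where
  "laplacian f x = (\<Sum>j\<in>UNIV. partial (\<lambda>y. partial f j y) j x)"

definition grad_sq :: "(real^'n \<Rightarrow> real) \<Rightarrow> real^'n \<Rightarrow> real" where
  "grad_sq f x = (\<Sum>j\<in>UNIV. (partial f j x)^2)"

definition classical_solution :: "real \<Rightarrow> (real^'n \<Rightarrow> real^'m) \<Rightarrow> bool" where
  "classical_solution p u \<longleftrightarrow> Ck 2 u \<and>
     (\<forall>i x. - laplacian (\<lambda>y. u y $ i) x = norm (u x) powr (p - 1) * u x $ i)"

definition Qform :: "real \<Rightarrow> (real^'n \<Rightarrow> real^'m) \<Rightarrow> (real^'n \<Rightarrow> real^'m) \<Rightarrow> real" where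
  "Qform p u \<phi> =
     (\<Sum>i\<in>UNIV. integral\<^sup>L lborel (\<lambda>x. grad_sq (\<lambda>y. \<phi> y $ i) x))
   - (\<Sum>i\<in>UNIV. integral\<^sup>L lborel (\<lambda>x. norm (u x) powr (p - 1) * (\<phi> x $ i)^2))
   - (p - 1) * (\<Sum>i\<in>UNIV. \<Sum>j\<in>UNIV. integral\<^sup>L lborel
        (\<lambda>x. norm (u x) powr (p - 3) * u x $ i * u x $ j * \<phi> x $ i * \<phi> x $ j))"

text \<open>There is a k-dimensional subspace of test functions on which Q_u is negative
  (away from 0): equivalently, k test functions all of whose nontrivial linear
  combinations have negative energy (such a family is automatically independent).\<close>
definition morse_index_ge :: "real \<Rightarrow> (real^'n \<Rightarrow> real^'m) \<Rightarrow> nat \<Rightarrow> bool" where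
  "morse_index_ge p u k \<longleftrightarrow> (\<exists>\<phi> :: nat \<Rightarrow> real^'n \<Rightarrow> real^'m.
     (\<forall>l<k. test_fun (\<phi> l)) \<and>
     (\<forall>c :: nat \<Rightarrow> real. (\<exists>l<k. c l \<noteq> 0) \<longrightarrow>
        Qform p u (\<lambda>x. \<Sum>l<k. c l *\<^sub>R \<phi> l x) < 0))"

definition finite_morse_index :: "real \<Rightarrow> (real^'n \<Rightarrow> real^'m) \<Rightarrow> bool" where
  "finite_morse_index p u \<longleftrightarrow> (\<exists>N. \<forall>k. morse_index_ge p u k \<longrightarrow> k \<le> N)"

definition stable :: "real \<Rightarrow> (real^'n \<Rightarrow> real^'m) \<Rightarrow> bool" where
  "stable p u \<longleftrightarrow> (\<forall>\<phi>. test_fun \<phi> \<longrightarrow> Qform p u \<phi> \<ge> 0)"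

definition p_c :: "nat \<Rightarrow> ereal" where
  "p_c n = (if n \<le> 10 then \<infinity> else
     ereal (((real n - 2)^2 - 4 * real n + 8 * sqrt (real n - 1)) / ((real n - 2) * (real n - 10))))"

end

theory Submission
  imports Defs
begin

text \<open>
  A solution of finite Morse index is stable outside a ball, since otherwise test functions of
  negative energy with disjoint supports span negative spaces of every dimension. Testing stability
  with \<open>|u|\<^sup>s u \<psi>\<close> and the equation with \<open>|u|\<^sup>2\<^sup>s u \<psi>\<^sup>2\<close> bounds the integral of \<open>|u|\<close> to the power
  \<open>p + 1 + 2 s\<close> as long as \<open>(1 + s)\<^sup>2 < p (1 + 2 s)\<close>.

  For \<open>p\<close> up to the critical exponent, \<open>s = 0\<close> gives finite energy, and the energy and Pohozaev
  identities on large balls yield two relations between the integrals of \<open>|\<nabla>u|\<^sup>2\<close> and \<open>|u|\<close> to the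
  power \<open>p + 1\<close>, which are incompatible below the critical exponent unless \<open>u = 0\<close>.

  Above the critical exponent, the condition \<open>p < p_c n\<close> says exactly that \<open>s\<close> may be chosen with
  \<open>p + 1 + 2 s = n (p - 1) / 2\<close>, the scale-invariant power. The energy, Pohozaev and scaling
  identities with the weights \<open>|x|\<^sup>a\<close> and \<open>|x|\<^sup>a\<^sup>-\<^sup>2\<close>, where \<open>a = 2 \<alpha> + 2 - n < 0\<close> and \<open>\<alpha> = 2 / (p - 1)\<close>,
  combine into the monotonicity of the Emden-Fowler energy. Its boundary terms vanish at \<open>0\<close> and at
  infinity, so \<open>u\<close> is homogeneous of degree \<open>-\<alpha>\<close>, and being bounded near \<open>0\<close> it is zero.
\<close>

section \<open>Calculus of continuously differentiable functions\<close>

text \<open>The functions |u|^s u psi are only C1, since |y|^s y need not be smooth at 0. Stability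
  is therefore extended from smooth to C1 functions by mollification, and C1 cutoffs then suffice
  everywhere. The bound on s compares two gradient integrals, whose leading parts have ratio at most
  (1 + s)^2 / (1 + 2 s), with the factor p gained by linearising the nonlinearity; for systems this
  rests on |u . grad u| <= |u| |grad u|.

  No surface integrals occur: identities on balls carry radial C1 weights, and boundary terms become
  integrals over the layers where the weight is cut off. In the variables t = log |x| and w =
  |x|^\<alpha> u the system is autonomous with damping coefficient -a = n - 2 - 2 \<alpha>, positive
  above the critical exponent, and the energy has derivative a times the integral of |w_t|^2 over
  the sphere. The scale-invariant power is the one for which Hoelder's inequality bounds the
  integral of |u|^(p + 1) over a ball of radius R by a multiple of R^(-a), which the weight |x|^a
  just compensates; integrability improves this bound to decay. Near 0 the factor |x|^(2 \<alpha>)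
  and the boundedness of u suffice.\<close>

definition C1_grad :: "('a::euclidean_space \<Rightarrow> real) \<Rightarrow> ('a \<Rightarrow> 'a) \<Rightarrow> bool" where
  "C1_grad f G \<longleftrightarrow> (\<forall>x. (f has_derivative (\<lambda>h. G x \<bullet> h)) (at x)) \<and> continuous_on UNIV G"

lemma C1_gradD: "C1_grad f G \<Longrightarrow> (f has_derivative (\<lambda>h. G x \<bullet> h)) (at x)"
  by (simp add: C1_grad_def)

lemma C1_grad_continuous_grad: "C1_grad f G \<Longrightarrow> continuous_on S G"
  unfolding C1_grad_def using continuous_on_subset by blast

lemma C1_grad_continuous: "C1_grad f G \<Longrightarrow> continuous_on S f"
  by (meson C1_gradD continuous_at_imp_continuous_on has_derivative_continuous)

lemma C1_gradI:
  assumes "\<And>x. (f has_derivative (\<lambda>h. G x \<bullet> h)) (at x)" "continuous_on UNIV G"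
  shows "C1_grad f G"
  using assms by (simp add: C1_grad_def)

lemma C1_grad_const: "C1_grad (\<lambda>x. c) (\<lambda>x. 0)"
  by (auto simp: C1_grad_def)

lemma C1_grad_inner: "C1_grad (\<lambda>x. x \<bullet> e) (\<lambda>x. e)"
  by (auto simp: C1_grad_def inner_commute intro!: derivative_eq_intros)

lemma C1_grad_norm_sq: "C1_grad (\<lambda>x. x \<bullet> x) (\<lambda>x. 2 *\<^sub>R x)"
  by (rule C1_gradI) (auto simp: inner_commute intro!: derivative_eq_intros continuous_intros)

lemma C1_grad_add:
  assumes "C1_grad f F" "C1_grad g G"
  shows "C1_grad (\<lambda>x. f x + g x) (\<lambda>x. F x + G x)"
proof (rule C1_gradI)
  fix x
  show "((\<lambda>x. f x + g x) has_derivative (\<lambda>h. (F x + G x) \<bullet> h)) (at x)"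
    using has_derivative_add[OF C1_gradD[OF assms(1)] C1_gradD[OF assms(2)], of x]
    by (simp add: inner_add_left)
qed (intro continuous_intros C1_grad_continuous_grad[OF assms(1)] C1_grad_continuous_grad[OF assms(2)])

lemma C1_grad_mult:
  assumes "C1_grad f F" "C1_grad g G"
  shows "C1_grad (\<lambda>x. f x * g x) (\<lambda>x. f x *\<^sub>R G x + g x *\<^sub>R F x)"
proof (rule C1_gradI)
  fix x
  show "((\<lambda>x. f x * g x) has_derivative (\<lambda>h. (f x *\<^sub>R G x + g x *\<^sub>R F x) \<bullet> h)) (at x)"
    using has_derivative_mult[OF C1_gradD[OF assms(1)] C1_gradD[OF assms(2)], of x]
    by (simp add: inner_add_left mult.commute)
qed (intro continuous_intros C1_grad_continuous_grad[OF assms(1)] C1_grad_continuous_grad[OF assms(2)]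
     C1_grad_continuous[OF assms(1)] C1_grad_continuous[OF assms(2)])

lemma C1_grad_cmult:
  assumes "C1_grad f F"
  shows "C1_grad (\<lambda>x. c * f x) (\<lambda>x. c *\<^sub>R F x)"
  using C1_grad_mult[OF C1_grad_const[of c] assms] by simp

lemma C1_grad_sum:
  assumes "\<And>i. i \<in> I \<Longrightarrow> C1_grad (f i) (F i)"
  shows "C1_grad (\<lambda>x. \<Sum>i\<in>I. f i x) (\<lambda>x. \<Sum>i\<in>I. F i x)"
  using assms
proof (induction I rule: infinite_finite_induct)
  case (insert a I)
  then show ?case using C1_grad_add[of "f a" "F a"] by simp
qed (simp_all add: C1_grad_const)

lemma C1_grad_compose_real:
  assumes f: "C1_grad f F"
    and h: "\<And>t. (h has_real_derivative h' t) (at t)" "continuous_on UNIV h'"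
  shows "C1_grad (\<lambda>x. h (f x)) (\<lambda>x. h' (f x) *\<^sub>R F x)"
proof (rule C1_gradI)
  fix x
  have "(h has_derivative (*) (h' (f x))) (at (f x))"
    using h(1) by (simp add: has_field_derivative_def)
  from has_derivative_compose[OF C1_gradD[OF f] this]
  show "((\<lambda>x. h (f x)) has_derivative (\<lambda>y. (h' (f x) *\<^sub>R F x) \<bullet> y)) (at x)"
    by simp
next
  have "continuous_on UNIV (\<lambda>x. h' (f x))"
    by (rule continuous_on_compose2[OF h(2) C1_grad_continuous[OF f]]) auto
  then show "continuous_on UNIV (\<lambda>x. h' (f x) *\<^sub>R F x)"
    by (intro continuous_intros C1_grad_continuous_grad[OF f])
qed

lemma C1_grad_power:
  assumes "C1_grad f F"
  shows "C1_grad (\<lambda>x. f x ^ k) (\<lambda>x. (real k * f x ^ (k - 1)) *\<^sub>R F x)"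
  by (rule C1_grad_compose_real[OF assms]) (auto intro!: derivative_eq_intros continuous_intros)

lemma C1_grad_compose_vec:
  fixes u :: "'a::euclidean_space \<Rightarrow> real^'m"
  assumes f: "C1_grad f F" and u: "\<And>i. C1_grad (\<lambda>x. u x $ i) (g i)"
  shows "C1_grad (\<lambda>x. f (u x)) (\<lambda>x. \<Sum>i\<in>UNIV. (F (u x) $ i) *\<^sub>R g i x)"
proof (rule C1_gradI)
  fix x
  have "(u has_derivative (\<lambda>h. \<chi> i. g i x \<bullet> h)) (at x)"
    unfolding has_derivative_componentwise_within[of u]
    using C1_gradD[OF u] by (auto simp: Basis_vec_def inner_axis)
  from has_derivative_compose[OF this C1_gradD[OF f]]
  show "((\<lambda>x. f (u x)) has_derivative (\<lambda>h. (\<Sum>i\<in>UNIV. (F (u x) $ i) *\<^sub>R g i x) \<bullet> h)) (at x)"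
    by (simp add: inner_vec_def[of "F (u x)"] inner_sum_left)
next
  have "continuous_on UNIV u"
    using C1_grad_continuous[OF u] by (simp add: continuous_on_componentwise[of _ u] Basis_vec_def inner_axis)
  then have "continuous_on UNIV (\<lambda>x. F (u x))"
    by (rule continuous_on_compose2[OF C1_grad_continuous_grad[OF f]]) auto
  then show "continuous_on UNIV (\<lambda>x. \<Sum>i\<in>UNIV. F (u x) $ i *\<^sub>R g i x)"
    by (intro continuous_intros C1_grad_continuous_grad[OF u])
qed

lemma C1_grad_shift:
  assumes "C1_grad f F" shows "C1_grad (\<lambda>x. f (x - z)) (\<lambda>x. F (x - z))"
proof (rule C1_gradI)
  fix x
  have "((\<lambda>x. x - z) has_derivative (\<lambda>h. h)) (at x)"
    by (auto intro!: derivative_eq_intros)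
  from has_derivative_compose[OF this C1_gradD[OF assms]]
  show "((\<lambda>x. f (x - z)) has_derivative (\<lambda>h. F (x - z) \<bullet> h)) (at x)" .
next
  show "continuous_on UNIV (\<lambda>x. F (x - z))"
    by (rule continuous_on_compose2[OF C1_grad_continuous_grad[OF assms]]) (auto intro!: continuous_intros)
qed

lemma C1_grad_eq_0:
  assumes "C1_grad f F" "open S" "\<And>x. x \<in> S \<Longrightarrow> f x = 0" "x \<in> S"
  shows "F x = 0"
proof -
  have "(f has_derivative (\<lambda>h. 0)) (at x)"
    by (rule has_derivative_transform_within_open[of "\<lambda>x. 0" _ _ _ S]) (use assms in auto)
  with C1_gradD[OF assms(1), of x] have "(\<lambda>h. F x \<bullet> h) = (\<lambda>h. 0)"
    by (rule has_derivative_unique)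
  then have "F x \<bullet> F x = 0" by meson
  then show ?thesis by simp
qed

lemma C1_grad_eq_0_outside:
  assumes "C1_grad f F" "\<And>x. norm x > r \<Longrightarrow> f x = 0" "norm x > r"
  shows "F x = 0"
  by (rule C1_grad_eq_0[OF assms(1), of "{x. norm x > r}"])
    (use assms in \<open>auto intro!: open_Collect_less continuous_intros\<close>)

lemma C1_grad_frechet: "C1_grad f F \<Longrightarrow> frechet_derivative f (at x) v = F x \<bullet> v"
  using frechet_derivative_at[OF C1_gradD] by metis

lemma C1_grad_partial:
  fixes f :: "real^'n \<Rightarrow> real"
  shows "C1_grad f F \<Longrightarrow> partial f j x = F x $ j"
  by (simp add: partial_def C1_grad_frechet inner_axis)

lemma C1_grad_grad_sq:
  fixes f :: "real^'n \<Rightarrow> real"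
  shows "C1_grad f F \<Longrightarrow> grad_sq f x = F x \<bullet> F x"
  by (simp add: grad_sq_def C1_grad_partial inner_vec_def power2_eq_square)

lemma C1_grad_has_vector_derivative:
  assumes "C1_grad f F"
  shows "((\<lambda>t. f (x + t *\<^sub>R v)) has_real_derivative F (x + t *\<^sub>R v) \<bullet> v) (at t)"
proof -
  have "((\<lambda>t. x + t *\<^sub>R v) has_derivative (\<lambda>h. h *\<^sub>R v)) (at t)"
    by (auto intro!: derivative_eq_intros)
  from has_derivative_compose[OF this C1_gradD[OF assms]]
  show ?thesis by (simp add: has_field_derivative_def mult_commute_abs)
qed

text \<open>Both mixed derivatives are limits of the same second difference quotient.\<close>

lemma second_difference:
  assumes f: "C1_grad f F" and F: "C1_grad (\<lambda>x. F x \<bullet> v) H" and h: "h > 0"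
  shows "\<exists>s t. 0 \<le> s \<and> s \<le> h \<and> 0 \<le> t \<and> t \<le> h \<and>
    f (x + h *\<^sub>R v + h *\<^sub>R w) - f (x + h *\<^sub>R v) - f (x + h *\<^sub>R w) + f x = h\<^sup>2 * (H (x + s *\<^sub>R v + t *\<^sub>R w) \<bullet> w)"
proof -
  have "\<exists>s. 0 < s \<and> s < h \<and> (f ((x + h *\<^sub>R w) + h *\<^sub>R v) - f (x + h *\<^sub>R v)) - (f ((x + h *\<^sub>R w) + 0 *\<^sub>R v) - f (x + 0 *\<^sub>R v))
     = (h - 0) * (F ((x + h *\<^sub>R w) + s *\<^sub>R v) \<bullet> v - F (x + s *\<^sub>R v) \<bullet> v)"
    by (rule MVT2[OF h, of "\<lambda>s. f ((x + h *\<^sub>R w) + s *\<^sub>R v) - f (x + s *\<^sub>R v)"])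
      (rule DERIV_diff; rule C1_grad_has_vector_derivative[OF f])
  then obtain s where s: "0 < s" "s < h" and 1: "f (x + h *\<^sub>R v + h *\<^sub>R w) - f (x + h *\<^sub>R v) - f (x + h *\<^sub>R w) + f x
     = h * (F (x + s *\<^sub>R v + h *\<^sub>R w) \<bullet> v - F (x + s *\<^sub>R v) \<bullet> v)"
    by (auto simp: algebra_simps)
  have "\<exists>t. 0 < t \<and> t < h \<and> F ((x + s *\<^sub>R v) + h *\<^sub>R w) \<bullet> v - F ((x + s *\<^sub>R v) + 0 *\<^sub>R w) \<bullet> v
    = (h - 0) * (H ((x + s *\<^sub>R v) + t *\<^sub>R w) \<bullet> w)"
    by (rule MVT2[OF h, of "\<lambda>t. F ((x + s *\<^sub>R v) + t *\<^sub>R w) \<bullet> v"])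
      (intro C1_grad_has_vector_derivative[OF F])
  then obtain t where t: "0 < t" "t < h" "F (x + s *\<^sub>R v + h *\<^sub>R w) \<bullet> v - F (x + s *\<^sub>R v) \<bullet> v = h * (H (x + s *\<^sub>R v + t *\<^sub>R w) \<bullet> w)"
    by auto
  show ?thesis
    by (rule exI[of _ s], rule exI[of _ t]) (use s t 1 in \<open>simp add: power2_eq_square\<close>)
qed

lemma mixed_derivatives_commute:
  assumes f: "C1_grad f F" and H: "C1_grad (\<lambda>x. F x \<bullet> v) H" and K: "C1_grad (\<lambda>x. F x \<bullet> w) K"
  shows "H x \<bullet> w = K x \<bullet> v"
proof -
  define e where "e n = 1 / real (Suc n)" for n
  have e0: "e n > 0" for n by (simp add: e_def)
  have e: "e \<longlonglongrightarrow> 0" unfolding e_def using LIMSEQ_inverse_real_of_nat by (simp add: inverse_eq_divide)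
  have "\<forall>n. \<exists>s t. 0 \<le> s \<and> s \<le> e n \<and> 0 \<le> t \<and> t \<le> e n \<and>
    f (x + e n *\<^sub>R v + e n *\<^sub>R w) - f (x + e n *\<^sub>R v) - f (x + e n *\<^sub>R w) + f x = (e n)\<^sup>2 * (H (x + s *\<^sub>R v + t *\<^sub>R w) \<bullet> w)"
    using second_difference[OF f H e0] by blast
  then obtain s t where st: "0 \<le> s n" "s n \<le> e n" "0 \<le> t n" "t n \<le> e n"
    "f (x + e n *\<^sub>R v + e n *\<^sub>R w) - f (x + e n *\<^sub>R v) - f (x + e n *\<^sub>R w) + f x = (e n)\<^sup>2 * (H (x + s n *\<^sub>R v + t n *\<^sub>R w) \<bullet> w)" for n
    by metis
  have "\<forall>n. \<exists>s t. 0 \<le> s \<and> s \<le> e n \<and> 0 \<le> t \<and> t \<le> e n \<and>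
    f (x + e n *\<^sub>R w + e n *\<^sub>R v) - f (x + e n *\<^sub>R w) - f (x + e n *\<^sub>R v) + f x = (e n)\<^sup>2 * (K (x + s *\<^sub>R w + t *\<^sub>R v) \<bullet> v)"
    using second_difference[OF f K e0] by blast
  then obtain s' t' where st': "0 \<le> s' n" "s' n \<le> e n" "0 \<le> t' n" "t' n \<le> e n"
    "f (x + e n *\<^sub>R w + e n *\<^sub>R v) - f (x + e n *\<^sub>R w) - f (x + e n *\<^sub>R v) + f x = (e n)\<^sup>2 * (K (x + s' n *\<^sub>R w + t' n *\<^sub>R v) \<bullet> v)" for n
    by metis
  have eq: "H (x + s n *\<^sub>R v + t n *\<^sub>R w) \<bullet> w = K (x + s' n *\<^sub>R w + t' n *\<^sub>R v) \<bullet> v" for n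
  proof -
    have "x + e n *\<^sub>R w + e n *\<^sub>R v = x + e n *\<^sub>R v + e n *\<^sub>R w" by simp
    then have "(e n)\<^sup>2 * (H (x + s n *\<^sub>R v + t n *\<^sub>R w) \<bullet> w) = (e n)\<^sup>2 * (K (x + s' n *\<^sub>R w + t' n *\<^sub>R v) \<bullet> v)"
      using st(5)[of n] st'(5)[of n] by (simp add: algebra_simps)
    with e0[of n] show ?thesis by simp
  qed
  have lims: "s \<longlonglongrightarrow> 0" "t \<longlonglongrightarrow> 0" "s' \<longlonglongrightarrow> 0" "t' \<longlonglongrightarrow> 0"
    using st st' by (auto intro!: tendsto_sandwich[OF _ _ tendsto_const e] always_eventually)
  have lim0: "(\<lambda>n. x + s n *\<^sub>R v + t n *\<^sub>R w) \<longlonglongrightarrow> x + 0 *\<^sub>R v + 0 *\<^sub>R w" 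
    by (intro tendsto_intros lims)
  have "isCont H x" "isCont K x"
    using C1_grad_continuous_grad[OF H, of UNIV] C1_grad_continuous_grad[OF K, of UNIV]
    by (auto simp: continuous_on_eq_continuous_at)
  have 1: "(\<lambda>n. H (x + s n *\<^sub>R v + t n *\<^sub>R w) \<bullet> w) \<longlonglongrightarrow> H x \<bullet> w"
    using isCont_tendsto_compose[OF \<open>isCont H x\<close>, of "\<lambda>n. x + s n *\<^sub>R v + t n *\<^sub>R w"] lim0
    by (auto intro!: tendsto_intros)
  have "(\<lambda>n. x + s' n *\<^sub>R w + t' n *\<^sub>R v) \<longlonglongrightarrow> x + 0 *\<^sub>R w + 0 *\<^sub>R v" 
    by (intro tendsto_intros lims)
  then have 2: "(\<lambda>n. K (x + s' n *\<^sub>R w + t' n *\<^sub>R v) \<bullet> v) \<longlonglongrightarrow> K x \<bullet> v"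
    using isCont_tendsto_compose[OF \<open>isCont K x\<close>, of "\<lambda>n. x + s' n *\<^sub>R w + t' n *\<^sub>R v"]
    by (auto intro!: tendsto_intros)
  show ?thesis using LIMSEQ_unique[OF 1] 2 by (simp add: eq)
qed

section \<open>Integration by parts\<close>

lemma integrable_continuous_bounded_support:
  fixes f :: "'a::euclidean_space \<Rightarrow> 'b::euclidean_space"
  assumes "continuous_on UNIV f" "\<And>x. norm x > r \<Longrightarrow> f x = 0"
  shows "integrable lborel f"
proof -
  have "set_integrable lborel (cball 0 r) f"
    unfolding set_integrable_def using assms(1)
    by (intro borel_integrable_compact) (auto intro: continuous_on_subset)
  moreover have "(\<lambda>x. indicator (cball 0 r) x *\<^sub>R f x) = f"
    using assms(2) by (auto simp: indicator_def fun_eq_iff)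
  ultimately show ?thesis by (simp add: set_integrable_def)
qed

lemma lborel_integral_shift:
  fixes f :: "'a::euclidean_space \<Rightarrow> real"
  assumes "f \<in> borel_measurable borel"
  shows "(LBINT x. f (x + a)) = integral\<^sup>L lborel f"
proof -
  have "integral\<^sup>L lborel f = integral\<^sup>L (distr lborel borel ((+) a)) f"
    by (subst lborel_distr_plus[of a]) simp
  also have "\<dots> = (LBINT x. f (a + x))"
    using assms by (intro integral_distr) auto
  finally show ?thesis by (simp add: add.commute)
qed

lemma bounded_on_ball:
  fixes f :: "'a::euclidean_space \<Rightarrow> 'b::real_normed_vector"
  assumes "continuous_on UNIV f"
  obtains M where "M > 0" "\<And>x. norm x \<le> r \<Longrightarrow> norm (f x) \<le> M"
proof -
  have "compact (f ` cball 0 r)"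
    using assms by (intro compact_continuous_image) (auto intro: continuous_on_subset)
  then obtain M where "M > 0" "\<forall>y \<in> f ` cball 0 r. norm y \<le> M"
    using compact_imp_bounded bounded_pos by blast
  with that show ?thesis by auto
qed

text \<open>Difference quotients have integral zero by translation invariance, and converge dominatedly.\<close>

lemma integral_derivative_eq_0:
  assumes f: "C1_grad f F" and supp: "\<And>x. norm x > r \<Longrightarrow> f x = 0"
  shows "(LBINT x. F x \<bullet> v) = 0"
proof -
  define e where "e n = 1 / real (Suc n)" for n
  have e0: "0 < e n" "e n \<le> 1" for n by (auto simp: e_def)
  have e: "e \<longlonglongrightarrow> 0" unfolding e_def using LIMSEQ_inverse_real_of_nat by (simp add: inverse_eq_divide)
  define D where "D n x = (f (x + e n *\<^sub>R v) - f x) / e n" for n x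
  have cf: "continuous_on UNIV f" using C1_grad_continuous[OF f] .
  have cF: "continuous_on UNIV F" using C1_grad_continuous_grad[OF f] .
  have [measurable]: "f \<in> borel_measurable borel" using cf by (rule borel_measurable_continuous_onI)
  have [measurable]: "F \<in> borel_measurable borel" using cF by (rule borel_measurable_continuous_onI)
  have int_f: "integrable lborel f" by (rule integrable_continuous_bounded_support[OF cf supp])
  have int_s: "integrable lborel (\<lambda>x. f (x + a))" for a
  proof (rule integrable_continuous_bounded_support[of _ "r + norm a"])
    show "continuous_on UNIV (\<lambda>x. f (x + a))"
      by (rule continuous_on_compose2[OF cf]) (auto intro!: continuous_intros)
    show "f (x + a) = 0" if "r + norm a < norm x" for x
      using norm_triangle_ineq4[of "x + a" a] that by (intro supp) auto
  qed
  have D0: "integral\<^sup>L lborel (D n) = 0" for n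
    unfolding D_def using int_f int_s lborel_integral_shift[of f "e n *\<^sub>R v"] by simp
  \<comment> \<open>The difference quotients live on the ball of radius \<open>r + norm v\<close>,
    and the mean value point moves at most a further \<open>norm v\<close>.\<close>
  obtain M where M: "M > 0" "\<And>x. norm x \<le> r + 2 * norm v \<Longrightarrow> norm (F x) \<le> M"
    using bounded_on_ball[OF cF] by blast
  have bd: "norm (D n x) \<le> M * norm v * indicator (cball 0 (r + norm v)) x" for n x
  proof (cases "norm x \<le> r + norm v")
    case True
    have "\<exists>s>0. s < e n \<and> f (x + e n *\<^sub>R v) - f (x + 0 *\<^sub>R v) = (e n - 0) * (F (x + s *\<^sub>R v) \<bullet> v)"
      by (rule MVT2[OF e0(1)]) (rule C1_grad_has_vector_derivative[OF f])
    then obtain s where s: "s > 0" "s < e n" "f (x + e n *\<^sub>R v) - f x = e n * (F (x + s *\<^sub>R v) \<bullet> v)"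
      by auto
    have "norm (x + s *\<^sub>R v) \<le> norm x + s * norm v" using norm_triangle_ineq[of x "s *\<^sub>R v"] s by simp
    also have "\<dots> \<le> norm x + 1 * norm v" using s e0(2)[of n] by (intro add_left_mono mult_right_mono) auto
    finally have "norm (F (x + s *\<^sub>R v)) \<le> M" using True by (intro M(2)) auto
    then have "\<bar>F (x + s *\<^sub>R v) \<bullet> v\<bar> \<le> M * norm v"
      using Cauchy_Schwarz_ineq2[of "F (x + s *\<^sub>R v)" v] by (meson mult_right_mono norm_ge_zero order_trans)
    moreover have "D n x = F (x + s *\<^sub>R v) \<bullet> v" using s e0(1)[of n] by (simp add: D_def)
    ultimately show ?thesis using True by simp
  next
    case False
    have "e n * norm v \<le> 1 * norm v" using e0(2)[of n] by (intro mult_right_mono) auto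
    then have "norm (x + e n *\<^sub>R v) > r"
      using norm_triangle_ineq4[of "x + e n *\<^sub>R v" "e n *\<^sub>R v"] False e0(1)[of n] by simp
    moreover have "norm x > r" using False norm_ge_zero[of v] by linarith
    ultimately show ?thesis using supp False by (simp add: D_def)
  qed
  have "(\<lambda>n. integral\<^sup>L lborel (D n)) \<longlonglongrightarrow> (LBINT x. F x \<bullet> v)"
  proof (rule integral_dominated_convergence[where w="\<lambda>x. M * norm v * indicator (cball 0 (r + norm v)) x"])
    show "AE x in lborel. (\<lambda>n. D n x) \<longlonglongrightarrow> F x \<bullet> v"
    proof (rule AE_I2)
      fix x
      have "((\<lambda>t. (f (x + t *\<^sub>R v) - f x) / t) \<longlongrightarrow> F x \<bullet> v) (at 0)"
        using C1_grad_has_vector_derivative[OF f, of x v 0] by (simp add: DERIV_def)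
      moreover have "filterlim e (at 0) sequentially"
        using e e0(1) by (auto simp: filterlim_at less_imp_neq[symmetric])
      ultimately show "(\<lambda>n. D n x) \<longlonglongrightarrow> F x \<bullet> v"
        unfolding D_def by (rule filterlim_compose)
    qed
    show "AE x in lborel. norm (D n x) \<le> M * norm v * indicator (cball 0 (r + norm v)) x" for n
      using bd by auto
    show "integrable lborel (\<lambda>x. M * norm v * indicat_real (cball 0 (r + norm v)) x)"
      by (auto intro!: integrable_mult_right integrable_real_indicator emeasure_bounded_finite)
  qed (auto simp: D_def [abs_def])
  then have "(\<lambda>n. 0) \<longlonglongrightarrow> (LBINT x. F x \<bullet> v)" by (simp add: D0)
  then show ?thesis using LIMSEQ_unique tendsto_const by blast
qed

text \<open>The product has bounded support as soon as one factor has, so \<open>g\<close> may be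
  built from the solution itself; the derivative of the product integrates to 0.\<close>

lemma integration_by_parts:
  assumes f: "C1_grad f F" and g: "C1_grad g G" and supp: "\<And>x. norm x > r \<Longrightarrow> f x = 0"
  shows "(LBINT x. f x * (G x \<bullet> v)) = - (LBINT x. g x * (F x \<bullet> v))"
proof -
  note cont = C1_grad_continuous[OF f] C1_grad_continuous[OF g] C1_grad_continuous_grad[OF f] C1_grad_continuous_grad[OF g]
  have F0: "norm x > r \<Longrightarrow> F x = 0" for x using C1_grad_eq_0_outside[OF f supp] by blast
  have i: "integrable lborel (\<lambda>x. f x * (G x \<bullet> v))" "integrable lborel (\<lambda>x. g x * (F x \<bullet> v))"
    using supp F0
    by (auto intro!: integrable_continuous_bounded_support[where r=r] continuous_intros cont)
  have "(LBINT x. (f x *\<^sub>R G x + g x *\<^sub>R F x) \<bullet> v) = 0"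
    by (rule integral_derivative_eq_0[OF C1_grad_mult[OF f g], where r=r]) (simp add: supp)
  then have "(LBINT x. f x * (G x \<bullet> v) + g x * (F x \<bullet> v)) = 0"
    by (simp add: inner_add_left)
  with i show ?thesis by simp
qed

section \<open>Smooth bump functions\<close>

lemma Ck_SucD: "Ck (Suc k) f \<Longrightarrow> Ck k f"
proof (induction k arbitrary: f)
  case 0
  then show ?case by (simp add: differentiable_imp_continuous_on)
next
  case (Suc k)
  then show ?case using Ck.simps(2) by blast
qed

lemma Ck_const: "Ck k (\<lambda>x. c)"
  by (induction k arbitrary: c) simp_all

lemma Ck_SucI:
  assumes "\<And>x. (f has_derivative D x) (at x)" "\<And>v. Ck k (\<lambda>x. D x v)"
  shows "Ck (Suc k) f"
proof -
  have "frechet_derivative f (at x) = D x" for x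
    using frechet_derivative_at[OF assms(1)] by simp
  then show ?thesis using assms
    by (auto simp: differentiable_on_def differentiable_def)
qed

lemma Ck_SucE:
  assumes "Ck (Suc k) f"
  shows "(f has_derivative frechet_derivative f (at x)) (at x)" "Ck k (\<lambda>x. frechet_derivative f (at x) v)"
  using assms by (auto simp: differentiable_on_def frechet_derivative_works)

lemma Ck_add: "Ck k f \<Longrightarrow> Ck k g \<Longrightarrow> Ck k (\<lambda>x. f x + g x)"
proof (induction k arbitrary: f g)
  case (Suc k)
  show ?case
    by (rule Ck_SucI[OF has_derivative_add[OF Ck_SucE(1)[OF Suc.prems(1)] Ck_SucE(1)[OF Suc.prems(2)]]])
      (intro Suc.IH Ck_SucE(2)[OF Suc.prems(1)] Ck_SucE(2)[OF Suc.prems(2)])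
qed (simp add: continuous_on_add)

lemma Ck_mult:
  fixes f g :: "'a::real_normed_vector \<Rightarrow> real"
  shows "Ck k f \<Longrightarrow> Ck k g \<Longrightarrow> Ck k (\<lambda>x. f x * g x)"
proof (induction k arbitrary: f g)
  case (Suc k)
  show ?case
    by (rule Ck_SucI[OF has_derivative_mult[OF Ck_SucE(1)[OF Suc.prems(1)] Ck_SucE(1)[OF Suc.prems(2)]]])
      (intro Ck_add Suc.IH Ck_SucE(2)[OF Suc.prems(1)] Ck_SucE(2)[OF Suc.prems(2)] Ck_SucD[OF Suc.prems(1)] Ck_SucD[OF Suc.prems(2)])
qed (simp add: continuous_on_mult)

text \<open>The outer function comes with the whole sequence of its derivatives. The chain rule then
  only shifts \<open>n\<close>, and the induction needs no formula for higher derivatives of a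
  composition.\<close>

lemma Ck_compose_real:
  fixes h :: "nat \<Rightarrow> real \<Rightarrow> real" and s :: "'a::real_normed_vector \<Rightarrow> real"
  assumes h: "\<And>n t. (h n has_real_derivative h (Suc n) t) (at t)"
  shows "Ck k s \<Longrightarrow> Ck k (\<lambda>x. h n (s x))"
proof (induction k arbitrary: n)
  case 0
  have "continuous_on UNIV (h n)"
    using h by (meson DERIV_isCont continuous_at_imp_continuous_on)
  then show ?case using 0 by (auto intro: continuous_on_compose2)
next
  case (Suc k)
  have h': "(h n has_derivative (\<lambda>y. h (Suc n) t * y)) (at t)" for t
    using h by (simp add: has_field_derivative_def)
  show ?case
    by (rule Ck_SucI[OF has_derivative_compose[OF Ck_SucE(1)[OF Suc.prems] h']])
      (intro Ck_mult Suc.IH Ck_SucE(2)[OF Suc.prems] Ck_SucD[OF Suc.prems])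
qed

lemma Ck_inner: "Ck k (\<lambda>x. x \<bullet> v)"
proof (cases k)
  case (Suc l)
  show ?thesis unfolding Suc
    by (rule Ck_SucI[of _ "\<lambda>x h. h \<bullet> v"]) (auto intro!: derivative_eq_intros Ck_const)
qed (auto intro!: continuous_intros)

lemma Ck_inner_self: "Ck k (\<lambda>x. x \<bullet> x)"
proof (cases k)
  case (Suc l)
  show ?thesis unfolding Suc
    by (rule Ck_SucI[OF has_derivative_inner[OF has_derivative_ident has_derivative_ident]])
      (subst inner_commute, intro Ck_add Ck_inner)
qed (auto intro!: continuous_intros)

text \<open>Polynomials in 1/t times exp(-1/t), continued by 0, form a family closed under
  differentiation; the polynomial parameter lets one derivative formula serve all orders.\<close>

definition exp_bump :: "real poly \<Rightarrow> real \<Rightarrow> real" where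
  "exp_bump q t = (if t > 0 then poly q (1 / t) * exp (- (1 / t)) else 0)"

lemma poly_exp_tendsto_0: "((\<lambda>y. poly q y * exp (- y)) \<longlongrightarrow> 0) at_top" for q :: "real poly"
proof -
  have eq: "poly q y * exp (- y) = (\<Sum>i\<le>degree q. coeff q i * (y ^ i / exp y))" for y
    by (simp add: poly_altdef sum_distrib_right exp_minus divide_inverse mult.assoc)
  have "((\<lambda>y. \<Sum>i\<le>degree q. coeff q i * (y ^ i / exp y)) \<longlongrightarrow> (\<Sum>i\<le>degree q. coeff q i * 0)) at_top"
    by (intro tendsto_intros tendsto_power_div_exp_0)
  then show ?thesis by (simp add: eq)
qed

lemma exp_bump_DERIV:
  "(exp_bump q has_real_derivative exp_bump (monom 1 2 * (q - pderiv q)) t) (at t)"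
proof -
  consider "t > 0" | "t < 0" | "t = 0" by linarith
  then show ?thesis
  proof cases
    case 1
    have "((\<lambda>t. poly q (1 / t) * exp (- (1 / t))) has_real_derivative exp_bump (monom 1 2 * (q - pderiv q)) t) (at t)"
      using 1 by (auto intro!: derivative_eq_intros simp: exp_bump_def poly_monom field_simps power2_eq_square)
    then show ?thesis
      by (rule has_field_derivative_transform_within_open[of _ _ _ "{0<..}"])
        (use 1 in \<open>auto simp: exp_bump_def\<close>)
  next
    case 2
    have "((\<lambda>t. 0) has_real_derivative exp_bump (monom 1 2 * (q - pderiv q)) t) (at t)"
      using 2 by (simp add: exp_bump_def)
    then show ?thesis
      by (rule has_field_derivative_transform_within_open[of _ _ _ "{..<0}"])
        (use 2 in \<open>auto simp: exp_bump_def\<close>)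
  next
    case 3
    \<comment> \<open>Division by \<open>h\<close> multiplies the polynomial in 1/h by its variable,
      so the difference quotient from the right is of the same kind and decays as well.\<close>
    have "((\<lambda>h. poly ([:0, 1:] * q) (inverse h) * exp (- inverse h)) \<longlongrightarrow> 0) (at_right 0)"
      by (rule filterlim_compose[OF poly_exp_tendsto_0 filterlim_inverse_at_top_right])
    moreover have "\<forall>\<^sub>F h in at_right 0. poly ([:0, 1:] * q) (inverse h) * exp (- inverse h) = exp_bump q h / h"
      by (rule eventually_mono[OF eventually_at_right_less[of 0]]) (auto simp: exp_bump_def field_simps)
    ultimately have "((\<lambda>h. exp_bump q h / h) \<longlongrightarrow> 0) (at_right 0)"
      using tendsto_cong by force
    moreover have "((\<lambda>h. exp_bump q h / h) \<longlongrightarrow> 0) (at_left 0)"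
      by (rule tendsto_eventually, rule eventually_mono[OF eventually_at_left_real[of "-1"]]) (auto simp: exp_bump_def)
    ultimately have "((\<lambda>h. exp_bump q h / h) \<longlongrightarrow> 0) (at 0)"
      using filterlim_split_at by blast
    then show ?thesis using 3 by (simp add: DERIV_def exp_bump_def)
  qed
qed

primrec exp_bump_poly :: "nat \<Rightarrow> real poly" where
  "exp_bump_poly 0 = 1"
| "exp_bump_poly (Suc n) = monom 1 2 * (exp_bump_poly n - pderiv (exp_bump_poly n))"

lemma C1_grad_of_smooth:
  fixes f :: "'a::euclidean_space \<Rightarrow> real"
  assumes "Ck (Suc k) f"
  shows "C1_grad f (\<lambda>x. \<Sum>b\<in>Basis. frechet_derivative f (at x) b *\<^sub>R b)"
proof (rule C1_gradI)
  fix x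
  have d: "(f has_derivative frechet_derivative f (at x)) (at x)" using assms Ck_SucE(1) by blast
  have "frechet_derivative f (at x) h = (\<Sum>b\<in>Basis. frechet_derivative f (at x) b *\<^sub>R b) \<bullet> h" for h
  proof -
    have l: "linear (frechet_derivative f (at x))" using d has_derivative_linear by blast
    have "frechet_derivative f (at x) h = frechet_derivative f (at x) (\<Sum>b\<in>Basis. (h \<bullet> b) *\<^sub>R b)"
      by (simp add: euclidean_representation)
    also have "\<dots> = (\<Sum>b\<in>Basis. (h \<bullet> b) * frechet_derivative f (at x) b)"
      using l by (simp add: linear_sum linear_scale)
    finally show ?thesis by (simp add: inner_sum_left inner_commute[of h] mult.commute)
  qed
  then have "frechet_derivative f (at x) = (\<lambda>h. (\<Sum>b\<in>Basis. frechet_derivative f (at x) b *\<^sub>R b) \<bullet> h)" by blast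
  then show "(f has_derivative (\<lambda>h. (\<Sum>b\<in>Basis. frechet_derivative f (at x) b *\<^sub>R b) \<bullet> h)) (at x)"
    using d by metis
next
  have "Ck 0 (\<lambda>x. frechet_derivative f (at x) b)" for b
    using Ck_SucE(2)[OF assms] by (induction k) (auto dest: Ck_SucD simp del: Ck.simps)
  then show "continuous_on UNIV (\<lambda>x. \<Sum>b\<in>Basis. frechet_derivative f (at x) b *\<^sub>R b)"
    by (auto intro!: continuous_intros)
qed

definition mollifier :: "('a::euclidean_space \<Rightarrow> real) \<Rightarrow> real \<Rightarrow> bool" where
  "mollifier \<eta> \<epsilon> \<longleftrightarrow> smooth \<eta> \<and> (\<forall>x. 0 \<le> \<eta> x) \<and> (\<forall>x. norm x > \<epsilon> \<longrightarrow> \<eta> x = 0) \<and> integral\<^sup>L lborel \<eta> = 1"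

lemma smooth_C1_grad: "smooth f \<Longrightarrow> \<exists>F. C1_grad f F" for f :: "'a::euclidean_space \<Rightarrow> real"
  unfolding smooth_def using C1_grad_of_smooth by blast

text \<open>A nonempty open set is not negligible. This turns vanishing integrals of nonnegative
  densities into pointwise vanishing in all three vanishing results for \<open>u\<close>.\<close>

lemma AE_eq_0_imp_eq_0:
  fixes f :: "'a::euclidean_space \<Rightarrow> real"
  assumes "continuous_on UNIV f" "AE x in lborel. f x = 0"
  shows "f x = 0"
proof -
  have op: "open {x. f x \<noteq> 0}" using assms(1) by (intro open_Collect_neq continuous_intros)
  have "{x. f x \<noteq> 0} \<in> null_sets lborel"
    using assms(2) op by (subst AE_iff_null_sets) auto
  then have "negligible {x. f x \<noteq> 0}"
    using negligible_iff_null_sets null_sets_completionI by blast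
  with op have "{x. f x \<noteq> 0} = {}" using open_not_negligible by blast
  then show ?thesis by auto
qed

lemma mollifier_exists:
  assumes "\<epsilon> > 0"
  shows "\<exists>\<eta> :: 'a::euclidean_space \<Rightarrow> real. mollifier \<eta> \<epsilon>"
proof -
  define b :: "'a \<Rightarrow> real" where "b x = exp_bump 1 (\<epsilon>\<^sup>2 + - 1 * (x \<bullet> x))" for x
  have sm: "Ck k b" for k
  proof -
    have s: "Ck k (\<lambda>x::'a. \<epsilon>\<^sup>2 + - 1 * (x \<bullet> x))"
      by (intro Ck_add Ck_mult Ck_const Ck_inner_self)
    show ?thesis unfolding b_def
      using Ck_compose_real[of "\<lambda>n. exp_bump (exp_bump_poly n)", OF _ s, of 0] exp_bump_DERIV by simp
  qed
  have nonneg: "b x \<ge> 0" for x by (simp add: b_def exp_bump_def)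
  have supp: "b x = 0" if "norm x > \<epsilon>" for x
  proof -
    have "\<epsilon>\<^sup>2 < (norm x)\<^sup>2" using that assms by (intro power_strict_mono) auto
    then show ?thesis by (simp add: b_def exp_bump_def power2_norm_eq_inner)
  qed
  have cont: "continuous_on UNIV b" using sm[of 0] by simp
  have int: "integrable lborel b" by (rule integrable_continuous_bounded_support[OF cont supp])
  have "b 0 > 0" using assms by (simp add: b_def exp_bump_def)
  have c: "integral\<^sup>L lborel b > 0"
  proof (rule ccontr)
    assume "\<not> ?thesis"
    moreover have "integral\<^sup>L lborel b \<ge> 0" using nonneg by simp
    ultimately have "AE x in lborel. b x = 0"
      using integral_nonneg_eq_0_iff_AE[OF int] nonneg by auto
    from AE_eq_0_imp_eq_0[OF cont this, of 0] \<open>b 0 > 0\<close> show False by simp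
  qed
  have "mollifier (\<lambda>x. (1 / integral\<^sup>L lborel b) * b x) \<epsilon>"
    unfolding mollifier_def smooth_def using c nonneg supp int Ck_mult[OF Ck_const[of _ "1 / integral\<^sup>L lborel b"] sm]
    by simp
  then show ?thesis by blast
qed

section \<open>Mollification\<close>

lemma lborel_integral_reflect:
  fixes f :: "'a::euclidean_space \<Rightarrow> 'b::euclidean_space"
  assumes "f \<in> borel_measurable borel"
  shows "integral\<^sup>L lborel (\<lambda>y. f (x - y)) = integral\<^sup>L lborel f"
proof -
  have "(lborel::'a measure) = distr lborel borel (\<lambda>y. x + (-1) *\<^sub>R y)"
    by (subst lborel_affine[of "-1" x]) (simp_all add: density_1)
  then have "integral\<^sup>L lborel f = integral\<^sup>L (distr lborel borel (\<lambda>y. x - y)) f" by simp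
  also have "\<dots> = integral\<^sup>L lborel (\<lambda>y. f (x - y))"
    using assms by (intro integral_distr) auto
  finally show ?thesis ..
qed

text \<open>Rewrites convolutions as integrals over a fixed box, the setting of the Leibniz rule and
  of continuity in a parameter.\<close>

lemma lborel_integral_cbox:
  fixes f :: "'a::euclidean_space \<Rightarrow> 'b::euclidean_space"
  assumes "continuous_on UNIV f" "\<And>x. norm x > r \<Longrightarrow> f x = 0" "cball 0 r \<subseteq> cbox a b"
  shows "integral\<^sup>L lborel f = integral (cbox a b) f"
proof -
  have "integral\<^sup>L lborel f = integral UNIV f"
    using integral_lborel[OF integrable_continuous_bounded_support[OF assms(1,2)]] by simp
  also have "\<dots> = integral UNIV (\<lambda>x. if x \<in> cbox a b then f x else 0)"
  proof (rule arg_cong[of _ _ "integral UNIV"])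
    show "f = (\<lambda>x. if x \<in> cbox a b then f x else 0)"
      using assms(2,3) by (force simp: fun_eq_iff subset_iff)
  qed
  finally show ?thesis by (simp add: integral_restrict_UNIV)
qed

lemma C1_grad_convolution:
  fixes f :: "'a::euclidean_space \<Rightarrow> real"
  assumes f: "continuous_on UNIV f" "\<And>x. norm x > r \<Longrightarrow> f x = 0" and g: "C1_grad g G"
  shows "C1_grad (\<lambda>x. integral\<^sup>L lborel (\<lambda>y. f y * g (x - y))) (\<lambda>x. integral\<^sup>L lborel (\<lambda>y. f y *\<^sub>R G (x - y)))"
proof -
  obtain a b :: 'a where ab: "cball 0 r \<subseteq> cbox a b"
    using bounded_subset_cbox_symmetric[OF bounded_cball, of 0 r] by metis
  have cg: "continuous_on S (\<lambda>y. g (h y))" if "continuous_on S h" for h :: "'c::topological_space \<Rightarrow> 'a" and S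
    by (rule continuous_on_compose2[OF C1_grad_continuous[OF g, of UNIV] that]) auto
  have cG: "continuous_on S (\<lambda>y. G (h y))" if "continuous_on S h" for h :: "'c::topological_space \<Rightarrow> 'a" and S
    by (rule continuous_on_compose2[OF C1_grad_continuous_grad[OF g, of UNIV] that]) auto
  have cf: "continuous_on S (\<lambda>y. f (h y))" if "continuous_on S h" for h :: "'c::topological_space \<Rightarrow> 'a" and S
    by (rule continuous_on_compose2[OF f(1) that]) auto
  have e1: "integral\<^sup>L lborel (\<lambda>y. f y * g (x - y)) = integral (cbox a b) (\<lambda>y. f y * g (x - y))" for x
    by (rule lborel_integral_cbox[OF _ _ ab]) (auto simp: f(2) intro!: continuous_intros cf cg)
  have e2: "integral\<^sup>L lborel (\<lambda>y. f y *\<^sub>R G (x - y)) = integral (cbox a b) (\<lambda>y. f y *\<^sub>R G (x - y))" for x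
    by (rule lborel_integral_cbox[OF _ _ ab]) (auto simp: f(2) intro!: continuous_intros cf cG)
  have cG2: "continuous_on (UNIV \<times> cbox a b) (\<lambda>(x, y). f y *\<^sub>R G (x - y))"
    by (auto simp: case_prod_unfold intro!: continuous_intros cf cG)
  show ?thesis unfolding e1 e2
  proof (rule C1_gradI)
    fix x
    have "((\<lambda>x. integral (cbox a b) (\<lambda>y. f y * g (x - y))) has_derivative
      integral (cbox a b) (\<lambda>y. blinfun_inner_right (f y *\<^sub>R G (x - y)))) (at x within UNIV)"
    proof (rule leibniz_rule)
      show "((\<lambda>x. f y * g (x - y)) has_derivative blinfun_apply (blinfun_inner_right (f y *\<^sub>R G (x - y)))) (at x within UNIV)" for x y
        using C1_gradD[OF C1_grad_cmult[OF C1_grad_shift[OF g]], of "f y" y x]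
        by (simp add: inner_scaleR_left[symmetric] del: inner_scaleR_left)
      show "(\<lambda>y. f y * g (x - y)) integrable_on cbox a b" for x
        by (intro integrable_continuous continuous_intros cf cg)
      show "continuous_on (UNIV \<times> cbox a b) (\<lambda>(x, y). blinfun_inner_right (f y *\<^sub>R G (x - y)))"
        using bounded_linear.continuous_on[OF bounded_linear_blinfun_inner_right cG2]
        by (simp add: case_prod_unfold)
    qed auto
    moreover have "integral (cbox a b) (\<lambda>y. blinfun_inner_right (f y *\<^sub>R G (x - y)))
      = blinfun_inner_right (integral (cbox a b) (\<lambda>y. f y *\<^sub>R G (x - y)))"
      by (rule integral_linear[OF _ bounded_linear_blinfun_inner_right, unfolded o_def])
        (intro integrable_continuous continuous_intros cf cG)
    ultimately show "((\<lambda>x. integral (cbox a b) (\<lambda>y. f y * g (x - y))) has_derivative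
      (\<lambda>h. integral (cbox a b) (\<lambda>y. f y *\<^sub>R G (x - y)) \<bullet> h)) (at x)"
      by simp
  next
    show "continuous_on UNIV (\<lambda>x. integral (cbox a b) (\<lambda>y. f y *\<^sub>R G (x - y)))"
      by (rule integral_continuous_on_param[OF cG2])
  qed
qed

text \<open>All derivatives are thrown onto \<open>g\<close>: a directional derivative of the
  convolution is the convolution of the same \<open>f\<close> with a directional derivative of
  \<open>g\<close>, which is again smooth.\<close>

lemma smooth_convolution:
  fixes f :: "'a::euclidean_space \<Rightarrow> real"
  assumes f: "continuous_on UNIV f" "\<And>x. norm x > r \<Longrightarrow> f x = 0" and g: "smooth g"
  shows "smooth (\<lambda>x. integral\<^sup>L lborel (\<lambda>y. f y * g (x - y)))"
proof -
  have "smooth g \<Longrightarrow> Ck k (\<lambda>x. integral\<^sup>L lborel (\<lambda>y. f y * g (x - y)))" for k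
  proof (induction k arbitrary: g)
    case 0
    from smooth_C1_grad[OF 0] obtain G where "C1_grad g G" by blast
    from C1_grad_continuous[OF C1_grad_convolution[OF f this]] show ?case by simp
  next
    case (Suc k)
    from smooth_C1_grad[OF Suc.prems] obtain G where G: "C1_grad g G" by blast
    show ?case
    proof (rule Ck_SucI[OF C1_gradD[OF C1_grad_convolution[OF f G]]])
      fix v
      have cG: "continuous_on UNIV (\<lambda>y. G (x - y))" for x
        by (rule continuous_on_compose2[OF C1_grad_continuous_grad[OF G, of UNIV]]) (auto intro!: continuous_intros)
      have i: "integrable lborel (\<lambda>y. f y *\<^sub>R G (x - y))" for x
        by (rule integrable_continuous_bounded_support[where r=r]) (auto simp: f(2) intro!: continuous_intros f(1) cG)
      have e: "integral\<^sup>L lborel (\<lambda>y. f y *\<^sub>R G (x - y)) \<bullet> v = integral\<^sup>L lborel (\<lambda>y. f y * frechet_derivative g (at (x - y)) v)" for x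
        using integral_inner_left[OF i, of x v] by (simp add: C1_grad_frechet[OF G])
      have "smooth (\<lambda>x. frechet_derivative g (at x) v)"
        using Suc.prems Ck_SucE(2) unfolding smooth_def by blast
      from Suc.IH[OF this] show "Ck k (\<lambda>x. integral\<^sup>L lborel (\<lambda>y. f y *\<^sub>R G (x - y)) \<bullet> v)"
        unfolding e .
    qed
  qed
  with g show ?thesis by (simp add: smooth_def)
qed

lemma convolution_commute:
  fixes f g :: "'a::euclidean_space \<Rightarrow> real"
  assumes "continuous_on UNIV f" "continuous_on UNIV g"
  shows "integral\<^sup>L lborel (\<lambda>y. f y * g (x - y)) = integral\<^sup>L lborel (\<lambda>y. g y * f (x - y))"
proof -
  have [measurable]: "f \<in> borel_measurable borel" "g \<in> borel_measurable borel"
    using assms by (auto intro: borel_measurable_continuous_onI)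
  show ?thesis
    using lborel_integral_reflect[of "\<lambda>y. f y * g (x - y)" x] by (simp add: mult.commute)
qed

text \<open>An average against a probability density stays as close to \<open>c\<close> as the
  averaged values do. With \<open>c\<close> the expected limit this gives convergence, with
  \<open>c = 0\<close> the uniform bounds for dominated convergence.\<close>

lemma mollify_close:
  fixes f :: "'a::euclidean_space \<Rightarrow> 'b::euclidean_space"
  assumes \<eta>: "mollifier \<eta> \<epsilon>" and f: "continuous_on UNIV f"
    and close: "\<And>z. norm z \<le> \<epsilon> \<Longrightarrow> norm (f (x - z) - c) \<le> \<delta>"
  shows "norm (integral\<^sup>L lborel (\<lambda>z. \<eta> z *\<^sub>R f (x - z)) - c) \<le> \<delta>"
proof -
  have c\<eta>: "continuous_on UNIV \<eta>" using \<eta> unfolding mollifier_def smooth_def by (metis Ck.simps(1))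
  have supp: "norm z > \<epsilon> \<Longrightarrow> \<eta> z = 0" and nn: "\<eta> z \<ge> 0" for z using \<eta> by (auto simp: mollifier_def)
  have cf: "continuous_on UNIV (\<lambda>z. f (x - z))"
    by (rule continuous_on_compose2[OF f]) (auto intro!: continuous_intros)
  have i\<eta>: "integrable lborel \<eta>" by (rule integrable_continuous_bounded_support[OF c\<eta> supp])
  have i1: "integrable lborel (\<lambda>z. \<eta> z *\<^sub>R f (x - z))"
    by (rule integrable_continuous_bounded_support[where r=\<epsilon>]) (auto simp: supp intro!: continuous_intros c\<eta> cf)
  have i2: "integrable lborel (\<lambda>z. \<eta> z *\<^sub>R (f (x - z) - c))"
    by (rule integrable_continuous_bounded_support[where r=\<epsilon>]) (auto simp: supp intro!: continuous_intros c\<eta> cf)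
  have "integral\<^sup>L lborel (\<lambda>z. \<eta> z *\<^sub>R f (x - z)) - c = integral\<^sup>L lborel (\<lambda>z. \<eta> z *\<^sub>R f (x - z)) - integral\<^sup>L lborel (\<lambda>z. \<eta> z *\<^sub>R c)"
    using \<eta> i\<eta> by (simp add: mollifier_def)
  also have "\<dots> = integral\<^sup>L lborel (\<lambda>z. \<eta> z *\<^sub>R (f (x - z) - c))"
    using i1 i\<eta> by (simp add: scaleR_right_diff_distrib)
  also have "norm \<dots> \<le> integral\<^sup>L lborel (\<lambda>z. norm (\<eta> z *\<^sub>R (f (x - z) - c)))"
    by (rule integral_norm_bound)
  also have "\<dots> \<le> integral\<^sup>L lborel (\<lambda>z. \<eta> z * \<delta>)"
  proof (rule integral_mono)
    show "norm (\<eta> z *\<^sub>R (f (x - z) - c)) \<le> \<eta> z * \<delta>" for z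
      using close[of z] nn[of z] supp[of z] by (cases "norm z \<le> \<epsilon>") (auto intro: mult_left_mono)
  qed (use integrable_norm[OF i2] i\<eta> in simp_all)
  also have "\<dots> = \<delta>" using \<eta> i\<eta> by (simp add: mollifier_def)
  finally show ?thesis .
qed

lemma mollify_tendsto:
  fixes f :: "'a::euclidean_space \<Rightarrow> 'b::euclidean_space"
  assumes \<eta>: "\<And>n. mollifier (\<eta> n) (e n)" and e: "e \<longlonglongrightarrow> 0" and f: "continuous_on UNIV f"
  shows "(\<lambda>n. integral\<^sup>L lborel (\<lambda>z. \<eta> n z *\<^sub>R f (x - z))) \<longlonglongrightarrow> f x"
proof (rule LIMSEQ_I)
  fix \<delta> :: real assume "\<delta> > 0"
  have "isCont f x" using f by (simp add: continuous_on_eq_continuous_at)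
  then obtain d where d: "d > 0" "\<And>y. dist y x < d \<Longrightarrow> dist (f y) (f x) < \<delta> / 2"
    using \<open>\<delta> > 0\<close> unfolding continuous_at_eps_delta by (meson half_gt_zero)
  from LIMSEQ_D[OF e d(1)] obtain n0 where n0: "\<And>n. n \<ge> n0 \<Longrightarrow> norm (e n) < d" by auto
  have "norm (integral\<^sup>L lborel (\<lambda>z. \<eta> n z *\<^sub>R f (x - z)) - f x) < \<delta>" if "n \<ge> n0" for n
  proof -
    have "norm (integral\<^sup>L lborel (\<lambda>z. \<eta> n z *\<^sub>R f (x - z)) - f x) \<le> \<delta> / 2"
    proof (rule mollify_close[OF \<eta> f])
      fix z :: 'a assume "norm z \<le> e n"
      then have "dist (x - z) x < d" using n0[OF that] by (simp add: dist_norm)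
      from d(2)[OF this] show "norm (f (x - z) - f x) \<le> \<delta> / 2" by (simp add: dist_norm)
    qed
    with \<open>\<delta> > 0\<close> show ?thesis by simp
  qed
  then show "\<exists>n0. \<forall>n\<ge>n0. norm (integral\<^sup>L lborel (\<lambda>z. \<eta> n z *\<^sub>R f (x - z)) - f x) < \<delta>" by blast
qed

section \<open>Componentwise differentiability of vector-valued functions\<close>

lemma has_derivative_vec_nth:
  fixes f :: "'a::euclidean_space \<Rightarrow> real^'m"
  shows "(f has_derivative D) (at x) \<longleftrightarrow> (\<forall>i. ((\<lambda>x. f x $ i) has_derivative (\<lambda>h. D h $ i)) (at x))"
  unfolding has_derivative_componentwise_within[of f] by (auto simp: Basis_vec_def inner_axis)

lemma continuous_on_vec_nth_iff:
  fixes f :: "'a::t2_space \<Rightarrow> real^'m"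
  shows "continuous_on S f \<longleftrightarrow> (\<forall>i. continuous_on S (\<lambda>x. f x $ i))"
  unfolding continuous_on_componentwise[of S f] by (auto simp: Basis_vec_def inner_axis)

lemma Ck_vecI:
  fixes f :: "'a::euclidean_space \<Rightarrow> real^'m"
  shows "(\<And>i. Ck k (\<lambda>x. f x $ i)) \<Longrightarrow> Ck k f"
proof (induction k arbitrary: f)
  case 0
  then show ?case by (simp add: continuous_on_vec_nth_iff)
next
  case (Suc k)
  show ?case
  proof (rule Ck_SucI)
    show "(f has_derivative (\<lambda>h. \<chi> i. frechet_derivative (\<lambda>x. f x $ i) (at x) h)) (at x)" for x
      using Ck_SucE(1)[OF Suc.prems] by (simp add: has_derivative_vec_nth)
    show "Ck k (\<lambda>x. \<chi> i. frechet_derivative (\<lambda>x. f x $ i) (at x) v)" for v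
      using Ck_SucE(2)[OF Suc.prems] by (intro Suc.IH) simp
  qed
qed

lemma Ck_vec_nth:
  fixes f :: "'a::euclidean_space \<Rightarrow> real^'m"
  shows "Ck k f \<Longrightarrow> Ck k (\<lambda>x. f x $ i)"
proof (induction k arbitrary: f)
  case 0
  then show ?case by (simp add: continuous_on_vec_nth_iff)
next
  case (Suc k)
  show ?case
  proof (rule Ck_SucI)
    show "((\<lambda>x. f x $ i) has_derivative (\<lambda>h. frechet_derivative f (at x) h $ i)) (at x)" for x
      using Ck_SucE(1)[OF Suc.prems] has_derivative_vec_nth by blast
    show "Ck k (\<lambda>x. frechet_derivative f (at x) v $ i)" for v
      using Ck_SucE(2)[OF Suc.prems] by (intro Suc.IH) simp
  qed
qed

section \<open>The quadratic form on continuously differentiable test functions\<close>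

text \<open>A single integrand for the whole quadratic form. The double sum over \<open>i\<close>
  and \<open>j\<close> collapses to a square, and the gradients are passed explicitly so that
  mollified gradients can be inserted.\<close>

definition Q_density :: "real \<Rightarrow> (real^'n \<Rightarrow> real^'m) \<Rightarrow> (real^'n \<Rightarrow> real^'m) \<Rightarrow> ('m \<Rightarrow> real^'n \<Rightarrow> real^'n) \<Rightarrow> real^'n \<Rightarrow> real" where
  "Q_density p u \<phi> \<Phi> x = (\<Sum>i\<in>UNIV. \<Phi> i x \<bullet> \<Phi> i x) - norm (u x) powr (p - 1) * (\<phi> x \<bullet> \<phi> x)
     - (p - 1) * (norm (u x) powr (p - 3) * (u x \<bullet> \<phi> x)\<^sup>2)"

lemma norm_powr_mult_sq:
  fixes y :: "'a::real_normed_vector"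
  assumes "y \<noteq> 0"
  shows "norm y powr a * (norm y)\<^sup>2 = norm y powr (a + 2)"
  using assms by (simp add: powr_add powr_numeral)

text \<open>The exponent \<open>p - 3\<close> may be negative. Cauchy-Schwarz gains two powers of
  \<open>norm y\<close>, so the singular weight in the last term of the quadratic form is harmless
  at zeros of \<open>u\<close>.\<close>

lemma powr_inner_bound:
  fixes y z :: "'a::real_inner"
  shows "norm y powr (p - 3) * (y \<bullet> z)\<^sup>2 \<le> norm y powr (p - 1) * (z \<bullet> z)"
proof (cases "y = 0")
  case False
  have "(y \<bullet> z)\<^sup>2 \<le> (norm y)\<^sup>2 * (z \<bullet> z)"
    using Cauchy_Schwarz_ineq[of y z] by (simp add: power2_norm_eq_inner)
  then have "norm y powr (p - 3) * (y \<bullet> z)\<^sup>2 \<le> norm y powr (p - 3) * ((norm y)\<^sup>2 * (z \<bullet> z))"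
    by (intro mult_left_mono) auto
  also have "\<dots> = norm y powr (p - 1) * (z \<bullet> z)"
    using norm_powr_mult_sq[OF False, of "p - 3"] by (simp add: mult.assoc[symmetric])
  finally show ?thesis .
qed simp

lemma continuous_on_norm_powr:
  assumes "continuous_on S u" "a > 0"
  shows "continuous_on S (\<lambda>x. norm (u x) powr a)"
  using assms by (intro continuous_on_powr') (auto intro!: continuous_intros)

lemma integrable_bounded_by_continuous:
  fixes f g :: "'a::euclidean_space \<Rightarrow> real"
  assumes "f \<in> borel_measurable borel" "continuous_on UNIV g" "\<And>x. norm x > r \<Longrightarrow> g x = 0" "\<And>x. \<bar>f x\<bar> \<le> g x"
  shows "integrable lborel f"
proof (rule Bochner_Integration.integrable_bound[OF integrable_continuous_bounded_support[OF assms(2,3)]])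
  show "AE x in lborel. norm (f x) \<le> norm (g x)"
    using assms(4) by (intro AE_I2) (metis abs_ge_self order_trans real_norm_def)
qed (use assms in auto)

lemma Qform_eq_integral:
  fixes u \<phi> :: "real^'n \<Rightarrow> real^'m"
  assumes p: "p > 1" and u: "continuous_on UNIV u"
    and \<phi>: "\<And>i. C1_grad (\<lambda>x. \<phi> x $ i) (\<Phi> i)" and supp: "\<And>x. norm x > r \<Longrightarrow> \<phi> x = 0"
  shows "integrable lborel (Q_density p u \<phi> \<Phi>)" "Qform p u \<phi> = integral\<^sup>L lborel (Q_density p u \<phi> \<Phi>)"
proof -
  have supp_i: "norm x > r \<Longrightarrow> \<phi> x $ i = 0" for x i using supp by simp
  have supp_g: "norm x > r \<Longrightarrow> \<Phi> i x = 0" for x i by (rule C1_grad_eq_0_outside[OF \<phi> supp_i])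
  have ci: "continuous_on UNIV (\<lambda>x. \<phi> x $ i)" "continuous_on UNIV (\<Phi> i)" "continuous_on UNIV (\<lambda>x. u x $ i)" for i
    using C1_grad_continuous[OF \<phi>] C1_grad_continuous_grad[OF \<phi>] u by (auto simp: continuous_on_vec_nth_iff)
  have cw: "continuous_on UNIV (\<lambda>x. norm (u x) powr (p - 1))"
    using p by (intro continuous_on_norm_powr u) auto
  have [measurable]: "u \<in> borel_measurable borel" "(\<lambda>x. u x $ i) \<in> borel_measurable borel"
    "(\<lambda>x. \<phi> x $ i) \<in> borel_measurable borel" for i
    using u ci by (auto intro!: borel_measurable_continuous_onI)
  have a: "integrable lborel (\<lambda>x. \<Phi> i x \<bullet> \<Phi> i x)" for i
    by (rule integrable_continuous_bounded_support[where r=r]) (auto intro!: continuous_intros ci simp: supp_g)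
  have b: "integrable lborel (\<lambda>x. norm (u x) powr (p - 1) * (\<phi> x $ i)\<^sup>2)" for i
    by (rule integrable_continuous_bounded_support[where r=r]) (auto intro!: continuous_intros ci cw simp: supp)
  \<comment> \<open>For p <= 3 the weight may be discontinuous at zeros of \<open>u\<close>, so this
    integrand is treated by measurability and domination rather than by continuity.\<close>
  have c: "integrable lborel (\<lambda>x. norm (u x) powr (p - 3) * u x $ i * u x $ j * \<phi> x $ i * \<phi> x $ j)" for i j
  proof (rule integrable_bounded_by_continuous[where r=r and g = "\<lambda>x. norm (u x) powr (p - 1) * (\<bar>\<phi> x $ i\<bar> * \<bar>\<phi> x $ j\<bar>)"])
    show "(\<lambda>x. norm (u x) powr (p - 3) * u x $ i * u x $ j * \<phi> x $ i * \<phi> x $ j) \<in> borel_measurable borel"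
      by measurable
    show "\<bar>norm (u x) powr (p - 3) * u x $ i * u x $ j * \<phi> x $ i * \<phi> x $ j\<bar> \<le> norm (u x) powr (p - 1) * (\<bar>\<phi> x $ i\<bar> * \<bar>\<phi> x $ j\<bar>)" for x
    proof (cases "u x = 0")
      case False
      have "\<bar>u x $ i\<bar> * \<bar>u x $ j\<bar> \<le> (norm (u x))\<^sup>2"
        using component_le_norm_cart[of "u x"] by (simp add: power2_eq_square mult_mono)
      then have "norm (u x) powr (p - 3) * (\<bar>u x $ i\<bar> * \<bar>u x $ j\<bar>) \<le> norm (u x) powr (p - 3) * (norm (u x))\<^sup>2"
        by (intro mult_left_mono) auto
      also have "\<dots> = norm (u x) powr (p - 1)"
        using norm_powr_mult_sq[OF False, of "p - 3"] by simp
      finally have "norm (u x) powr (p - 3) * (\<bar>u x $ i\<bar> * \<bar>u x $ j\<bar>) * (\<bar>\<phi> x $ i\<bar> * \<bar>\<phi> x $ j\<bar>)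
         \<le> norm (u x) powr (p - 1) * (\<bar>\<phi> x $ i\<bar> * \<bar>\<phi> x $ j\<bar>)"
        by (rule mult_right_mono) auto
      then show ?thesis by (simp add: abs_mult mult.assoc)
    qed simp
  qed (auto intro!: continuous_intros ci cw simp: supp)
  have Qd: "Q_density p u \<phi> \<Phi> x = (\<Sum>i\<in>UNIV. \<Phi> i x \<bullet> \<Phi> i x) - (\<Sum>i\<in>UNIV. norm (u x) powr (p - 1) * (\<phi> x $ i)\<^sup>2)
    - (p - 1) * (\<Sum>i\<in>UNIV. \<Sum>j\<in>UNIV. norm (u x) powr (p - 3) * u x $ i * u x $ j * \<phi> x $ i * \<phi> x $ j)" for x
  proof -
    have "norm (u x) powr (p - 3) * (u x \<bullet> \<phi> x)\<^sup>2 = (\<Sum>i\<in>UNIV. \<Sum>j\<in>UNIV. norm (u x) powr (p - 3) * u x $ i * u x $ j * \<phi> x $ i * \<phi> x $ j)"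
      unfolding inner_vec_def power2_eq_square sum_product sum_distrib_left
      by (intro sum.cong refl) (simp add: sum_distrib_left mult_ac)
    moreover have "norm (u x) powr (p - 1) * (\<phi> x \<bullet> \<phi> x) = (\<Sum>i\<in>UNIV. norm (u x) powr (p - 1) * (\<phi> x $ i)\<^sup>2)"
      unfolding inner_vec_def power2_eq_square sum_distrib_left by simp
    ultimately show ?thesis by (simp add: Q_density_def)
  qed
  show "integrable lborel (Q_density p u \<phi> \<Phi>)"
    unfolding Qd[abs_def] using a b c by auto
  show "Qform p u \<phi> = integral\<^sup>L lborel (Q_density p u \<phi> \<Phi>)"
    unfolding Qd[abs_def] Qform_def C1_grad_grad_sq[OF \<phi>] using a b c by simp
qed

text \<open>The margin \<open>1\<close> in the last assumption leaves room for mollifying \<open>\<phi>\<close>.\<close>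

lemma Qform_C1_nonneg:
  fixes u \<phi> :: "real^'n \<Rightarrow> real^'m"
  assumes p: "p > 1" and u: "continuous_on UNIV u"
    and stab: "\<And>\<phi>. test_fun \<phi> \<Longrightarrow> (\<And>x. norm x < R0 \<Longrightarrow> \<phi> x = 0) \<Longrightarrow> Qform p u \<phi> \<ge> 0"
    and \<phi>: "\<And>i. C1_grad (\<lambda>x. \<phi> x $ i) (\<Phi> i)" and supp: "\<And>x. norm x > r \<Longrightarrow> \<phi> x = 0"
    and supp0: "\<And>x. norm x < R0 + 1 \<Longrightarrow> \<phi> x = 0"
  shows "integral\<^sup>L lborel (Q_density p u \<phi> \<Phi>) \<ge> 0"
proof -
  define e where "e n = 1 / real (Suc n)" for n
  have e0: "0 < e n" "e n \<le> 1" for n by (auto simp: e_def)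
  have e: "e \<longlonglongrightarrow> 0" unfolding e_def using LIMSEQ_inverse_real_of_nat by (simp add: inverse_eq_divide)
  obtain \<eta> :: "nat \<Rightarrow> real^'n \<Rightarrow> real" where \<eta>: "mollifier (\<eta> n) (e n)" for n
    using mollifier_exists[OF e0(1)] by metis
  have \<eta>0: "norm z > e n \<Longrightarrow> \<eta> n z = 0" for n z using \<eta> by (auto simp: mollifier_def)
  have sm: "smooth (\<eta> n)" for n using \<eta> by (auto simp: mollifier_def)
  have c\<eta>: "continuous_on UNIV (\<eta> n)" for n using sm[of n] unfolding smooth_def by (metis Ck.simps(1))
  have supp_i: "norm x > r \<Longrightarrow> \<phi> x $ i = 0" for x i using supp by simp
  have supp_g: "norm x > r \<Longrightarrow> \<Phi> i x = 0" for x i by (rule C1_grad_eq_0_outside[OF \<phi> supp_i])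
  have c\<phi>: "continuous_on UNIV (\<lambda>x. \<phi> x $ i)" for i using C1_grad_continuous[OF \<phi>] .
  have c\<Phi>: "continuous_on UNIV (\<Phi> i)" for i using C1_grad_continuous_grad[OF \<phi>] .
  define \<psi> where "\<psi> n x = (\<chi> i. integral\<^sup>L lborel (\<lambda>y. \<phi> y $ i * \<eta> n (x - y)))" for n x
  define \<Psi> where "\<Psi> n i x = integral\<^sup>L lborel (\<lambda>z. \<eta> n z *\<^sub>R \<Phi> i (x - z))" for n i x
  \<comment> \<open>The convolution is read in two ways: with the kernel carrying the derivatives it
    is smooth, and with \<phi> carrying them its gradient is the mollified gradient, which converges
    to \<open>\<Phi>\<close>.\<close>
  have \<psi>: "\<psi> n x $ i = integral\<^sup>L lborel (\<lambda>z. \<eta> n z *\<^sub>R (\<phi> (x - z) $ i))" for n x i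
    using convolution_commute[OF c\<phi> c\<eta>] by (simp add: \<psi>_def)
  have grad: "C1_grad (\<lambda>x. \<psi> n x $ i) (\<Psi> n i)" for n i
    using C1_grad_convolution[OF c\<eta> \<eta>0 \<phi>] unfolding \<psi> \<Psi>_def[abs_def] by simp
  have shift: "norm x - e n \<le> norm (x - z)" "norm (x - z) \<le> norm x + e n" if "norm z \<le> e n" for x z :: "real^'n" and n
    using norm_triangle_ineq2[of x z] norm_triangle_ineq4[of x z] that by auto
  have van: "\<psi> n x = 0" if "\<And>z. norm z \<le> e n \<Longrightarrow> \<phi> (x - z) = 0" for n x
  proof (rule vec_eq_iff[THEN iffD2], rule allI)
    fix i
    have "\<eta> n z *\<^sub>R (\<phi> (x - z) $ i) = 0" for z
      using that[of z] \<eta>0[of n z] by (cases "norm z \<le> e n") auto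
    then show "\<psi> n x $ i = 0 $ i" by (simp only: \<psi>) simp
  qed
  have out: "\<psi> n x = 0" if "norm x > r + 1" for n x
    using shift(1)[of _ n x] e0[of n] that by (intro van supp) force
  have "in": "\<psi> n x = 0" if "norm x < R0" for n x
    using shift(2)[of _ n x] e0[of n] that by (intro van supp0) force
  have test: "test_fun (\<psi> n)" for n
  proof -
    have "smooth (\<lambda>x. \<psi> n x $ i)" for i
      using smooth_convolution[OF c\<phi> supp_i sm] by (simp add: \<psi>_def)
    then have "smooth (\<psi> n)" unfolding smooth_def using Ck_vecI by blast
    moreover have "{x. \<psi> n x \<noteq> 0} \<subseteq> cball 0 (r + 1)" using out by force
    then have "bounded {x. \<psi> n x \<noteq> 0}" by (rule bounded_subset[OF bounded_cball])
    then have "compact (closure {x. \<psi> n x \<noteq> 0})" by simp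
    ultimately show ?thesis by (simp add: test_fun_def)
  qed
  have Q: "integral\<^sup>L lborel (Q_density p u (\<psi> n) (\<Psi> n)) \<ge> 0" for n
    using Qform_eq_integral(2)[OF p u grad out] stab[OF test "in"] by simp
  have "\<exists>M. M > 0 \<and> (\<forall>x. norm (\<phi> x $ i) \<le> M \<and> norm (\<Phi> i x) \<le> M)" for i
  proof -
    obtain M1 where M1: "M1 > 0" "\<And>x. norm x \<le> r \<Longrightarrow> norm (\<phi> x $ i) \<le> M1" by (rule bounded_on_ball[OF c\<phi>]) blast
    obtain M2 where M2: "M2 > 0" "\<And>x. norm x \<le> r \<Longrightarrow> norm (\<Phi> i x) \<le> M2" by (rule bounded_on_ball[OF c\<Phi>]) blast
    have "norm (\<phi> x $ i) \<le> max M1 M2 \<and> norm (\<Phi> i x) \<le> max M1 M2" for x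
      using M1 M2 supp_g[of x i] supp[of x] by (cases "norm x \<le> r") (force simp: le_max_iff_disj)+
    then show ?thesis using M1(1) by (intro exI[of _ "max M1 M2"]) auto
  qed
  then obtain M where M: "M i > 0" "\<And>x. norm (\<phi> x $ i) \<le> M i" "\<And>x. norm (\<Phi> i x) \<le> M i" for i by metis
  have bd: "norm (\<psi> n x $ i) \<le> M i" "norm (\<Psi> n i x) \<le> M i" for n x i
    using mollify_close[OF \<eta> c\<phi>[of i], where c=0 and \<delta>="M i"] mollify_close[OF \<eta> c\<Phi>[of i], where c=0 and \<delta>="M i"] M
    by (auto simp: \<psi> \<Psi>_def)
  have cw: "continuous_on UNIV (\<lambda>x. norm (u x) powr (p - 1))"
    using p by (intro continuous_on_norm_powr u) auto
  obtain U where U: "U > 0" "\<And>x. norm x \<le> r + 1 \<Longrightarrow> norm (norm (u x) powr (p - 1)) \<le> U"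
    by (rule bounded_on_ball[OF cw]) blast
  define S where "S = (\<Sum>i\<in>UNIV. (M i)\<^sup>2)"
  have S0: "S \<ge> 0" by (simp add: S_def sum_nonneg)
  have s1: "\<psi> n x \<bullet> \<psi> n x \<le> S" for n x
  proof -
    have "\<psi> n x $ i * \<psi> n x $ i \<le> (M i)\<^sup>2" for i
      using power_mono[OF bd(1)[where n=n and x=x and i=i], of 2] by (simp add: power2_eq_square)
    then show ?thesis unfolding S_def inner_vec_def by (auto intro: sum_mono)
  qed
  have s2: "(\<Sum>i\<in>UNIV. \<Psi> n i x \<bullet> \<Psi> n i x) \<le> S" for n x
  proof -
    have "\<Psi> n i x \<bullet> \<Psi> n i x \<le> (M i)\<^sup>2" for i
      using power_mono[OF bd(2)[where n=n and x=x and i=i], of 2] by (simp add: power2_norm_eq_inner)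
    then show ?thesis unfolding S_def by (intro sum_mono)
  qed
  have bdQ: "norm (Q_density p u (\<psi> n) (\<Psi> n) x) \<le> (S + U * S + (p - 1) * (U * S)) * indicator (cball 0 (r + 1)) x" for n x
  proof (cases "norm x \<le> r + 1")
    case True
    have a: "norm (u x) powr (p - 1) * (\<psi> n x \<bullet> \<psi> n x) \<le> U * S"
      using U True s1 by (intro mult_mono) auto
    have b: "norm (u x) powr (p - 3) * (u x \<bullet> \<psi> n x)\<^sup>2 \<le> U * S"
      using powr_inner_bound a order_trans by blast
    have c: "(p - 1) * (norm (u x) powr (p - 3) * (u x \<bullet> \<psi> n x)\<^sup>2) \<le> (p - 1) * (U * S)"
      using b p by (intro mult_left_mono) auto
    have "0 \<le> (\<Sum>i\<in>UNIV. \<Psi> n i x \<bullet> \<Psi> n i x)" "0 \<le> norm (u x) powr (p - 1) * (\<psi> n x \<bullet> \<psi> n x)"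
      "0 \<le> (p - 1) * (norm (u x) powr (p - 3) * (u x \<bullet> \<psi> n x)\<^sup>2)"
      using p by (auto intro!: sum_nonneg mult_nonneg_nonneg)
    then have "\<bar>Q_density p u (\<psi> n) (\<Psi> n) x\<bar> \<le> S + U * S + (p - 1) * (U * S)"
      using a c s2[of n x] unfolding Q_density_def by linarith
    then show ?thesis using True by simp
  next
    case False
    have "\<psi> n x $ i = 0" if "norm x > r + 1" for x i using out[OF that] by simp
    then have "\<Psi> n i x = 0" for i using False by (intro C1_grad_eq_0_outside[OF grad, of "r + 1"]) auto
    then show ?thesis using False out by (simp add: Q_density_def)
  qed
  have "(\<lambda>n. integral\<^sup>L lborel (Q_density p u (\<psi> n) (\<Psi> n))) \<longlonglongrightarrow> integral\<^sup>L lborel (Q_density p u \<phi> \<Phi>)"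
  proof (rule integral_dominated_convergence[where w="\<lambda>x. (S + U * S + (p - 1) * (U * S)) * indicator (cball 0 (r + 1)) x"])
    show "AE x in lborel. (\<lambda>n. Q_density p u (\<psi> n) (\<Psi> n) x) \<longlonglongrightarrow> Q_density p u \<phi> \<Phi> x"
    proof (rule AE_I2)
      fix x
      have 1: "(\<lambda>n. \<Psi> n i x) \<longlonglongrightarrow> \<Phi> i x" for i
        unfolding \<Psi>_def by (rule mollify_tendsto[OF \<eta> e c\<Phi>])
      have 2: "(\<lambda>n. \<psi> n x) \<longlonglongrightarrow> \<phi> x"
        by (rule vec_tendstoI) (simp only: \<psi>, rule mollify_tendsto[OF \<eta> e c\<phi>])
      show "(\<lambda>n. Q_density p u (\<psi> n) (\<Psi> n) x) \<longlonglongrightarrow> Q_density p u \<phi> \<Phi> x"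
        unfolding Q_density_def by (intro tendsto_intros 1 2)
    qed
    show "AE x in lborel. norm (Q_density p u (\<psi> n) (\<Psi> n) x) \<le> (S + U * S + (p - 1) * (U * S)) * indicator (cball 0 (r + 1)) x" for n
      using bdQ by (intro AE_I2)
    show "integrable lborel (\<lambda>x. (S + U * S + (p - 1) * (U * S)) * indicat_real (cball 0 (r + 1)) x)"
      by (auto intro!: integrable_mult_right integrable_real_indicator emeasure_bounded_finite)
    show "Q_density p u \<phi> \<Phi> \<in> borel_measurable lborel"
      using Qform_eq_integral(1)[OF p u \<phi> supp] by simp
    show "Q_density p u (\<psi> n) (\<Psi> n) \<in> borel_measurable lborel" for n
      using Qform_eq_integral(1)[OF p u grad out] by simp
  qed
  then show ?thesis using Q by (intro LIMSEQ_le_const) auto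
qed

section \<open>Finite Morse index implies stability outside a ball\<close>

lemma test_fun_C1:
  fixes \<phi> :: "real^'n \<Rightarrow> real^'m"
  assumes "test_fun \<phi>"
  obtains \<Phi> where "\<And>i. C1_grad (\<lambda>x. \<phi> x $ i) (\<Phi> i)"
proof -
  have "smooth (\<lambda>x. \<phi> x $ i)" for i
    using assms Ck_vec_nth unfolding test_fun_def smooth_def by blast
  then have "\<forall>i. \<exists>\<Phi>. C1_grad (\<lambda>x. \<phi> x $ i) \<Phi>" using smooth_C1_grad by blast
  then obtain \<Phi> where "\<forall>i. C1_grad (\<lambda>x. \<phi> x $ i) (\<Phi> i)" by metis
  with that show ?thesis by blast
qed

lemma test_fun_bounded_support:
  fixes \<phi> :: "real^'n \<Rightarrow> real^'m"
  assumes "test_fun \<phi>"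
  shows "\<exists>r>R. \<forall>x. norm x > r \<longrightarrow> \<phi> x = 0"
proof -
  have "bounded {x. \<phi> x \<noteq> 0}"
    using assms compact_imp_bounded bounded_subset closure_subset unfolding test_fun_def by metis
  then obtain b where b: "\<forall>x\<in>{x. \<phi> x \<noteq> 0}. norm x \<le> b" unfolding bounded_iff by blast
  show ?thesis
  proof (intro exI conjI allI impI)
    show "R < max (R + 1) b" by simp
    show "\<phi> x = 0" if "norm x > max (R + 1) b" for x using b that by force
  qed
qed

text \<open>\<open>b R\<close> will bound the support of a test function of negative energy that
  vanishes inside radius \<open>R\<close>. The additional 1 leaves a gap, so that the closed shells
  between \<open>r n\<close> and \<open>b (r n)\<close> are disjoint.\<close>

primrec iterate_bound :: "(real \<Rightarrow> real) \<Rightarrow> nat \<Rightarrow> real" where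
  "iterate_bound b 0 = 0"
| "iterate_bound b (Suc n) = b (iterate_bound b n) + 1"

lemma sum_only_one:
  fixes f :: "nat \<Rightarrow> 'a::comm_monoid_add"
  assumes "l < k" "\<And>j. j \<noteq> l \<Longrightarrow> f j = 0"
  shows "sum f {..<k} = f l"
proof -
  have "sum f {..<k} = sum f {l}"
    using assms by (intro sum.mono_neutral_right) auto
  then show ?thesis by simp
qed

text \<open>Where at most one of the functions and its gradients is nonzero, the density has no
  cross terms and is additive with squared coefficients. The index \<open>l\<close> may lie beyond
  \<open>k\<close>, and then both sides vanish.\<close>

lemma Qdens_disjoint_sum:
  fixes k :: nat
  assumes "\<And>j. j \<noteq> l \<Longrightarrow> \<phi> j x = 0" "\<And>j i. j \<noteq> l \<Longrightarrow> \<Phi> j i x = 0"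
  shows "Q_density p u (\<lambda>x. \<Sum>j<k. c j *\<^sub>R \<phi> j x) (\<lambda>i x. \<Sum>j<k. c j *\<^sub>R \<Phi> j i x) x
    = (\<Sum>j<k. (c j)\<^sup>2 * Q_density p u (\<phi> j) (\<Phi> j) x)"
proof (cases "l < k")
  case True
  have "(\<Sum>j<k. c j *\<^sub>R \<phi> j x) = c l *\<^sub>R \<phi> l x"
    by (rule sum_only_one[OF True]) (simp add: assms)
  moreover have "(\<Sum>j<k. c j *\<^sub>R \<Phi> j i x) = c l *\<^sub>R \<Phi> l i x" for i
    by (rule sum_only_one[OF True]) (simp add: assms)
  moreover have "(\<Sum>j<k. (c j)\<^sup>2 * Q_density p u (\<phi> j) (\<Phi> j) x) = (c l)\<^sup>2 * Q_density p u (\<phi> l) (\<Phi> l) x"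
    by (rule sum_only_one[OF True]) (simp add: assms Q_density_def)
  ultimately show ?thesis
    by (simp add: Q_density_def algebra_simps power2_eq_square sum_distrib_left)
next
  case False
  then have "\<phi> j x = 0" "\<Phi> j i x = 0" if "j < k" for i j using assms that by auto
  then show ?thesis by (simp add: Q_density_def)
qed

lemma finite_morse_index_stable_outside:
  fixes u :: "real^'n \<Rightarrow> real^'m"
  assumes p: "p > 1" and u: "continuous_on UNIV u" and fmi: "finite_morse_index p u"
  shows "\<exists>R0\<ge>0. \<forall>\<phi>. test_fun \<phi> \<longrightarrow> (\<forall>x. norm x < R0 \<longrightarrow> \<phi> x = 0) \<longrightarrow> Qform p u \<phi> \<ge> 0"
proof (rule ccontr)
  assume neg: "\<not> ?thesis"
  \<comment> \<open>The restriction to nonnegative radii is moved below the quantifiers, so that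
    choice functions \<open>f\<close> and \<open>b\<close> on all reals can be extracted.\<close>
  have "\<exists>\<phi> b. R \<ge> 0 \<longrightarrow> test_fun \<phi> \<and> (\<forall>x. norm x < R \<longrightarrow> \<phi> x = 0) \<and> Qform p u \<phi> < 0 \<and> b > R \<and> (\<forall>x. norm x > b \<longrightarrow> \<phi> x = 0)" for R
  proof (cases "R \<ge> 0")
    case True
    then have "\<exists>\<phi>. test_fun \<phi> \<and> (\<forall>x. norm x < R \<longrightarrow> \<phi> x = 0) \<and> Qform p u \<phi> < 0"
      using neg by (metis not_le)
    then obtain \<phi> where 1: "test_fun \<phi>" "\<forall>x. norm x < R \<longrightarrow> \<phi> x = 0" "Qform p u \<phi> < 0"
      by blast
    from test_fun_bounded_support[OF 1(1), of R] obtain b where "b > R" "\<forall>x. norm x > b \<longrightarrow> \<phi> x = 0"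
      by blast
    with 1 show ?thesis by blast
  qed auto
  then obtain f b where fb: "\<And>R. R \<ge> 0 \<Longrightarrow> test_fun (f R) \<and> (\<forall>x. norm x < R \<longrightarrow> f R x = 0) \<and> Qform p u (f R) < 0 \<and> b R > R \<and> (\<forall>x. norm x > b R \<longrightarrow> f R x = 0)"
    by metis
  define r where "r = iterate_bound b"
  have r0: "r n \<ge> 0" for n
  proof (induction n)
    case (Suc n)
    then show ?case using fb[of "r n"] by (simp add: r_def)
  qed (simp add: r_def)
  have r_Suc: "r (Suc n) = b (r n) + 1" for n by (simp add: r_def)
  have "r n < r (Suc n)" for n using fb[OF r0[of n]] r_Suc[of n] by simp
  then have r_mono: "m \<le> n \<Longrightarrow> r m \<le> r n" for m n by (rule lift_Suc_mono_le[OF less_imp_le])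
  define \<phi> where "\<phi> l = f (r l)" for l
  have \<phi>: "test_fun (\<phi> l)" "\<And>x. norm x < r l \<Longrightarrow> \<phi> l x = 0" "Qform p u (\<phi> l) < 0" "\<And>x. norm x > b (r l) \<Longrightarrow> \<phi> l x = 0" for l
    using fb[OF r0[of l]] by (auto simp: \<phi>_def)
  have "\<forall>l. \<exists>\<Phi>. \<forall>i. C1_grad (\<lambda>x. \<phi> l x $ i) (\<Phi> i)"
    using test_fun_C1[OF \<phi>(1)] by metis
  then obtain \<Phi> where \<Phi>: "\<And>l i. C1_grad (\<lambda>x. \<phi> l x $ i) (\<Phi> l i)" by metis
  have zero: "\<phi> l x = 0 \<and> (\<forall>i. \<Phi> l i x = 0)" if "norm x < r l \<or> norm x > b (r l)" for l x
  proof
    show "\<phi> l x = 0" using that \<phi>(2,4) by blast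
    have "open ({x. norm x < r l} \<union> {x. norm x > b (r l)})"
      by (intro open_Un open_Collect_less continuous_intros)
    then show "\<forall>i. \<Phi> l i x = 0"
      using \<phi>(2) \<phi>(4) that by (intro allI C1_grad_eq_0[OF \<Phi>, of "{x. norm x < r l} \<union> {x. norm x > b (r l)}"]) auto
  qed
  have "\<exists>l. \<forall>j. j \<noteq> l \<longrightarrow> \<phi> j x = 0 \<and> (\<forall>i. \<Phi> j i x = 0)" for x
  proof (cases "\<exists>l. r l \<le> norm x \<and> norm x \<le> b (r l)")
    case True
    then obtain l where l: "r l \<le> norm x" "norm x \<le> b (r l)" by blast
    have "norm x < r j \<or> norm x > b (r j)" if "j \<noteq> l" for j
    proof (cases "j < l")
      case True
      then have "r (Suc j) \<le> r l" by (intro r_mono) auto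
      then show ?thesis using l r_Suc[of j] by linarith
    next
      case False
      then have "r (Suc l) \<le> r j" using that by (intro r_mono) auto
      then show ?thesis using l r_Suc[of l] by linarith
    qed
    then show ?thesis using zero by blast
  next
    case False
    then show ?thesis using zero by (meson not_le)
  qed
  then obtain L where L: "\<And>x j i. j \<noteq> L x \<Longrightarrow> \<phi> j x = 0" "\<And>x j i. j \<noteq> L x \<Longrightarrow> \<Phi> j i x = 0" by metis
  have "morse_index_ge p u k" for k
    unfolding morse_index_ge_def
  proof (intro exI[of _ \<phi>] conjI allI impI \<phi>(1))
    fix c :: "nat \<Rightarrow> real" assume "\<exists>l<k. c l \<noteq> 0"
    then obtain l where l: "l < k" "c l \<noteq> 0" by blast
    have grad: "C1_grad (\<lambda>x. (\<Sum>j<k. c j *\<^sub>R \<phi> j x) $ i) (\<lambda>x. \<Sum>j<k. c j *\<^sub>R \<Phi> j i x)" for i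
      unfolding sum_component vector_scaleR_component real_scaleR_def by (intro C1_grad_sum C1_grad_cmult \<Phi>)
    have supp: "(\<Sum>j<k. c j *\<^sub>R \<phi> j x) = 0" if "norm x > r k" for x
    proof -
      have "\<phi> j x = 0" if "j < k" for j
        using \<open>norm x > r k\<close> r_mono[of "Suc j" k] r_Suc[of j] that by (intro \<phi>(4)) auto
      then show ?thesis by simp
    qed
    have "Qform p u (\<lambda>x. \<Sum>j<k. c j *\<^sub>R \<phi> j x) = integral\<^sup>L lborel (Q_density p u (\<lambda>x. \<Sum>j<k. c j *\<^sub>R \<phi> j x) (\<lambda>i x. \<Sum>j<k. c j *\<^sub>R \<Phi> j i x))"
      by (rule Qform_eq_integral(2)[OF p u grad supp])
    also have "\<dots> = (LBINT x. (\<Sum>j<k. (c j)\<^sup>2 * Q_density p u (\<phi> j) (\<Phi> j) x))"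
      by (intro Bochner_Integration.integral_cong refl Qdens_disjoint_sum[of "L _"] L)
    also have "\<dots> = (\<Sum>j<k. (c j)\<^sup>2 * integral\<^sup>L lborel (Q_density p u (\<phi> j) (\<Phi> j)))"
      using Qform_eq_integral(1)[OF p u \<Phi> \<phi>(4)] by simp
    also have "\<dots> = (\<Sum>j<k. (c j)\<^sup>2 * Qform p u (\<phi> j))"
      using Qform_eq_integral(2)[OF p u \<Phi> \<phi>(4)] by simp
    also have "\<dots> = (c l)\<^sup>2 * Qform p u (\<phi> l) + (\<Sum>j\<in>{..<k} - {l}. (c j)\<^sup>2 * Qform p u (\<phi> j))"
      using l by (intro sum.remove) auto
    also have "\<dots> < 0"
    proof (rule add_neg_nonpos)
      show "(c l)\<^sup>2 * Qform p u (\<phi> l) < 0" using l \<phi>(3) by (simp add: mult_pos_neg)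
      show "(\<Sum>j\<in>{..<k} - {l}. (c j)\<^sup>2 * Qform p u (\<phi> j)) \<le> 0"
        using \<phi>(3) by (intro sum_nonpos mult_nonneg_nonpos) (auto intro: less_imp_le)
    qed
    finally show "Qform p u (\<lambda>x. \<Sum>j<k. c j *\<^sub>R \<phi> j x) < 0" .
  qed
  then show False using fmi unfolding finite_morse_index_def by (metis Suc_n_not_le_n)
qed

section \<open>Powers of the Euclidean norm\<close>

text \<open>The growth bounds settle the behaviour at the origin: the bound on \<open>f\<close>
  makes its derivative there 0, and the bound on \<open>G\<close> makes the gradient
  continuous.\<close>

lemma C1_grad_removable:
  fixes f :: "'a::euclidean_space \<Rightarrow> real"
  assumes d: "\<And>y. y \<noteq> 0 \<Longrightarrow> (f has_derivative (\<lambda>h. G y \<bullet> h)) (at y)" and cG: "continuous_on (- {0}) G"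
    and a: "a > 0" and f0: "f 0 = 0" and G0: "G 0 = 0"
    and bf: "\<And>y. \<bar>f y\<bar> \<le> C * norm y powr (1 + a)" and bG: "\<And>y. norm (G y) \<le> C * norm y powr a"
  shows "C1_grad f G"
proof (rule C1_gradI)
  have lim: "((\<lambda>y::'a. C * norm y powr a) \<longlongrightarrow> 0) (at 0)"
  proof -
    have "isCont (\<lambda>y::'a. C * norm y powr a) 0"
      using continuous_on_norm_powr[OF continuous_on_id[of "UNIV::'a set"] a]
      by (auto intro!: continuous_intros simp: continuous_on_eq_continuous_at)
    then show ?thesis using a by (simp add: isCont_def)
  qed
  fix x :: 'a
  show "(f has_derivative (\<lambda>h. G x \<bullet> h)) (at x)"
  proof (cases "x = 0")
    case True
    have "((\<lambda>h. norm (f h) / norm h) \<longlongrightarrow> 0) (at 0)"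
    proof (rule Lim_null_comparison[OF _ lim], rule always_eventually, rule allI)
      fix y :: 'a
      show "norm (norm (f y) / norm y) \<le> C * norm y powr a"
      proof (cases "y = 0")
        case False
        then have "C * norm y powr (1 + a) = C * norm y powr a * norm y" by (simp add: powr_add)
        with bf[of y] False show ?thesis by (simp add: divide_le_eq)
      qed (use bG[of 0] G0 in simp)
    qed
    then show ?thesis using True f0 G0 by (simp add: has_derivative_at)
  qed (use d in simp)
next
  have lim: "((\<lambda>y::'a. C * norm y powr a) \<longlongrightarrow> 0) (at 0)"
  proof -
    have "isCont (\<lambda>y::'a. C * norm y powr a) 0"
      using continuous_on_norm_powr[OF continuous_on_id[of "UNIV::'a set"] a]
      by (auto intro!: continuous_intros simp: continuous_on_eq_continuous_at)
    then show ?thesis using a by (simp add: isCont_def)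
  qed
  have "isCont G x" for x
  proof (cases "x = 0")
    case True
    have "(G \<longlongrightarrow> 0) (at 0)"
      by (rule Lim_null_comparison[OF _ lim], rule always_eventually) (use bG in auto)
    then show ?thesis using True G0 by (simp add: isCont_def)
  next
    case False
    then show ?thesis using cG by (simp add: continuous_on_eq_continuous_at open_Compl)
  qed
  then show "continuous_on UNIV G" by (simp add: continuous_at_imp_continuous_on)
qed

lemma inner_self_powr:
  fixes y :: "'a::real_inner"
  shows "(y \<bullet> y) powr a = norm y powr (2 * a)"
proof (cases "y = 0")
  case False
  then have "y \<bullet> y = norm y powr 2" by (simp add: powr_numeral power2_norm_eq_inner)
  then show ?thesis by (simp only: powr_powr)
qed simp

lemma has_derivative_norm_powr:
  fixes y :: "'a::euclidean_space"
  assumes "y \<noteq> 0"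
  shows "((\<lambda>y. norm y powr a) has_derivative (\<lambda>h. (a * norm y powr (a - 2)) * (y \<bullet> h))) (at y)"
proof -
  have "((\<lambda>t. t powr (a / 2)) has_derivative (*) (a / 2 * (y \<bullet> y) powr (a / 2 - 1))) (at (y \<bullet> y))"
    using has_real_derivative_powr[of "y \<bullet> y" "a / 2"] assms by (simp add: has_field_derivative_def)
  from has_derivative_compose[OF C1_gradD[OF C1_grad_norm_sq] this]
  have "((\<lambda>y. (y \<bullet> y) powr (a / 2)) has_derivative (\<lambda>h. (a * norm y powr (a - 2)) * (y \<bullet> h))) (at y)"
    by (simp add: inner_self_powr algebra_simps)
  then show ?thesis by (simp add: inner_self_powr)
qed

lemma C1_grad_norm_powr:
  assumes "q > 1"
  shows "C1_grad (\<lambda>y::'a::euclidean_space. norm y powr q) (\<lambda>y. (q * norm y powr (q - 2)) *\<^sub>R y)"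
proof (rule C1_grad_removable[where a="q - 1" and C=q])
  show "((\<lambda>y. norm y powr q) has_derivative (\<bullet>) ((q * norm y powr (q - 2)) *\<^sub>R y)) (at y)" if "y \<noteq> 0" for y :: 'a
    by (rule has_derivative_eq_rhs[OF has_derivative_norm_powr[OF that, of q]]) (auto simp: fun_eq_iff)
  show "continuous_on (- {0}) (\<lambda>y::'a. (q * norm y powr (q - 2)) *\<^sub>R y)"
    by (intro continuous_intros) auto
  show "\<bar>norm y powr q\<bar> \<le> q * norm y powr (1 + (q - 1))" for y :: 'a
    using assms by (simp add: mult_right_mono[of 1 q, simplified])
  show "norm ((q * norm y powr (q - 2)) *\<^sub>R y) \<le> q * norm y powr (q - 1)" for y :: 'a
  proof (cases "y = 0")
    case False
    then have "norm y powr (q - 1) = norm y powr (q - 2) * norm y"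
      using powr_add[of "norm y" "q - 2" 1] by simp
    then show ?thesis using assms by simp
  qed simp
qed (use assms in auto)

text \<open>The convention \<open>0 powr 0 = 0\<close> makes the case distinction necessary.\<close>

definition pw :: "real \<Rightarrow> 'a::real_normed_vector \<Rightarrow> real" where
  "pw s y = (if s = 0 then 1 else norm y powr s)"

lemma pw_nonneg: "pw s y \<ge> 0" by (simp add: pw_def)

lemma pw_mult: "pw s y * pw t y = pw (s + t) y" if "s \<ge> 0" "t \<ge> 0"
  using that by (cases "y = 0") (auto simp: pw_def powr_add[symmetric])

lemma pw_mult_powr: "pw s y * norm y powr t = norm y powr (s + t)" if "s \<ge> 0" "t > 0"
  using that by (cases "y = 0") (auto simp: pw_def powr_add[symmetric])

lemma norm_powr_mult_inner: "norm y powr a * (y \<bullet> y) = norm y powr (a + 2)" if "a + 2 > 0" for y :: "'a::real_inner"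
  using norm_powr_mult_sq[of y a] by (cases "y = 0") (auto simp: power2_norm_eq_inner)

text \<open>The components of |y|^s y, from which the test functions are built. For s > 0 the values
  are of order |y|^(1 + s) and the gradients of order |y|^s, so the origin is removable; for s = 0
  the map is the identity.\<close>

lemma C1_grad_pw_nth:
  assumes s: "s \<ge> 0"
  shows "C1_grad (\<lambda>y::real^'m. pw s y * y $ i) (\<lambda>y. pw s y *\<^sub>R axis i 1 + (s * norm y powr (s - 2) * y $ i) *\<^sub>R y)"
proof (cases "s = 0")
  case True
  then show ?thesis using C1_grad_inner[of "axis i 1 :: real^'m"] by (simp add: pw_def inner_axis)
next
  case False
  then have s: "s > 0" using s by simp
  show ?thesis
  proof (rule C1_grad_removable[where a=s and C="1 + s"])
    fix y :: "real^'m" assume y: "y \<noteq> 0"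
    have "((\<lambda>y. norm y powr s * (y \<bullet> axis i 1)) has_derivative
       (\<lambda>h. norm y powr s * (axis i 1 \<bullet> h) + (s * norm y powr (s - 2)) * (y \<bullet> h) * (y \<bullet> axis i 1))) (at y)"
      by (rule has_derivative_mult[OF has_derivative_norm_powr[OF y] C1_gradD[OF C1_grad_inner]])
    then show "((\<lambda>y. pw s y * y $ i) has_derivative (\<bullet>) (pw s y *\<^sub>R axis i 1 + (s * norm y powr (s - 2) * y $ i) *\<^sub>R y)) (at y)"
      using False by (simp add: pw_def inner_axis) (erule has_derivative_eq_rhs, auto simp: fun_eq_iff inner_add_left)
  next
    show "continuous_on (- {0}) (\<lambda>y::real^'m. pw s y *\<^sub>R axis i 1 + (s * norm y powr (s - 2) * y $ i) *\<^sub>R y)"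
      using False unfolding pw_def by (auto intro!: continuous_intros)
  next
    fix y :: "real^'m"
    have "\<bar>y $ i\<bar> \<le> norm y" by (rule component_le_norm_cart)
    then have "norm y powr s * \<bar>y $ i\<bar> \<le> norm y powr s * norm y" by (intro mult_left_mono) auto
    also have "\<dots> = norm y powr (1 + s)" by (cases "y = 0") (auto simp: powr_add)
    also have "\<dots> \<le> (1 + s) * norm y powr (1 + s)" using s by (simp add: mult_right_mono[of 1 "1 + s", simplified])
    finally show "\<bar>pw s y * y $ i\<bar> \<le> (1 + s) * norm y powr (1 + s)" using False by (simp add: pw_def abs_mult)
    have "norm ((s * norm y powr (s - 2) * y $ i) *\<^sub>R y) \<le> s * norm y powr s"
    proof (cases "y = 0")
      case False
      have "norm ((s * norm y powr (s - 2) * y $ i) *\<^sub>R y) = s * norm y powr (s - 2) * (\<bar>y $ i\<bar> * norm y)"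
        using s by (simp add: abs_mult)
      also have "\<dots> \<le> s * norm y powr (s - 2) * (norm y)\<^sup>2"
        using s \<open>\<bar>y $ i\<bar> \<le> norm y\<close> by (intro mult_left_mono) (auto simp: power2_eq_square intro: mult_right_mono)
      also have "\<dots> = s * norm y powr s" using norm_powr_mult_sq[OF False, of "s - 2"] by simp
      finally show ?thesis .
    qed simp
    moreover have "norm (pw s y *\<^sub>R (axis i 1 :: real^'m)) = norm y powr s" using False by (simp add: pw_def)
    ultimately show "norm (pw s y *\<^sub>R axis i 1 + (s * norm y powr (s - 2) * y $ i) *\<^sub>R y) \<le> (1 + s) * norm y powr s"
      using norm_triangle_ineq[of "pw s y *\<^sub>R (axis i 1 :: real^'m)" "(s * norm y powr (s - 2) * y $ i) *\<^sub>R y"]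
      by (simp add: algebra_simps)
  qed (use s False in \<open>auto simp: pw_def\<close>)
qed

section \<open>Integral identities for classical solutions\<close>

text \<open>The divergence theorem for the field \<eta> f x, obtained by integrating by parts
  coordinate by coordinate against \<open>x $ k * \<eta> x\<close>. It underlies both the scaling
  and the Pohozaev identity.\<close>

lemma integral_mult_position_grad:
  fixes \<eta> f :: "real^'n \<Rightarrow> real"
  assumes \<eta>: "C1_grad \<eta> E" and supp: "\<And>x. norm x > r \<Longrightarrow> \<eta> x = 0" and f: "C1_grad f F"
  shows "(LBINT x. \<eta> x * (x \<bullet> F x)) = - (LBINT x. f x * (real CARD('n) * \<eta> x + x \<bullet> E x))"
proof -
  have suppE: "norm x > r \<Longrightarrow> E x = 0" for x by (rule C1_grad_eq_0_outside[OF \<eta> supp])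
  note cont = C1_grad_continuous[OF \<eta>] C1_grad_continuous[OF f] C1_grad_continuous_grad[OF \<eta>] C1_grad_continuous_grad[OF f]
  have gk: "C1_grad (\<lambda>x. x $ k * \<eta> x) (\<lambda>x. (x $ k) *\<^sub>R E x + \<eta> x *\<^sub>R axis k 1)" for k
    using C1_grad_mult[OF C1_grad_inner[of "axis k 1"] \<eta>] by (simp add: inner_axis)
  have ibp: "(LBINT x. x $ k * \<eta> x * (F x $ k)) = - (LBINT x. f x * (x $ k * E x $ k + \<eta> x))" for k
    using integration_by_parts[OF gk[of k] f, where r=r and v="axis k 1"] supp
    by (simp add: inner_axis inner_add_left)
  have i1: "integrable lborel (\<lambda>x. x $ k * \<eta> x * (F x $ k))" for k
    by (rule integrable_continuous_bounded_support[where r=r]) (auto simp: supp intro!: continuous_intros cont)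
  have i2: "integrable lborel (\<lambda>x. f x * (x $ k * E x $ k + \<eta> x))" for k
    by (rule integrable_continuous_bounded_support[where r=r]) (auto simp: supp suppE intro!: continuous_intros cont)
  have "(LBINT x. \<eta> x * (x \<bullet> F x)) = (LBINT x. (\<Sum>k\<in>UNIV. x $ k * \<eta> x * (F x $ k)))"
    by (simp add: inner_vec_def sum_distrib_left mult_ac)
  also have "\<dots> = (\<Sum>k\<in>UNIV. - (LBINT x. f x * (x $ k * E x $ k + \<eta> x)))"
    using i1 ibp by simp
  also have "\<dots> = - (LBINT x. (\<Sum>k\<in>UNIV. f x * (x $ k * E x $ k + \<eta> x)))"
    using i2 by (simp add: sum_negf)
  also have "(\<lambda>x. \<Sum>k\<in>UNIV. f x * (x $ k * E x $ k + \<eta> x)) = (\<lambda>x. f x * (real CARD('n) * \<eta> x + x \<bullet> E x))"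
    by (simp add: inner_vec_def sum_distrib_left[symmetric] sum.distrib algebra_simps)
  finally show ?thesis .
qed

text \<open>\<open>g i\<close> is the gradient of the i-th component and \<open>H i j\<close> the
  gradient of its j-th partial derivative. Carrying the derivatives as fields lets the identities
  below be computed with \<open>C1_grad\<close> alone.\<close>

locale lane_emden =
  fixes u :: "real^'n \<Rightarrow> real^'m" and g :: "'m \<Rightarrow> real^'n \<Rightarrow> real^'n"
    and H :: "'m \<Rightarrow> 'n \<Rightarrow> real^'n \<Rightarrow> real^'n" and p :: real
  assumes p1: "p > 1"
    and u: "\<And>i. C1_grad (\<lambda>x. u x $ i) (g i)"
    and g: "\<And>i j. C1_grad (\<lambda>x. g i x $ j) (H i j)"
    and eq: "\<And>i x. - (\<Sum>j\<in>UNIV. H i j x $ j) = norm (u x) powr (p - 1) * u x $ i"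
begin

lemma u_cont: "continuous_on UNIV u"
  using C1_grad_continuous[OF u] by (simp add: continuous_on_vec_nth_iff)

lemma g_cont: "continuous_on S (g i)"
  by (rule C1_grad_continuous_grad[OF u])

lemma H_sym: "H i j x $ k = H i k x $ j"
  using mixed_derivatives_commute[OF u[of i], of "axis j 1" "H i j" "axis k 1" "H i k" x] g
  by (simp add: inner_axis)

definition Gsq where "Gsq x = (\<Sum>i\<in>UNIV. g i x \<bullet> g i x)"
definition S where "S x = norm (u x) powr (p + 1)"
text \<open>Half the gradient of |u|^2; see \<open>C1_grad_u_sq\<close>.\<close>

definition V where "V x = (\<Sum>i\<in>UNIV. (u x $ i) *\<^sub>R g i x)"

lemma Gsq_nonneg: "Gsq x \<ge> 0" by (simp add: Gsq_def sum_nonneg)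
lemma S_nonneg: "S x \<ge> 0" by (simp add: S_def)

lemma Gsq_cont: "continuous_on UNIV Gsq"
  unfolding Gsq_def by (intro continuous_intros g_cont)

lemma norm_u_powr_cont: "a > 0 \<Longrightarrow> continuous_on UNIV (\<lambda>x. norm (u x) powr a)"
  by (rule continuous_on_norm_powr[OF u_cont])

lemma S_cont: "continuous_on UNIV S"
  unfolding S_def[abs_def] using p1 by (intro norm_u_powr_cont) auto

lemma u_nth_cont: "continuous_on UNIV (\<lambda>x. u x $ i)"
  by (rule C1_grad_continuous[OF u])

lemma V_cont: "continuous_on UNIV V"
  unfolding V_def by (intro continuous_intros g_cont u_nth_cont)

lemma S_eq: "norm (u x) powr (p - 1) * (u x \<bullet> u x) = S x"
  using norm_powr_mult_inner[of "p - 1" "u x"] p1 by (simp add: S_def add.commute)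

text \<open>The vector form of the inequality between the gradient of |u| and that of u, multiplied
  by |u|^2 so that it makes sense at zeros of u.\<close>

lemma V_bound: "V x \<bullet> V x \<le> (u x \<bullet> u x) * Gsq x"
proof -
  have "norm (V x) \<le> (\<Sum>i\<in>UNIV. \<bar>u x $ i\<bar> * norm (g i x))"
    unfolding V_def by (rule order_trans[OF norm_sum]) simp
  then have "(norm (V x))\<^sup>2 \<le> (\<Sum>i\<in>UNIV. \<bar>u x $ i\<bar> * norm (g i x))\<^sup>2"
    by (intro power_mono) auto
  also have "\<dots> \<le> (\<Sum>i\<in>UNIV. \<bar>u x $ i\<bar>\<^sup>2) * (\<Sum>i\<in>UNIV. (norm (g i x))\<^sup>2)"
    by (rule Cauchy_Schwarz_ineq_sum)
  finally show ?thesis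
    by (simp add: power2_norm_eq_inner Gsq_def inner_vec_def[of "u x"] power2_eq_square[of "u x $ _"])
qed

lemma weak_form:
  assumes \<phi>: "C1_grad \<phi> \<Phi>" and supp: "\<And>x. norm x > r \<Longrightarrow> \<phi> x = 0"
  shows "(LBINT x. g i x \<bullet> \<Phi> x) = (LBINT x. norm (u x) powr (p - 1) * u x $ i * \<phi> x)"
proof -
  have suppE: "norm x > r \<Longrightarrow> \<Phi> x = 0" for x by (rule C1_grad_eq_0_outside[OF \<phi> supp])
  note cont = C1_grad_continuous[OF \<phi>] C1_grad_continuous[OF g] C1_grad_continuous_grad[OF \<phi>] C1_grad_continuous_grad[OF g]
  have ibp: "(LBINT x. \<phi> x * H i j x $ j) = - (LBINT x. g i x $ j * \<Phi> x $ j)" for j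
    using integration_by_parts[OF \<phi> g[of i j] supp, where v="axis j 1"] by (simp add: inner_axis)
  have i1: "integrable lborel (\<lambda>x. g i x $ j * \<Phi> x $ j)" for j
    by (rule integrable_continuous_bounded_support[where r=r]) (auto simp: suppE intro!: continuous_intros cont)
  have i2: "integrable lborel (\<lambda>x. \<phi> x * H i j x $ j)" for j
    by (rule integrable_continuous_bounded_support[where r=r]) (auto simp: supp intro!: continuous_intros cont)
  have "(LBINT x. g i x \<bullet> \<Phi> x) = (\<Sum>j\<in>UNIV. (LBINT x. g i x $ j * \<Phi> x $ j))"
    using i1 by (simp add: inner_vec_def)
  also have "\<dots> = - (LBINT x. (\<Sum>j\<in>UNIV. \<phi> x * H i j x $ j))"
    using i2 ibp by (simp add: sum_negf)
  also have "\<dots> = (LBINT x. \<phi> x * (- (\<Sum>j\<in>UNIV. H i j x $ j)))"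
    by (simp add: sum_distrib_left)
  finally show ?thesis by (simp add: eq mult_ac)
qed

text \<open>Test the i-th equation with \<eta> times the i-th component and sum over
  \<open>i\<close>.\<close>

lemma energy_identity:
  assumes \<eta>: "C1_grad \<eta> E" and supp: "\<And>x. norm x > r \<Longrightarrow> \<eta> x = 0"
  shows "(LBINT x. \<eta> x * Gsq x + V x \<bullet> E x) = (LBINT x. \<eta> x * S x)"
proof -
  have suppE: "norm x > r \<Longrightarrow> E x = 0" for x by (rule C1_grad_eq_0_outside[OF \<eta> supp])
  note cont = C1_grad_continuous[OF \<eta>] C1_grad_continuous_grad[OF \<eta>] u_nth_cont g_cont u_cont
  have w: "(LBINT x. g i x \<bullet> (\<eta> x *\<^sub>R g i x + (u x $ i) *\<^sub>R E x))
     = (LBINT x. norm (u x) powr (p - 1) * u x $ i * (\<eta> x * u x $ i))" for i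
    by (rule weak_form[OF C1_grad_mult[OF \<eta> u], where r=r]) (simp add: supp)
  have i1: "integrable lborel (\<lambda>x. g i x \<bullet> (\<eta> x *\<^sub>R g i x + (u x $ i) *\<^sub>R E x))" for i
    by (rule integrable_continuous_bounded_support[where r=r]) (auto simp: supp suppE intro!: continuous_intros cont)
  have i2: "integrable lborel (\<lambda>x. norm (u x) powr (p - 1) * u x $ i * (\<eta> x * u x $ i))" for i
    using p1 by (intro integrable_continuous_bounded_support[where r=r])
      (auto simp: supp intro!: continuous_intros cont norm_u_powr_cont)
  have "(LBINT x. \<eta> x * Gsq x + V x \<bullet> E x) = (LBINT x. (\<Sum>i\<in>UNIV. g i x \<bullet> (\<eta> x *\<^sub>R g i x + (u x $ i) *\<^sub>R E x)))"
    by (simp add: Gsq_def V_def inner_add_right sum.distrib sum_distrib_left inner_sum_left)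
  also have "\<dots> = (LBINT x. (\<Sum>i\<in>UNIV. norm (u x) powr (p - 1) * u x $ i * (\<eta> x * u x $ i)))"
    using i1 i2 w by simp
  also have "(\<lambda>x. \<Sum>i\<in>UNIV. norm (u x) powr (p - 1) * u x $ i * (\<eta> x * u x $ i)) = (\<lambda>x. \<eta> x * S x)"
    unfolding S_eq[symmetric] by (simp add: inner_vec_def sum_distrib_left mult_ac)
  finally show ?thesis .
qed

lemma C1_grad_u_sq: "C1_grad (\<lambda>x. u x \<bullet> u x) (\<lambda>x. 2 *\<^sub>R V x)"
  using C1_grad_compose_vec[OF C1_grad_norm_sq u] by (simp add: V_def scaleR_sum_right)

lemma C1_grad_S: "C1_grad S (\<lambda>x. ((p + 1) * norm (u x) powr (p - 1)) *\<^sub>R V x)"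
proof -
  have "(p + 1) - 2 = p - 1" by simp
  then show ?thesis
    using C1_grad_compose_vec[OF C1_grad_norm_powr[of "p + 1"] u] p1
    by (simp add: V_def S_def[abs_def] scaleR_sum_right)
qed

text \<open>\<open>x \<bullet> V x\<close> is half the radial derivative of |u|^2 multiplied by |x|,
  so this is the divergence theorem for the field \<eta> |u|^2 x.\<close>

lemma scaling_identity:
  assumes \<eta>: "C1_grad \<eta> E" and supp: "\<And>x. norm x > r \<Longrightarrow> \<eta> x = 0"
  shows "(LBINT x. \<eta> x * (x \<bullet> V x)) = - (1 / 2) * (LBINT x. (u x \<bullet> u x) * (real CARD('n) * \<eta> x + x \<bullet> E x))"
proof -
  have "2 * (LBINT x. \<eta> x * (x \<bullet> V x)) = (LBINT x. \<eta> x * (x \<bullet> (2 *\<^sub>R V x)))"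
    by (simp add: mult.left_commute[of _ 2])
  also have "\<dots> = - (LBINT x. (u x \<bullet> u x) * (real CARD('n) * \<eta> x + x \<bullet> E x))"
    by (rule integral_mult_position_grad[OF \<eta> supp C1_grad_u_sq])
  finally show ?thesis by simp
qed

text \<open>Test the i-th equation with \<open>\<eta> x * (x \<bullet> g i x)\<close> and sum.
  Second derivatives and nonlinearity enter only through \<open>x\<close> times the gradients of
  |grad u_i|^2 and of \<open>S\<close>, and the divergence theorem removes both.\<close>

lemma pohozaev_identity:
  assumes \<eta>: "C1_grad \<eta> E" and supp: "\<And>x. norm x > r \<Longrightarrow> \<eta> x = 0"
  shows "(LBINT x. (\<Sum>i\<in>UNIV. (x \<bullet> g i x) * (g i x \<bullet> E x)) + \<eta> x * Gsq x
      - (1 / 2) * (Gsq x * (real CARD('n) * \<eta> x + x \<bullet> E x)))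
    = - (1 / (p + 1)) * (LBINT x. S x * (real CARD('n) * \<eta> x + x \<bullet> E x))"
proof -
  have suppE: "norm x > r \<Longrightarrow> E x = 0" for x by (rule C1_grad_eq_0_outside[OF \<eta> supp])
  note cont = C1_grad_continuous[OF \<eta>] C1_grad_continuous_grad[OF \<eta>] u_nth_cont g_cont u_cont
    C1_grad_continuous_grad[OF g] Gsq_cont S_cont V_cont
  have xg: "C1_grad (\<lambda>x. x \<bullet> g i x) (\<lambda>x. g i x + (\<Sum>k\<in>UNIV. (x $ k) *\<^sub>R H i k x))" for i
  proof -
    have "C1_grad (\<lambda>x. \<Sum>k\<in>UNIV. (x \<bullet> axis k 1) * g i x $ k) (\<lambda>x. \<Sum>k\<in>UNIV. (x \<bullet> axis k 1) *\<^sub>R H i k x + (g i x $ k) *\<^sub>R axis k 1)"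
      by (intro C1_grad_sum C1_grad_mult C1_grad_inner g)
    moreover have "(\<Sum>k\<in>UNIV. (g i x $ k) *\<^sub>R axis k 1) = g i x" for x
      by (simp add: basis_expansion flip: scalar_mult_eq_scaleR)
    ultimately show ?thesis
      by (simp add: inner_axis sum.distrib add.commute inner_vec_def[of _ "g i _"])
  qed
  define D where "D i x = (\<Sum>j\<in>UNIV. (g i x $ j) *\<^sub>R H i j x)" for i x
  have gsq: "C1_grad (\<lambda>x. g i x \<bullet> g i x) (\<lambda>x. 2 *\<^sub>R D i x)" for i
    using C1_grad_compose_vec[OF C1_grad_norm_sq g] by (simp add: D_def scaleR_sum_right)
  have Dc: "continuous_on UNIV (D i)" for i unfolding D_def by (intro continuous_intros cont)
  \<comment> \<open>Symmetry of the Hessian turns the second-order term into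
    \<open>x \<bullet> D i x\<close>, where \<open>2 *\<^sub>R D i x\<close> is the gradient of
    \<open>g i x \<bullet> g i x\<close>.\<close>
  have sym: "g i x \<bullet> (\<Sum>k\<in>UNIV. (x $ k) *\<^sub>R H i k x) = x \<bullet> D i x" for i x
  proof -
    have "g i x \<bullet> (\<Sum>k\<in>UNIV. (x $ k) *\<^sub>R H i k x) = (\<Sum>k\<in>UNIV. \<Sum>j\<in>UNIV. x $ k * (g i x $ j * H i k x $ j))"
      by (simp add: inner_sum_right inner_vec_def[of "g i x"] sum_distrib_left)
    also have "\<dots> = (\<Sum>k\<in>UNIV. \<Sum>j\<in>UNIV. x $ k * (g i x $ j * H i j x $ k))"
      by (simp only: H_sym)
    also have "\<dots> = x \<bullet> D i x"
      by (simp add: D_def inner_vec_def sum_component sum_distrib_left)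
    finally show ?thesis .
  qed
  have w: "(LBINT x. (x \<bullet> g i x) * (g i x \<bullet> E x) + \<eta> x * (g i x \<bullet> g i x) + \<eta> x * (x \<bullet> D i x))
     = (LBINT x. norm (u x) powr (p - 1) * u x $ i * (\<eta> x * (x \<bullet> g i x)))" for i
    using weak_form[OF C1_grad_mult[OF \<eta> xg[of i]], of r i] supp sym
    by (simp add: inner_add_right algebra_simps)
  have i1: "integrable lborel (\<lambda>x. (x \<bullet> g i x) * (g i x \<bullet> E x) + \<eta> x * (g i x \<bullet> g i x))" for i
    by (rule integrable_continuous_bounded_support[where r=r]) (auto simp: supp suppE intro!: continuous_intros cont)
  have i2: "integrable lborel (\<lambda>x. \<eta> x * (x \<bullet> D i x))" for i
    by (rule integrable_continuous_bounded_support[where r=r]) (auto simp: supp suppE intro!: continuous_intros cont Dc)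
  have i3: "integrable lborel (\<lambda>x. norm (u x) powr (p - 1) * u x $ i * (\<eta> x * (x \<bullet> g i x)))" for i
    using p1 by (intro integrable_continuous_bounded_support[where r=r])
      (auto simp: supp intro!: continuous_intros cont norm_u_powr_cont)
  have i4: "integrable lborel (\<lambda>x. (g i x \<bullet> g i x) * (real CARD('n) * \<eta> x + x \<bullet> E x))" for i
    by (rule integrable_continuous_bounded_support[where r=r]) (auto simp: supp suppE intro!: continuous_intros cont)
  have d: "(LBINT x. \<eta> x * (x \<bullet> D i x)) = - (1 / 2) * (LBINT x. (g i x \<bullet> g i x) * (real CARD('n) * \<eta> x + x \<bullet> E x))" for i
   
  proof -
    have "2 * (LBINT x. \<eta> x * (x \<bullet> D i x)) = (LBINT x. \<eta> x * (x \<bullet> (2 *\<^sub>R D i x)))"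
      by (simp add: mult.left_commute[of _ 2])
    also have "\<dots> = - (LBINT x. (g i x \<bullet> g i x) * (real CARD('n) * \<eta> x + x \<bullet> E x))"
      by (rule integral_mult_position_grad[OF \<eta> supp gsq])
    finally show ?thesis by simp
  qed
  have "(LBINT x. (x \<bullet> g i x) * (g i x \<bullet> E x) + \<eta> x * (g i x \<bullet> g i x) - (1 / 2) * ((g i x \<bullet> g i x) * (real CARD('n) * \<eta> x + x \<bullet> E x)))
     = (LBINT x. norm (u x) powr (p - 1) * u x $ i * (\<eta> x * (x \<bullet> g i x)))" for i
  proof -
    have "(LBINT x. (x \<bullet> g i x) * (g i x \<bullet> E x) + \<eta> x * (g i x \<bullet> g i x) - (1 / 2) * ((g i x \<bullet> g i x) * (real CARD('n) * \<eta> x + x \<bullet> E x)))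
     = (LBINT x. (x \<bullet> g i x) * (g i x \<bullet> E x) + \<eta> x * (g i x \<bullet> g i x)) - (1 / 2) * (LBINT x. (g i x \<bullet> g i x) * (real CARD('n) * \<eta> x + x \<bullet> E x))"
      using Bochner_Integration.integral_diff[OF i1 integrable_mult_right[OF i4, of "1/2"]] by simp
    then show ?thesis
      using w[of i] d[of i] Bochner_Integration.integral_add[OF i1[of i] i2[of i]] by simp
  qed
  then have "(\<Sum>i\<in>UNIV. (LBINT x. (x \<bullet> g i x) * (g i x \<bullet> E x) + \<eta> x * (g i x \<bullet> g i x) - (1 / 2) * ((g i x \<bullet> g i x) * (real CARD('n) * \<eta> x + x \<bullet> E x))))
     = (\<Sum>i\<in>UNIV. (LBINT x. norm (u x) powr (p - 1) * u x $ i * (\<eta> x * (x \<bullet> g i x))))" by simp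
  also have "\<dots> = (LBINT x. (\<Sum>i\<in>UNIV. norm (u x) powr (p - 1) * u x $ i * (\<eta> x * (x \<bullet> g i x))))"
    using i3 by simp
  \<comment> \<open>Summed over \<open>i\<close>, the right-hand side contains \<open>x\<close>
    times the gradient of \<open>S\<close>, divided by \<open>p + 1\<close>.\<close>
  also have "(\<lambda>x. \<Sum>i\<in>UNIV. norm (u x) powr (p - 1) * u x $ i * (\<eta> x * (x \<bullet> g i x))) = (\<lambda>x. (1 / (p + 1)) * (\<eta> x * (x \<bullet> (((p + 1) * norm (u x) powr (p - 1)) *\<^sub>R V x))))"
    using p1 by (simp add: V_def inner_sum_right sum_distrib_left mult_ac)
  also have "integral\<^sup>L lborel \<dots> = - (1 / (p + 1)) * (LBINT x. S x * (real CARD('n) * \<eta> x + x \<bullet> E x))"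
  proof -
    have "(LBINT x. \<eta> x * (x \<bullet> (((p + 1) * norm (u x) powr (p - 1)) *\<^sub>R V x)))
      = - (LBINT x. S x * (real CARD('n) * \<eta> x + x \<bullet> E x))"
      by (rule integral_mult_position_grad[OF \<eta> supp C1_grad_S])
    then show ?thesis by (simp only: integral_mult_right_zero)
  qed
  finally have "- (1 / (p + 1)) * (LBINT x. S x * (real CARD('n) * \<eta> x + x \<bullet> E x))
    = (\<Sum>i\<in>UNIV. (LBINT x. (x \<bullet> g i x) * (g i x \<bullet> E x) + \<eta> x * (g i x \<bullet> g i x) - (1 / 2) * ((g i x \<bullet> g i x) * (real CARD('n) * \<eta> x + x \<bullet> E x))))" ..
  also have "\<dots> = (LBINT x. (\<Sum>i\<in>UNIV. (x \<bullet> g i x) * (g i x \<bullet> E x) + \<eta> x * (g i x \<bullet> g i x) - (1 / 2) * ((g i x \<bullet> g i x) * (real CARD('n) * \<eta> x + x \<bullet> E x))))"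
    by (rule Bochner_Integration.integral_sum[symmetric])
      (intro Bochner_Integration.integrable_diff i1 integrable_mult_right i4)
  also have "\<dots> = (LBINT x. (\<Sum>i\<in>UNIV. (x \<bullet> g i x) * (g i x \<bullet> E x)) + \<eta> x * Gsq x
      - (1 / 2) * (Gsq x * (real CARD('n) * \<eta> x + x \<bullet> E x)))"
    by (simp add: Gsq_def sum.distrib sum_subtractf sum_distrib_left sum_distrib_right)
  finally show ?thesis ..
qed

end

lemma classical_solution_lane_emden:
  fixes u :: "real^'n \<Rightarrow> real^'m"
  assumes "p > 1" "classical_solution p u"
  shows "\<exists>g H. lane_emden u g H p"
proof -
  have C2: "Ck (Suc (Suc 0)) (\<lambda>x. u x $ i)" for i
    using assms(2) Ck_vec_nth[of 2 u] by (simp add: classical_solution_def numeral_2_eq_2)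
  define g where "g i x = (\<Sum>b\<in>Basis. frechet_derivative (\<lambda>x. u x $ i) (at x) b *\<^sub>R b)" for i x
  have g: "C1_grad (\<lambda>x. u x $ i) (g i)" for i
    unfolding g_def by (rule C1_grad_of_smooth[OF C2])
  have gj: "g i x $ j = frechet_derivative (\<lambda>x. u x $ i) (at x) (axis j 1)" for i j x
    by (simp add: C1_grad_frechet[OF g] inner_axis)
  define H where "H i j x = (\<Sum>b\<in>Basis. frechet_derivative (\<lambda>x. g i x $ j) (at x) b *\<^sub>R b)" for i j x
  have "Ck (Suc 0) (\<lambda>x. g i x $ j)" for i j
    unfolding gj by (rule Ck_SucE(2)[OF C2])
  then have H: "C1_grad (\<lambda>x. g i x $ j) (H i j)" for i j
    unfolding H_def by (rule C1_grad_of_smooth)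
  have "laplacian (\<lambda>y. u y $ i) x = (\<Sum>j\<in>UNIV. H i j x $ j)" for i x
    unfolding laplacian_def C1_grad_partial[OF g] C1_grad_partial[OF H] ..
  then have "lane_emden u g H p"
    using assms g H by unfold_locales (auto simp: classical_solution_def)
  then show ?thesis by blast
qed

section \<open>Radial cutoff functions\<close>

text \<open>Equal to 1 up to 1 and to 0 from 2 on. Squares of positive parts are C1, which is all
  the regularity that \<open>C1_grad\<close> asks for.\<close>

definition cutoff :: "real \<Rightarrow> real" where
  "cutoff t = (max 0 (1 - (max 0 (t - 1))\<^sup>2))\<^sup>2"

definition cutoff' :: "real \<Rightarrow> real" where
  "cutoff' t = - (4 * max 0 (1 - (max 0 (t - 1))\<^sup>2) * max 0 (t - 1))"

lemma max_square_DERIV: "((\<lambda>t. (max 0 t)\<^sup>2) has_real_derivative 2 * max 0 t) (at t)" for t :: real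
proof -
  consider "t > 0" | "t < 0" | "t = 0" by linarith
  then show ?thesis
  proof cases
    case 1
    have "((\<lambda>t. t\<^sup>2) has_real_derivative 2 * max 0 t) (at t)"
      using 1 by (auto intro!: derivative_eq_intros)
    then show ?thesis
      by (rule has_field_derivative_transform_within_open[of _ _ _ "{0<..}"]) (use 1 in auto)
  next
    case 2
    have "((\<lambda>t. 0) has_real_derivative 2 * max 0 t) (at t)" using 2 by simp
    then show ?thesis
      by (rule has_field_derivative_transform_within_open[of _ _ _ "{..<0}"]) (use 2 in auto)
  next
    case 3
    have "((\<lambda>h. (max 0 h)\<^sup>2 / h) \<longlongrightarrow> 0) (at (0::real))"
    proof (rule Lim_null_comparison)
      show "\<forall>\<^sub>F h in at 0. norm ((max 0 h)\<^sup>2 / h) \<le> \<bar>h\<bar>" for h :: real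
        by (rule always_eventually) (auto simp: max_def power2_eq_square)
      show "((\<lambda>h::real. \<bar>h\<bar>) \<longlongrightarrow> 0) (at 0)"
        by (rule tendsto_rabs_zero) (rule tendsto_ident_at)
    qed
    then show ?thesis using 3 by (simp add: DERIV_def)
  qed
qed

lemma cutoff_DERIV: "(cutoff has_real_derivative cutoff' t) (at t)"
proof -
  have 1: "((\<lambda>t. (max 0 (t - 1))\<^sup>2) has_real_derivative 2 * max 0 (t - 1)) (at t)"
  proof -
    have "((\<lambda>t. t - 1) has_real_derivative 1) (at t)" by (auto intro!: derivative_eq_intros)
    from DERIV_chain2[OF max_square_DERIV this] show ?thesis by simp
  qed
  have 2: "((\<lambda>t. 1 - (max 0 (t - 1))\<^sup>2) has_real_derivative - (2 * max 0 (t - 1))) (at t)"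
    using DERIV_diff[OF DERIV_const 1] by simp
  show ?thesis
    unfolding cutoff_def[abs_def] cutoff'_def
    using DERIV_chain2[OF max_square_DERIV 2] by (simp add: algebra_simps)
qed

lemma cutoff'_cont: "continuous_on S cutoff'"
  unfolding cutoff'_def by (intro continuous_intros)

lemma cutoff_inner_eq_0: "t \<ge> 2 \<Longrightarrow> max 0 (1 - (max 0 (t - 1))\<^sup>2) = (0::real)"
proof -
  assume t: "t \<ge> 2"
  then have "1 \<le> (t - 1)\<^sup>2" by (intro one_le_power) simp
  moreover have "max 0 (t - 1) = t - 1" using t by simp
  ultimately show ?thesis by (simp only: max_absorb1)
qed

lemma cutoff_eq_1: "t \<le> 1 \<Longrightarrow> cutoff t = 1" by (simp add: cutoff_def)

lemma cutoff_eq_0: "t \<ge> 2 \<Longrightarrow> cutoff t = 0"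
  by (simp add: cutoff_def cutoff_inner_eq_0)

lemma cutoff_bounds: "0 \<le> cutoff t" "cutoff t \<le> 1"
  by (auto simp: cutoff_def power_le_one)

lemma cutoff'_eq_0: "t \<le> 1 \<or> t \<ge> 2 \<Longrightarrow> cutoff' t = 0"
  by (auto simp: cutoff'_def cutoff_inner_eq_0)

lemma cutoff'_bound: "\<bar>cutoff' t\<bar> \<le> 4"
proof (cases "t \<le> 1 \<or> t \<ge> 2")
  case False
  have "\<bar>max 0 (1 - (max 0 (t - 1))\<^sup>2) * max 0 (t - 1)\<bar> \<le> 1 * 1"
    unfolding abs_mult by (rule mult_mono) (use False in auto)
  then show ?thesis by (simp add: cutoff'_def abs_mult)
qed (simp add: cutoff'_eq_0)

text \<open>Written in |x|^2 to be differentiable at the origin. The transition takes place between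
  the radii R and sqrt 2 R, for which 2 R serves as a convenient bound.\<close>

definition ball_cutoff :: "real \<Rightarrow> 'a::real_inner \<Rightarrow> real" where
  "ball_cutoff R x = cutoff ((x \<bullet> x) / R\<^sup>2)"

definition ball_cutoff_slope :: "real \<Rightarrow> 'a::real_inner \<Rightarrow> real" where
  "ball_cutoff_slope R x = 2 * cutoff' ((x \<bullet> x) / R\<^sup>2) / R\<^sup>2"

lemma C1_grad_ball_cutoff: "C1_grad (ball_cutoff R) (\<lambda>x. ball_cutoff_slope R x *\<^sub>R x)" for R :: real
proof -
  have d: "((\<lambda>t. cutoff (t / R\<^sup>2)) has_real_derivative cutoff' (t / R\<^sup>2) / R\<^sup>2) (at t)" for t
    using DERIV_chain2[OF cutoff_DERIV DERIV_cdivide[OF DERIV_ident, of "R\<^sup>2"]] by simp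
  have c: "continuous_on UNIV (\<lambda>t. cutoff' (t / R\<^sup>2) / R\<^sup>2)"
  proof -
    have "continuous_on UNIV (\<lambda>t. cutoff' (t * inverse (R\<^sup>2)))"
      by (rule continuous_on_compose2[OF cutoff'_cont[of UNIV]]) (auto intro!: continuous_intros)
    then show ?thesis unfolding divide_inverse by (intro continuous_intros)
  qed
  show ?thesis
    using C1_grad_compose_real[OF C1_grad_norm_sq d c] by (simp add: ball_cutoff_def[abs_def] ball_cutoff_slope_def mult.commute)
qed

lemma ball_cutoff_slope_continuous: "continuous_on S (ball_cutoff_slope R :: 'a::real_inner \<Rightarrow> real)"
proof -
  have "continuous_on S (\<lambda>x::'a. cutoff' ((x \<bullet> x) * inverse (R\<^sup>2)))"
    by (rule continuous_on_compose2[OF cutoff'_cont[of UNIV]]) (auto intro!: continuous_intros)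
  then show ?thesis unfolding ball_cutoff_slope_def[abs_def] divide_inverse by (intro continuous_intros)
qed

lemma ball_cutoff_bounds: "0 \<le> ball_cutoff R x" "ball_cutoff R x \<le> 1" by (simp_all add: ball_cutoff_def cutoff_bounds)

lemma ball_cutoff_eq_1: "norm x \<le> R \<Longrightarrow> ball_cutoff R x = 1"
  unfolding ball_cutoff_def power2_norm_eq_inner[symmetric]
  by (cases "R = 0") (auto intro!: cutoff_eq_1 simp: divide_le_eq power_mono)

lemma two_le_inner_div: "R > 0 \<Longrightarrow> norm x \<ge> 2 * R \<Longrightarrow> (x \<bullet> x) / R\<^sup>2 \<ge> 2"
proof -
  assume R: "R > 0" "norm x \<ge> 2 * R"
  have "(2 * R)\<^sup>2 \<le> (norm x)\<^sup>2" using R by (intro power_mono) auto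
  moreover have "2 * R\<^sup>2 \<le> (2 * R)\<^sup>2" by (simp add: power_mult_distrib)
  ultimately have "2 * R\<^sup>2 \<le> x \<bullet> x" unfolding power2_norm_eq_inner[symmetric] by linarith
  with R show ?thesis by (simp add: le_divide_eq)
qed

lemma ball_cutoff_eq_0: "R > 0 \<Longrightarrow> norm x \<ge> 2 * R \<Longrightarrow> ball_cutoff R x = 0"
  unfolding ball_cutoff_def by (intro cutoff_eq_0 two_le_inner_div)

lemma ball_cutoff_slope_eq_0: 
  assumes "R > 0" "norm x \<le> R \<or> norm x \<ge> 2 * R" shows "ball_cutoff_slope R x = 0"
proof (cases "norm x \<le> R")
  case True
  then have "(x \<bullet> x) / R\<^sup>2 \<le> 1" using assms(1)
    unfolding power2_norm_eq_inner[symmetric] by (simp add: divide_le_eq power_mono)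
  then show ?thesis by (simp add: ball_cutoff_slope_def cutoff'_eq_0)
next
  case False
  then have "(x \<bullet> x) / R\<^sup>2 \<ge> 2" using assms by (intro two_le_inner_div) auto
  then show ?thesis by (simp add: ball_cutoff_slope_def cutoff'_eq_0)
qed

lemma ball_cutoff_slope_bound: "\<bar>ball_cutoff_slope R x\<bar> \<le> 8 / R\<^sup>2"
  using cutoff'_bound[of "(x \<bullet> x) / R\<^sup>2"] by (auto simp: ball_cutoff_slope_def abs_mult intro!: divide_right_mono)

lemma ball_cutoff_slope_norm_bound:
  assumes "R > 0" shows "\<bar>ball_cutoff_slope R x\<bar> * norm x \<le> (16 / R) * indicator (cball 0 (2 * R)) x"
proof (cases "norm x \<le> 2 * R")
  case True
  have "\<bar>ball_cutoff_slope R x\<bar> * norm x \<le> 8 / R\<^sup>2 * (2 * R)"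
    using True ball_cutoff_slope_bound by (intro mult_mono) auto
  then show ?thesis using assms True by (simp add: power2_eq_square)
qed (use assms ball_cutoff_slope_eq_0[of R x] in simp)

text \<open>Bounds \<open>x\<close> times the gradient of the cutoff independently of
  \<open>R\<close>. This scale invariance provides the dominating function when \<open>R\<close>
  tends to infinity in Pohozaev's identity.\<close>

lemma ball_cutoff_slope_inner_bound:
  assumes "R > 0" shows "\<bar>ball_cutoff_slope R x\<bar> * (x \<bullet> x) \<le> 32 * indicator {x. R \<le> norm x} x * indicator (cball 0 (2 * R)) x"
proof (cases "R < norm x \<and> norm x \<le> 2 * R")
  case True
  have "\<bar>ball_cutoff_slope R x\<bar> * (x \<bullet> x) \<le> 8 / R\<^sup>2 * (2 * R)\<^sup>2"
    using True ball_cutoff_slope_bound assms power_mono[of "norm x" "2 * R" 2] by (intro mult_mono) (auto simp: power2_norm_eq_inner)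
  then show ?thesis using assms True by (simp add: power_mult_distrib)
qed (use assms ball_cutoff_slope_eq_0[of R x] in auto)

section \<open>Volume and integrability on balls\<close>

lemma integral_indicator_cball:
  assumes "R \<ge> 0"
  shows "integral\<^sup>L lborel (indicator (cball (0::real^'n) R) :: _ \<Rightarrow> real) = unit_ball_vol (real CARD('n)) * R ^ CARD('n)"
  using content_cball[OF assms, of "0::real^'n"] by simp

lemma integrable_indicator_cball: "integrable lborel (indicator (cball (0::'a::euclidean_space) R) :: _ \<Rightarrow> real)"
  by (auto intro!: integrable_real_indicator emeasure_bounded_finite)

lemma integrable_cball:
  fixes f :: "'a::euclidean_space \<Rightarrow> real"
  assumes "continuous_on UNIV f"
  shows "integrable lborel (\<lambda>x. f x * indicator (cball 0 R) x)"
proof -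
  have "set_integrable lborel (cball 0 R) f"
    unfolding set_integrable_def using assms
    by (intro borel_integrable_compact) (auto intro: continuous_on_subset)
  then show ?thesis by (simp add: set_integrable_def mult.commute)
qed

text \<open>Monotone convergence along integer radii: uniform bounds on balls, which is what cutoff
  arguments yield, become global integrability.\<close>

lemma integrable_bounded_balls:
  fixes f :: "'a::euclidean_space \<Rightarrow> real"
  assumes f: "continuous_on UNIV f" "\<And>x. f x \<ge> 0"
    and bd: "\<And>n::nat. n \<ge> n0 \<Longrightarrow> (LBINT x. f x * indicator (cball 0 (real n)) x) \<le> C"
  shows "integrable lborel f"
proof -
  let ?f = "\<lambda>n x. f x * indicator (cball 0 (real n)) x"
  have mono: "incseq (\<lambda>n. integral\<^sup>L lborel (?f n))"
    using f(2) by (intro incseq_SucI integral_mono integrable_cball f) (auto simp: indicator_def)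
  have "integral\<^sup>L lborel (?f n) \<le> C" for n
    using bd[of "max n n0"] incseqD[OF mono, of n "max n n0"] by simp
  then obtain L where L: "(\<lambda>n. integral\<^sup>L lborel (?f n)) \<longlonglongrightarrow> L"
    using incseq_convergent[OF mono] by metis
  have lim: "(\<lambda>n. ?f n x) \<longlonglongrightarrow> f x" for x
  proof (rule tendsto_eventually)
    show "\<forall>\<^sub>F n in sequentially. ?f n x = f x"
      using eventually_ge_at_top[of "nat \<lceil>norm x\<rceil>"]
    proof eventually_elim
      case (elim n)
      then have "norm x \<le> real n" by linarith
      then show ?case by simp
    qed
  qed
  show ?thesis
  proof (rule integrable_monotone_convergence[OF integrable_cball[OF f(1)] _ _ L])
    show "AE x in lborel. mono (\<lambda>n. ?f n x)"
      using f(2) by (intro AE_I2 incseq_SucI) (auto simp: indicator_def)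
    show "AE x in lborel. (\<lambda>n. ?f n x) \<longlonglongrightarrow> f x" using lim by simp
    show "f \<in> borel_measurable lborel" using f(1) borel_measurable_continuous_onI by auto
  qed
qed

text \<open>A form of Young's inequality with a free parameter: depending on whether w^(q - e)
  exceeds \<open>M\<close>, one of the two terms alone dominates.\<close>

lemma powr_le_powr_div_add:
  fixes w :: real
  assumes "w \<ge> 0" "M > 0" "0 < e" "e < q"
  shows "w powr e \<le> w powr q / M + M powr (e / (q - e))"
proof (cases "w powr (q - e) \<ge> M")
  case True
  then have w: "w > 0" using assms by (cases "w = 0") auto
  have "w powr e * M \<le> w powr e * w powr (q - e)" using True by (intro mult_left_mono) auto
  also have "\<dots> = w powr q" by (simp flip: powr_add)
  finally have "w powr e \<le> w powr q / M" using assms by (simp add: le_divide_eq)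
  then show ?thesis by (simp add: add_increasing2)
next
  case False
  have "w powr e = (w powr (q - e)) powr (e / (q - e))" using assms by (simp add: powr_powr)
  also have "\<dots> \<le> M powr (e / (q - e))" using False assms by (intro powr_mono2) auto
  finally show ?thesis using assms by (simp add: add_increasing)
qed

lemma integral_outside_ball_tendsto_0:
  fixes f :: "'a::euclidean_space \<Rightarrow> real"
  assumes "integrable lborel f"
  shows "((\<lambda>R. (LBINT x. f x * indicator {x. R \<le> norm x} x)) \<longlongrightarrow> 0) at_top"
proof -
  have [measurable]: "f \<in> borel_measurable borel" using assms borel_measurable_integrable by fastforce
  have "((\<lambda>R. (LBINT x. f x * indicator {x. R \<le> norm x} x)) \<longlongrightarrow> integral\<^sup>L lborel (\<lambda>x::'a. 0)) at_top"
  proof (rule integral_dominated_convergence_at_top[where w="\<lambda>x. norm (f x)"])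
    show "AE x in lborel. ((\<lambda>R. f x * indicator {x. R \<le> norm x} x) \<longlongrightarrow> 0) at_top"
    proof (rule AE_I2, rule tendsto_eventually)
      fix x :: 'a
      show "\<forall>\<^sub>F R in at_top. f x * indicator {x. R \<le> norm x} x = 0"
        using eventually_gt_at_top[of "norm x"] by eventually_elim simp
    qed
    show "\<forall>\<^sub>F R in at_top. AE x in lborel. norm (f x * indicator {x. R \<le> norm x} x) \<le> norm (f x)"
      by (intro always_eventually allI AE_I2) (simp add: indicator_def)
  qed (use assms in \<open>auto intro: integrable_norm\<close>)
  then show ?thesis by simp
qed

text \<open>Outside a large fixed ball, Young's inequality makes the scaled average small; on that ball the scaling factor does.\<close>

lemma ball_average_tendsto_0:
  fixes w :: "real^'n \<Rightarrow> real"
  assumes w: "continuous_on UNIV w" "\<And>x. w x \<ge> 0" and e: "0 < e" "e < q" and int: "integrable lborel (\<lambda>x. w x powr q)" and c: "c > 0"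
  shows "((\<lambda>R. R powr (- (real CARD('n) * (1 - e / q))) * (LBINT x. w x powr e * indicator (cball 0 (c * R)) x)) \<longlongrightarrow> 0) at_top"
proof (rule tendstoI)
  fix \<epsilon> :: real assume \<epsilon>: "\<epsilon> > 0"
  define N where "N = real CARD('n)"
  define \<sigma> where "\<sigma> = N * (1 - e / q)"
  have N: "N > 0" and q: "q > 0" and \<sigma>: "\<sigma> > 0" using e by (auto simp: N_def \<sigma>_def intro!: mult_pos_pos)
  define \<omega> where "\<omega> = unit_ball_vol N * c ^ CARD('n)"
  have \<omega>: "\<omega> > 0" using c N by (auto simp: \<omega>_def intro!: mult_pos_pos unit_ball_vol_pos)
  \<comment> \<open>Chosen so that the volume term of Young's inequality contributes exactly
    \<epsilon> / 4, whatever \<open>R\<close> is.\<close>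
  define \<mu> where "\<mu> = (\<epsilon> / (4 * \<omega>)) powr ((q - e) / e)"
  have \<mu>: "\<mu> > 0" using \<epsilon> \<omega> by (auto simp: \<mu>_def)
  have \<mu>2: "\<mu> powr (e / (q - e)) * \<omega> = \<epsilon> / 4" using \<epsilon> \<omega> e by (simp add: \<mu>_def powr_powr)
  have ce: "continuous_on UNIV (\<lambda>x. w x powr e)" using w e by (intro continuous_on_powr') auto
  have cq: "continuous_on UNIV (\<lambda>x. w x powr q)" using w q by (intro continuous_on_powr') auto
  have "\<forall>\<^sub>F \<rho> in at_top. (LBINT x. w x powr q * indicator {x. \<rho> \<le> norm x} x) < \<mu> * \<epsilon> / 4"
    using order_tendstoD(2)[OF integral_outside_ball_tendsto_0[OF int], of "\<mu> * \<epsilon> / 4"] \<mu> \<epsilon> by simp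
  then obtain \<rho> where \<rho>: "(LBINT x. w x powr q * indicator {x. \<rho> \<le> norm x} x) < \<mu> * \<epsilon> / 4"
    using eventually_happens trivial_limit_at_top_linorder by blast
  define K where "K = (LBINT x. w x powr e * indicator (cball 0 \<rho>) x)"
  have "((\<lambda>R::real. R powr (- \<sigma>) * K) \<longlongrightarrow> 0 * K) at_top"
    using \<sigma> by (intro tendsto_intros tendsto_neg_powr filterlim_ident) auto
  then have "\<forall>\<^sub>F R in at_top. R powr (- \<sigma>) * K < \<epsilon> / 4"
    using \<epsilon> by (intro order_tendstoD(2)) auto
  then show "\<forall>\<^sub>F R in at_top. dist (R powr (- (real CARD('n) * (1 - e / q))) * (LBINT x. w x powr e * indicator (cball 0 (c * R)) x)) 0 < \<epsilon>"
    using eventually_gt_at_top[of 0]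
  proof eventually_elim
    case (elim R)
    have iq: "integrable lborel (\<lambda>x. w x powr q * indicator {x. \<rho> \<le> norm x} x)"
      using int by (intro integrable_real_mult_indicator) auto
    have pt: "R powr (- \<sigma>) * (w x powr e * indicator (cball 0 (c * R)) x) \<le> R powr (- \<sigma>) * (w x powr e * indicator (cball 0 \<rho>) x)
       + ((1 / \<mu>) * (w x powr q * indicator {x. \<rho> \<le> norm x} x) + \<mu> powr (e / (q - e)) * R powr (- N) * indicator (cball 0 (c * R)) x)" for x
    proof (cases "norm x \<le> \<rho> \<or> norm x > c * R")
      case True
      then show ?thesis using \<mu> by (auto simp: indicator_def)
    next
      case False
      \<comment> \<open>The factor \<open>R powr (- \<sigma>)\<close> in \<open>M\<close> cancels
        the prefactor of the first Young term and makes the second scale like R^(-N), the inverse of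
        the volume of the ball.\<close>
      define M where "M = \<mu> * R powr (- \<sigma>)"
      have M: "M > 0" using \<mu> elim by (simp add: M_def)
      have "R powr (- \<sigma>) * w x powr e \<le> R powr (- \<sigma>) * (w x powr q / M + M powr (e / (q - e)))"
        using powr_le_powr_div_add[OF w(2) M e] by (intro mult_left_mono) auto
      also have "\<dots> = (1 / \<mu>) * w x powr q + R powr (- \<sigma>) * M powr (e / (q - e))"
        using elim by (simp add: M_def distrib_left)
      also have "R powr (- \<sigma>) * M powr (e / (q - e)) = \<mu> powr (e / (q - e)) * (R powr (- \<sigma>) * R powr (- \<sigma> * (e / (q - e))))"
        using \<mu> by (simp add: M_def powr_mult powr_powr)
      also have "R powr (- \<sigma>) * R powr (- \<sigma> * (e / (q - e))) = R powr (- N)"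
      proof -
        have "\<sigma> + \<sigma> * (e / (q - e)) = N"
          using e q by (simp add: \<sigma>_def field_simps)
        then have "- \<sigma> + - \<sigma> * (e / (q - e)) = - N" by (simp add: algebra_simps)
        then show ?thesis by (simp flip: powr_add)
      qed
      finally show ?thesis using False by (simp add: indicator_def)
    qed
    have "R powr (- \<sigma>) * (LBINT x. w x powr e * indicator (cball 0 (c * R)) x)
      = (LBINT x. R powr (- \<sigma>) * (w x powr e * indicator (cball 0 (c * R)) x))" by simp
    also have "\<dots> \<le> (LBINT x. R powr (- \<sigma>) * (w x powr e * indicator (cball 0 \<rho>) x)
       + ((1 / \<mu>) * (w x powr q * indicator {x. \<rho> \<le> norm x} x) + \<mu> powr (e / (q - e)) * R powr (- N) * indicator (cball 0 (c * R)) x))"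
      by (rule integral_mono)
        (intro pt Bochner_Integration.integrable_add integrable_mult_right integrable_cball ce iq integrable_indicator_cball)+
    also have "\<dots> = R powr (- \<sigma>) * K + ((1 / \<mu>) * (LBINT x. w x powr q * indicator {x. \<rho> \<le> norm x} x)
       + \<mu> powr (e / (q - e)) * R powr (- N) * integral\<^sup>L lborel (indicator (cball (0::real^'n) (c * R))))"
      unfolding K_def by (subst Bochner_Integration.integral_add,
        intro Bochner_Integration.integrable_add integrable_mult_right integrable_cball ce iq integrable_indicator_cball,
        intro Bochner_Integration.integrable_add integrable_mult_right integrable_cball ce iq integrable_indicator_cball,
        subst Bochner_Integration.integral_add,
        intro Bochner_Integration.integrable_add integrable_mult_right integrable_cball ce iq integrable_indicator_cball,
        intro Bochner_Integration.integrable_add integrable_mult_right integrable_cball ce iq integrable_indicator_cball) simp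
    also have "\<mu> powr (e / (q - e)) * R powr (- N) * integral\<^sup>L lborel (indicator (cball (0::real^'n) (c * R))) = \<mu> powr (e / (q - e)) * \<omega> * (R powr (- N) * R ^ CARD('n))"
    proof -
      have "integral\<^sup>L lborel (indicator (cball (0::real^'n) (c * R))) = unit_ball_vol N * (c * R) ^ CARD('n)"
        unfolding N_def using c elim by (intro integral_indicator_cball) simp
      then show ?thesis by (simp only:) (simp add: \<omega>_def power_mult_distrib)
    qed
    also have "R powr (- N) * R ^ CARD('n) = 1"
      using elim by (simp add: N_def powr_realpow[symmetric] flip: powr_add)
    also have "R powr (- \<sigma>) * K + ((1 / \<mu>) * (LBINT x. w x powr q * indicator {x. \<rho> \<le> norm x} x) + \<mu> powr (e / (q - e)) * \<omega> * 1) < \<epsilon> / 4 + (\<epsilon> / 4 + \<epsilon> / 4)"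
    proof (rule add_strict_mono[OF elim(1) add_less_le_mono])
      show "(1 / \<mu>) * (LBINT x. w x powr q * indicator {x. \<rho> \<le> norm x} x) < \<epsilon> / 4"
        using \<rho> \<mu> by (simp add: divide_less_eq mult.commute)
    qed (use \<mu>2 in simp)
    also have "\<dots> < \<epsilon>" using \<epsilon> by simp
    finally have "R powr (- \<sigma>) * (LBINT x. w x powr e * indicator (cball 0 (c * R)) x) < \<epsilon>" .
    moreover have "0 \<le> R powr (- \<sigma>) * (LBINT x. w x powr e * indicator (cball 0 (c * R)) x)"
      by (intro mult_nonneg_nonneg Bochner_Integration.integral_nonneg) auto
    ultimately show ?case by (simp add: \<sigma>_def N_def)
  qed
qed

text \<open>Absorbs a lower power of \<open>w\<close> into half of w^q although both carry cutoffs.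
  The cutoff enters through a power large enough that the factor of \<xi> left over in the remainder
  has a nonnegative exponent; \<open>t\<close> will be the norm of the gradient of \<xi>.\<close>

lemma young_cutoff:
  fixes c e q :: real and k :: nat
  assumes c: "c > 0" and e: "0 < e" "e < q" and k: "real (2 * k) \<ge> 2 + 2 * e / (q - e)"
  shows "\<exists>K\<ge>0. \<forall>w \<xi> t. 0 \<le> w \<longrightarrow> 0 \<le> \<xi> \<longrightarrow> \<xi> \<le> 1 \<longrightarrow> 0 \<le> t \<longrightarrow>
    c * (w powr e * (\<xi> ^ (2 * k - 2) * t\<^sup>2)) \<le> (1 / 2) * (w powr q * \<xi> ^ (2 * k)) + K * t powr (2 * q / (q - e))"
proof (intro exI[of _ "c * (2 * c) powr (e / (q - e))"] conjI allI impI)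
  show "0 \<le> c * (2 * c) powr (e / (q - e))" using c by simp
  fix w \<xi> t :: real assume w: "0 \<le> w" and \<xi>: "0 \<le> \<xi>" "\<xi> \<le> 1" and t: "0 \<le> t"
  have kk: "real (2 * k - 2) \<ge> 2 * e / (q - e)" "2 * k \<ge> 2"
  proof -
    have "2 * e / (q - e) \<ge> 0" using e by simp
    then show "2 * k \<ge> 2" using k by linarith
    then have "real (2 * k - 2) = real (2 * k) - 2" by (subst of_nat_diff) auto
    with k show "real (2 * k - 2) \<ge> 2 * e / (q - e)" by linarith
  qed
  show "c * (w powr e * (\<xi> ^ (2 * k - 2) * t\<^sup>2)) \<le> (1 / 2) * (w powr q * \<xi> ^ (2 * k)) + c * (2 * c) powr (e / (q - e)) * t powr (2 * q / (q - e))"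
  proof (cases "w = 0 \<or> \<xi> = 0 \<or> t = 0")
    case True
    show ?thesis
    proof (cases "\<xi> = 0 \<and> 2 * k - 2 = 0")
      case True
      \<comment> \<open>As 0 ^ 0 = 1, the left-hand side need not vanish here; the lower bound on
        \<open>k\<close> together with e > 0 excludes this case.\<close>
      then have "2 * e / (q - e) \<le> 0" using kk(1) by simp
      then show ?thesis using e by (simp add: divide_le_0_iff)
    next
      case False
      then have "c * (w powr e * (\<xi> ^ (2 * k - 2) * t\<^sup>2)) = 0" using True by (auto simp: power_0_left)
      moreover have "0 \<le> (1 / 2) * (w powr q * \<xi> ^ (2 * k)) + c * (2 * c) powr (e / (q - e)) * t powr (2 * q / (q - e))"
        using c \<xi> by (intro add_nonneg_nonneg mult_nonneg_nonneg) auto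
      ultimately show ?thesis by linarith
    qed
  next
    case False
    then have pos: "w > 0" "\<xi> > 0" "t > 0" using w \<xi> t by auto
    \<comment> \<open>With this parameter the first Young term becomes exactly half of the absorbing
      term.\<close>
    define M where "M = 2 * c * t\<^sup>2 / \<xi>\<^sup>2"
    have M: "M > 0" using pos c by (simp add: M_def)
    have "c * (w powr e * (\<xi> ^ (2 * k - 2) * t\<^sup>2)) \<le> c * ((w powr q / M + M powr (e / (q - e))) * (\<xi> ^ (2 * k - 2) * t\<^sup>2))"
      using powr_le_powr_div_add[OF w M e] c \<xi> by (intro mult_left_mono mult_right_mono) auto
    also have "\<dots> = c * (w powr q / M * (\<xi> ^ (2 * k - 2) * t\<^sup>2)) + c * (M powr (e / (q - e)) * (\<xi> ^ (2 * k - 2) * t\<^sup>2))"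
      by (simp add: distrib_left distrib_right)
    finally have le: "c * (w powr e * (\<xi> ^ (2 * k - 2) * t\<^sup>2)) \<le> c * (w powr q / M * (\<xi> ^ (2 * k - 2) * t\<^sup>2)) + c * (M powr (e / (q - e)) * (\<xi> ^ (2 * k - 2) * t\<^sup>2))" .
    have X1: "c * (w powr q / M * (\<xi> ^ (2 * k - 2) * t\<^sup>2)) = (1 / 2) * (w powr q * \<xi> ^ (2 * k))"
    proof -
      have "\<xi> ^ (2 * k) = \<xi> ^ (2 * k - 2) * \<xi>\<^sup>2" using kk(2) by (cases k) (simp_all add: power2_eq_square)
      moreover have "w powr q / M = w powr q * \<xi>\<^sup>2 / (2 * c * t\<^sup>2)" by (simp add: M_def)
      ultimately show ?thesis using pos c by simp
    qed
    have X2: "c * (M powr (e / (q - e)) * (\<xi> ^ (2 * k - 2) * t\<^sup>2)) \<le> c * (2 * c) powr (e / (q - e)) * t powr (2 * q / (q - e))"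
    proof -
      have t2: "t\<^sup>2 = t powr 2" "\<xi>\<^sup>2 = \<xi> powr 2" using pos by (simp_all add: powr_numeral)
      have "M powr (e / (q - e)) = (2 * c) powr (e / (q - e)) * t powr (2 * e / (q - e)) * \<xi> powr (- (2 * e / (q - e)))"
      proof -
        have "M = (2 * c) * t powr 2 * \<xi> powr (- 2)"
          using pos by (simp add: M_def powr_minus_divide)
        then have "M powr (e / (q - e)) = (2 * c) powr (e / (q - e)) * t powr (2 * (e / (q - e))) * \<xi> powr (- 2 * (e / (q - e)))"
          by (simp only: powr_mult powr_powr)
        then show ?thesis by simp
      qed
      then have "M powr (e / (q - e)) * (\<xi> ^ (2 * k - 2) * t\<^sup>2)
        = (2 * c) powr (e / (q - e)) * (t powr (2 * e / (q - e)) * t powr 2) * (\<xi> powr (- (2 * e / (q - e))) * \<xi> powr real (2 * k - 2))"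
        using pos by (simp add: t2(1) powr_realpow mult_ac del: powr_numeral)
      also have "t powr (2 * e / (q - e)) * t powr 2 = t powr (2 * q / (q - e))"
      proof -
        have "2 * e / (q - e) + 2 = 2 * q / (q - e)" using e by (simp add: field_simps)
        then show ?thesis by (simp flip: powr_add)
      qed
      also have "(2 * c) powr (e / (q - e)) * t powr (2 * q / (q - e)) * (\<xi> powr (- (2 * e / (q - e))) * \<xi> powr real (2 * k - 2))
        \<le> (2 * c) powr (e / (q - e)) * t powr (2 * q / (q - e)) * 1"
      proof (rule mult_left_mono)
        show "\<xi> powr (- (2 * e / (q - e))) * \<xi> powr real (2 * k - 2) \<le> 1"
          unfolding powr_add[symmetric] using kk(1) pos \<xi> by (intro powr_le1) auto
      qed simp
      finally have "M powr (e / (q - e)) * (\<xi> ^ (2 * k - 2) * t\<^sup>2) \<le> (2 * c) powr (e / (q - e)) * t powr (2 * q / (q - e)) * 1" .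
      then have "c * (M powr (e / (q - e)) * (\<xi> ^ (2 * k - 2) * t\<^sup>2)) \<le> c * ((2 * c) powr (e / (q - e)) * t powr (2 * q / (q - e)))"
        using c by (intro mult_left_mono) auto
      then show ?thesis by (simp add: mult.assoc)
    qed
    show ?thesis by (rule order_trans[OF le]) (rule add_mono[OF eq_refl[OF X1] X2])
  qed
qed

section \<open>Energy estimates for solutions stable outside a ball\<close>

text \<open>The gradient of |u|^s u_i \<psi> is a combination of grad u_i, u_i V and u_i grad
  \<psi>. Summation over \<open>i\<close> turns every mixed product with grad u_i into a product
  with \<open>v\<close>, so systems need no more terms than a scalar equation.\<close>

lemma sum_inner_expand:
  fixes y :: "real^'m" and G :: "'m \<Rightarrow> 'a::real_inner"
  assumes v: "v = (\<Sum>i\<in>UNIV. (y $ i) *\<^sub>R G i)"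
  shows "(\<Sum>i\<in>UNIV. (\<alpha> *\<^sub>R G i + (\<beta> * y $ i) *\<^sub>R v + (\<gamma> * y $ i) *\<^sub>R d) \<bullet> (\<alpha> *\<^sub>R G i + (\<beta> * y $ i) *\<^sub>R v + (\<gamma> * y $ i) *\<^sub>R d))
      = \<alpha>\<^sup>2 * (\<Sum>i\<in>UNIV. G i \<bullet> G i) + (2 * \<alpha> * \<beta> + \<beta>\<^sup>2 * (y \<bullet> y)) * (v \<bullet> v)
        + (2 * \<alpha> * \<gamma> + 2 * \<beta> * \<gamma> * (y \<bullet> y)) * (v \<bullet> d) + \<gamma>\<^sup>2 * (y \<bullet> y) * (d \<bullet> d)" (is ?A)
    and "(\<Sum>i\<in>UNIV. G i \<bullet> (\<alpha> *\<^sub>R G i + (\<beta> * y $ i) *\<^sub>R v + (\<gamma> * y $ i) *\<^sub>R d))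
      = \<alpha> * (\<Sum>i\<in>UNIV. G i \<bullet> G i) + \<beta> * (v \<bullet> v) + \<gamma> * (v \<bullet> d)" (is ?B)
proof -
  have yy: "y \<bullet> y = (\<Sum>i\<in>UNIV. y $ i * y $ i)" by (simp add: inner_vec_def)
  have vw: "v \<bullet> z = (\<Sum>i\<in>UNIV. y $ i * (G i \<bullet> z))" for z by (simp add: v inner_sum_left)
  have e: "(\<alpha> *\<^sub>R G i + (\<beta> * y $ i) *\<^sub>R v + (\<gamma> * y $ i) *\<^sub>R d) \<bullet> (\<alpha> *\<^sub>R G i + (\<beta> * y $ i) *\<^sub>R v + (\<gamma> * y $ i) *\<^sub>R d)
    = \<alpha>\<^sup>2 * (G i \<bullet> G i) + 2 * \<alpha> * \<beta> * (y $ i * (G i \<bullet> v)) + \<beta>\<^sup>2 * (v \<bullet> v) * (y $ i * y $ i)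
     + 2 * \<alpha> * \<gamma> * (y $ i * (G i \<bullet> d)) + 2 * \<beta> * \<gamma> * (v \<bullet> d) * (y $ i * y $ i) + \<gamma>\<^sup>2 * (d \<bullet> d) * (y $ i * y $ i)" for i
    by (simp add: inner_add_left inner_add_right inner_commute[of v "G i"] inner_commute[of d "G i"] inner_commute[of d v]
        power2_eq_square algebra_simps)
  show ?A
    unfolding e sum.distrib sum_distrib_left[symmetric] vw[symmetric] yy[symmetric]
    by (simp add: algebra_simps)
  have e: "G i \<bullet> (\<alpha> *\<^sub>R G i + (\<beta> * y $ i) *\<^sub>R v + (\<gamma> * y $ i) *\<^sub>R d)
    = \<alpha> * (G i \<bullet> G i) + \<beta> * (y $ i * (G i \<bullet> v)) + \<gamma> * (y $ i * (G i \<bullet> d))" for i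
    by (simp add: inner_add_right algebra_simps)
  show ?B
    unfolding e sum.distrib sum_distrib_left[symmetric] vw[symmetric] by simp
qed

text \<open>The arithmetic-geometric mean inequality, in the form used to absorb cross terms after
  Cauchy-Schwarz.\<close>

lemma abs_le_weighted_sum:
  fixes A L Y \<epsilon> :: real
  assumes "0 \<le> A" "0 \<le> L" "Y\<^sup>2 \<le> A * L" "\<epsilon> > 0"
  shows "\<bar>Y\<bar> \<le> \<epsilon> * A + L / (4 * \<epsilon>)"
proof -
  have "4 * (\<epsilon> * A) * (L / (4 * \<epsilon>)) = A * L" using assms(4) by simp
  moreover have "(\<epsilon> * A + L / (4 * \<epsilon>))\<^sup>2 = (\<epsilon> * A - L / (4 * \<epsilon>))\<^sup>2 + 4 * (\<epsilon> * A) * (L / (4 * \<epsilon>))"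
    by (simp only: power2_sum power2_diff)
  ultimately have "Y\<^sup>2 \<le> (\<epsilon> * A + L / (4 * \<epsilon>))\<^sup>2"
    using assms(3) zero_le_power2[of "\<epsilon> * A - L / (4 * \<epsilon>)"] by linarith
  then have "\<bar>Y\<bar>\<^sup>2 \<le> (\<epsilon> * A + L / (4 * \<epsilon>))\<^sup>2" by simp
  then show ?thesis using assms by (intro power2_le_imp_le[of "\<bar>Y\<bar>"]) auto
qed

text \<open>The excess of \<open>\<kappa> (G + 2 s v)\<close> over \<open>G + (2 s + s\<^sup>2) v\<close> is a nonnegative multiple of \<open>G - v\<close>,
  where \<open>v\<close> stands for the squared gradient of the modulus.\<close>

lemma stability_algebra:
  fixes a b w G v d X \<psi> s \<epsilon> :: real
  assumes nn: "0 \<le> a" "0 \<le> b" "0 \<le> w" "0 \<le> G" "0 \<le> v" "0 \<le> d" "0 \<le> s"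
    and v: "v \<le> w * G" and X: "X\<^sup>2 \<le> v * d" and bw: "b * w = s * a" and \<epsilon>: "\<epsilon> > 0"
  defines "T \<equiv> (\<psi> * a)\<^sup>2 * G + (2 * (\<psi> * a) * (\<psi> * b) + (\<psi> * b)\<^sup>2 * w) * v + (2 * (\<psi> * a) * a + 2 * (\<psi> * b) * a * w) * X + a\<^sup>2 * w * d"
    and "E \<equiv> (\<psi>\<^sup>2 * a\<^sup>2) * G + (\<psi>\<^sup>2 * (2 * a * b)) * v + (2 * \<psi> * a\<^sup>2) * X"
    and "\<kappa> \<equiv> (1 + s)\<^sup>2 / (1 + 2 * s)" and "c \<equiv> 2 * (1 + s) * s / (1 + 2 * s)"
  shows "T \<le> (\<kappa> + 2 * c * \<epsilon>) * E + (4 * c * \<epsilon> + c / (4 * \<epsilon>) + 1) * (a\<^sup>2 * w * d)"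
proof -
  define A where "A = \<psi>\<^sup>2 * a\<^sup>2 * G"
  define B where "B = \<psi>\<^sup>2 * (a * b) * v"
  define Y where "Y = \<psi> * a\<^sup>2 * X"
  define L where "L = a\<^sup>2 * w * d"
  have A0: "A \<ge> 0" and B0: "B \<ge> 0" and L0: "L \<ge> 0" using nn by (auto simp: A_def B_def L_def)
  have BA: "B \<le> s * A"
  proof -
    have "b * v \<le> b * (w * G)" using v nn by (intro mult_left_mono) auto
    also have "\<dots> = s * a * G" using bw by (simp flip: mult.assoc)
    finally have "(\<psi>\<^sup>2 * a) * (b * v) \<le> (\<psi>\<^sup>2 * a) * (s * a * G)" using nn by (intro mult_left_mono) auto
    then show ?thesis by (simp add: A_def B_def power2_eq_square mult_ac)
  qed
  have T: "T = A + (2 + s) * B + 2 * (1 + s) * Y + L"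
  proof -
    have 1: "(\<psi> * b)\<^sup>2 * w = \<psi>\<^sup>2 * b * (s * a)" unfolding bw[symmetric] by (simp add: power2_eq_square)
    have 2: "2 * (\<psi> * b) * a * w = 2 * \<psi> * a * (s * a)" unfolding bw[symmetric] by simp
    show ?thesis unfolding T_def 1 2 by (simp add: A_def B_def Y_def L_def power2_eq_square algebra_simps)
  qed
  have E: "E = A + 2 * B + 2 * Y" by (simp add: E_def A_def B_def Y_def algebra_simps)
  have YAL: "Y\<^sup>2 \<le> A * L"
  proof -
    have "X\<^sup>2 \<le> (w * G) * d" using X v nn by (meson mult_right_mono order_trans)
    then have "(\<psi>\<^sup>2 * (a\<^sup>2)\<^sup>2) * X\<^sup>2 \<le> (\<psi>\<^sup>2 * (a\<^sup>2)\<^sup>2) * ((w * G) * d)" by (intro mult_left_mono) auto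
    then show ?thesis by (simp add: Y_def A_def L_def power_mult_distrib power2_eq_square mult_ac)
  qed
  have Y1: "\<bar>Y\<bar> \<le> \<epsilon> * A + L / (4 * \<epsilon>)" by (rule abs_le_weighted_sum[OF A0 L0 YAL \<epsilon>])
  \<comment> \<open>With the weight 1/4 the cross term of \<open>E\<close> takes away only half of
    \<open>A\<close>, so \<open>A\<close> is controlled by \<open>E\<close> and
    \<open>L\<close>.\<close>
  have "\<bar>Y\<bar> \<le> (1 / 4) * A + L / (4 * (1 / 4))" by (rule abs_le_weighted_sum[OF A0 L0 YAL]) simp
  then have A2: "A \<le> 2 * E + 4 * L" using E B0 by simp
  have s1: "1 + 2 * s > 0" using nn by simp
  have \<kappa>: "\<kappa> * (1 + 2 * s) = (1 + s)\<^sup>2" and cc: "c * (1 + 2 * s) = 2 * (1 + s) * s"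
    using s1 by (simp_all add: \<kappa>_def c_def)
  have c0: "c \<ge> 0" using nn by (simp add: c_def)
  have "(1 + 2 * s) * (A + (2 + s) * B) \<le> (1 + 2 * s) * (\<kappa> * (A + 2 * B))"
  proof -
    have "(1 + 2 * s) * (\<kappa> * (A + 2 * B)) - (1 + 2 * s) * (A + (2 + s) * B) = (1 + s)\<^sup>2 * (A + 2 * B) - (1 + 2 * s) * (A + (2 + s) * B)"
      unfolding \<kappa>[symmetric] by simp
    also have "\<dots> = s * (s * A - B)" by (simp add: power2_eq_square algebra_simps)
    also have "\<dots> \<ge> 0" using BA nn by simp
    finally show ?thesis by simp
  qed
  then have 1: "A + (2 + s) * B \<le> \<kappa> * (A + 2 * B)" using s1 by simp
  \<comment> \<open>So \<open>c\<close> is the coefficient of the cross term that remains after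
    \<open>\<kappa> * E\<close> has been split off.\<close>
  have "(1 + 2 * s) * (2 * (1 + s) - 2 * \<kappa>) = (1 + 2 * s) * c"
    using \<kappa> cc by (simp add: power2_eq_square algebra_simps)
  then have 2: "2 * (1 + s) - 2 * \<kappa> = c" using s1 by simp
  have "T \<le> \<kappa> * E + c * Y + L"
    using 1 unfolding T E 2[symmetric] by (simp add: algebra_simps)
  also have "c * Y \<le> c * (\<epsilon> * (2 * E + 4 * L) + L / (4 * \<epsilon>))"
    using c0 Y1 A2 \<epsilon> by (intro mult_left_mono) (auto intro: order_trans[OF _ add_right_mono[OF mult_left_mono[OF A2]]])
  finally show ?thesis by (simp add: L_def algebra_simps)
qed

section \<open>The Caccioppoli inequality and the weighted stability estimate\<close>

context lane_emden
begin

text \<open>The energy identity with weight \<psi>^2; the cross term is absorbed into half of the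
  gradient term.\<close>

lemma caccioppoli:
  assumes \<psi>: "C1_grad \<psi> D" and supp: "\<And>x. norm x > r \<Longrightarrow> \<psi> x = 0"
  shows "(LBINT x. (\<psi> x)\<^sup>2 * Gsq x) \<le> 2 * (LBINT x. (\<psi> x)\<^sup>2 * S x) + 4 * (LBINT x. (u x \<bullet> u x) * (D x \<bullet> D x))"
proof -
  have suppD: "norm x > r \<Longrightarrow> D x = 0" for x by (rule C1_grad_eq_0_outside[OF \<psi> supp])
  note cont = C1_grad_continuous[OF \<psi>] C1_grad_continuous_grad[OF \<psi>] Gsq_cont S_cont V_cont u_cont
  have \<psi>2: "C1_grad (\<lambda>x. (\<psi> x)\<^sup>2) (\<lambda>x. (2 * \<psi> x) *\<^sub>R D x)"
    using C1_grad_power[OF \<psi>, of 2] by simp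
  have en: "(LBINT x. (\<psi> x)\<^sup>2 * Gsq x + V x \<bullet> ((2 * \<psi> x) *\<^sub>R D x)) = (LBINT x. (\<psi> x)\<^sup>2 * S x)"
    by (rule energy_identity[OF \<psi>2, where r=r]) (simp add: supp)
  have i1: "integrable lborel (\<lambda>x. (\<psi> x)\<^sup>2 * Gsq x)"
    by (rule integrable_continuous_bounded_support[where r=r]) (auto simp: supp suppD intro!: continuous_intros cont)
  have i2: "integrable lborel (\<lambda>x. (u x \<bullet> u x) * (D x \<bullet> D x))"
    by (rule integrable_continuous_bounded_support[where r=r]) (auto simp: supp suppD intro!: continuous_intros cont)
  have i3: "integrable lborel (\<lambda>x. (\<psi> x)\<^sup>2 * Gsq x + V x \<bullet> ((2 * \<psi> x) *\<^sub>R D x))"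
    by (rule integrable_continuous_bounded_support[where r=r]) (auto simp: supp suppD intro!: continuous_intros cont)
  have pt: "(\<psi> x)\<^sup>2 * Gsq x \<le> 2 * ((\<psi> x)\<^sup>2 * Gsq x + V x \<bullet> ((2 * \<psi> x) *\<^sub>R D x)) + 4 * ((u x \<bullet> u x) * (D x \<bullet> D x))" for x
  proof -
    have "\<bar>\<psi> x * (V x \<bullet> D x)\<bar> \<le> (1 / 4) * ((\<psi> x)\<^sup>2 * Gsq x) + ((u x \<bullet> u x) * (D x \<bullet> D x)) / (4 * (1 / 4))"
    proof (rule abs_le_weighted_sum)
      have "(V x \<bullet> D x)\<^sup>2 \<le> (V x \<bullet> V x) * (D x \<bullet> D x)" by (rule Cauchy_Schwarz_ineq)
      also have "\<dots> \<le> ((u x \<bullet> u x) * Gsq x) * (D x \<bullet> D x)" using V_bound by (intro mult_right_mono) auto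
      finally have "(\<psi> x)\<^sup>2 * (V x \<bullet> D x)\<^sup>2 \<le> (\<psi> x)\<^sup>2 * (((u x \<bullet> u x) * Gsq x) * (D x \<bullet> D x))" by (intro mult_left_mono) auto
      then show "(\<psi> x * (V x \<bullet> D x))\<^sup>2 \<le> (\<psi> x)\<^sup>2 * Gsq x * ((u x \<bullet> u x) * (D x \<bullet> D x))"
        by (simp add: power_mult_distrib mult_ac)
    qed (auto simp: Gsq_nonneg)
    then have "- (4 * (\<psi> x * (V x \<bullet> D x))) \<le> (\<psi> x)\<^sup>2 * Gsq x + 4 * ((u x \<bullet> u x) * (D x \<bullet> D x))"
      by (simp add: abs_le_iff)
    moreover have "V x \<bullet> ((2 * \<psi> x) *\<^sub>R D x) = 2 * (\<psi> x * (V x \<bullet> D x))" by simp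
    ultimately show ?thesis by (simp only:) (simp add: algebra_simps)
  qed
  have "(LBINT x. (\<psi> x)\<^sup>2 * Gsq x) \<le> (LBINT x. 2 * ((\<psi> x)\<^sup>2 * Gsq x + V x \<bullet> ((2 * \<psi> x) *\<^sub>R D x)) + 4 * ((u x \<bullet> u x) * (D x \<bullet> D x)))"
    by (rule integral_mono[OF i1 _ pt]) (intro Bochner_Integration.integrable_add integrable_mult_right i2 i3)
  also have "\<dots> = 2 * (LBINT x. (\<psi> x)\<^sup>2 * Gsq x + V x \<bullet> ((2 * \<psi> x) *\<^sub>R D x)) + 4 * (LBINT x. (u x \<bullet> u x) * (D x \<bullet> D x))"
    by (subst Bochner_Integration.integral_add[OF integrable_mult_right[OF i3] integrable_mult_right[OF i2]])
      (simp only: integral_mult_right_zero)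
  finally show ?thesis unfolding en .
qed

text \<open>A negative radius imposes no condition on \<open>\<phi>\<close>.\<close>

definition stable_outside :: "real \<Rightarrow> bool" where
  "stable_outside R0 \<longleftrightarrow> (\<forall>\<phi>. test_fun \<phi> \<longrightarrow> (\<forall>x. norm x < R0 \<longrightarrow> \<phi> x = 0) \<longrightarrow> Qform p u \<phi> \<ge> 0)"

lemma C1_grad_pw_u:
  assumes "s \<ge> 0"
  shows "C1_grad (\<lambda>x. pw s (u x) * u x $ i) (\<lambda>x. pw s (u x) *\<^sub>R g i x + (s * norm (u x) powr (s - 2) * u x $ i) *\<^sub>R V x)"
proof -
  have "(\<Sum>k\<in>UNIV. ((pw s y *\<^sub>R axis i 1 + (c * y $ i) *\<^sub>R y) $ k) *\<^sub>R g k x) = pw s y *\<^sub>R g i x + (c * y $ i) *\<^sub>R (\<Sum>k\<in>UNIV. (y $ k) *\<^sub>R g k x)" for y c x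
  proof -
    have "(\<Sum>k\<in>UNIV. ((pw s y *\<^sub>R axis i 1 + (c * y $ i) *\<^sub>R y) $ k) *\<^sub>R g k x)
      = (\<Sum>k\<in>UNIV. (if k = i then pw s y *\<^sub>R g k x else 0) + (c * y $ i) *\<^sub>R ((y $ k) *\<^sub>R g k x))"
      by (intro sum.cong refl) (auto simp: axis_def scaleR_add_left)
    then show ?thesis by (simp add: sum.distrib scaleR_sum_right)
  qed
  note expand = this
  have "C1_grad (\<lambda>x. pw s (u x) * u x $ i)
    (\<lambda>x. \<Sum>k\<in>UNIV. ((pw s (u x) *\<^sub>R axis i 1 + (s * norm (u x) powr (s - 2) * u x $ i) *\<^sub>R u x) $ k) *\<^sub>R g k x)"
    by (rule C1_grad_compose_vec[OF C1_grad_pw_nth[OF assms] u])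
  then show ?thesis unfolding expand V_def .
qed

text \<open>Stability bounds p times the integral of \<open>P\<close> by that of \<open>T\<close>,
  the equation makes the integrals of \<open>E\<close> and \<open>P\<close> equal, and
  \<open>stability_algebra\<close> bounds \<open>T\<close> by nearly \<kappa> times \<open>E\<close>
  plus a term in |grad \<psi>|^2. As \<kappa> < p, the integral of \<open>P\<close> can be absorbed,
  with a constant independent of \<psi>.\<close>

lemma stable_weighted_estimate:
  assumes stab: "stable_outside R0" and s: "s \<ge> 0" and ps: "(1 + s)\<^sup>2 / (1 + 2 * s) < p"
  shows "\<exists>C>0. \<forall>\<psi> D r. C1_grad \<psi> D \<longrightarrow> (\<forall>x. norm x > r \<longrightarrow> \<psi> x = 0) \<longrightarrow> (\<forall>x. norm x < R0 + 1 \<longrightarrow> \<psi> x = 0) \<longrightarrow>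
    (LBINT x. norm (u x) powr (p + 1 + 2 * s) * (\<psi> x)\<^sup>2) \<le> C * (LBINT x. norm (u x) powr (2 + 2 * s) * (D x \<bullet> D x))"
proof -
  define \<kappa> where "\<kappa> = (1 + s)\<^sup>2 / (1 + 2 * s)"
  define c where "c = 2 * (1 + s) * s / (1 + 2 * s)"
  \<comment> \<open>The error 2 c \<epsilon> thus uses up at most half of the gap p - \<kappa>;
    adding 1 to \<open>c\<close> covers the case s = 0, where c = 0.\<close>
  define \<epsilon> where "\<epsilon> = (p - \<kappa>) / (4 * (c + 1))"
  define C where "C = 4 * c * \<epsilon> + c / (4 * \<epsilon>) + 1"
  have c0: "c \<ge> 0" using s by (simp add: c_def)
  have \<epsilon>0: "\<epsilon> > 0" using c0 ps by (simp add: \<epsilon>_def \<kappa>_def)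
  have C0: "C > 0" using c0 \<epsilon>0 by (simp add: C_def add_nonneg_pos)
  have pk: "p - \<kappa> > 0" using ps by (simp add: \<kappa>_def)
  have \<epsilon>2: "2 * c * \<epsilon> \<le> (p - \<kappa>) / 2"
  proof -
    have "2 * c * \<epsilon> = (p - \<kappa>) / 2 * (c / (c + 1))" using c0 by (simp add: \<epsilon>_def field_simps)
    also have "\<dots> \<le> (p - \<kappa>) / 2 * 1" using c0 pk by (intro mult_left_mono) auto
    finally show ?thesis by simp
  qed
  show ?thesis
  proof (intro exI[of _ "2 * C / (p - \<kappa>)"] conjI allI impI)
    show "0 < 2 * C / (p - \<kappa>)" using C0 pk by simp
    fix \<psi> :: "real^'n \<Rightarrow> real" and D r assume \<psi>: "C1_grad \<psi> D" and supp: "\<forall>x. norm x > r \<longrightarrow> \<psi> x = 0" and supp0: "\<forall>x. norm x < R0 + 1 \<longrightarrow> \<psi> x = 0"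
    have suppD: "norm x > r \<Longrightarrow> D x = 0" for x using C1_grad_eq_0_outside[OF \<psi>, of r] supp by blast
    note cont = C1_grad_continuous[OF \<psi>] C1_grad_continuous_grad[OF \<psi>] u_cont g_cont
    define a where "a x = pw s (u x)" for x
    define b where "b x = s * norm (u x) powr (s - 2)" for x
    define \<phi> where "\<phi> x = (\<psi> x * a x) *\<^sub>R u x" for x
    define \<Phi> where "\<Phi> i x = (\<psi> x * a x) *\<^sub>R g i x + (\<psi> x * b x * u x $ i) *\<^sub>R V x + (a x * u x $ i) *\<^sub>R D x" for i x
    \<comment> \<open>The gradient of the second test function \<psi>^2 |u|^(2 s) u_i, with
      coefficients arranged for \<open>sum_inner_expand\<close>.\<close>
    define \<Phi>' where "\<Phi>' i x = ((\<psi> x)\<^sup>2 * (a x)\<^sup>2) *\<^sub>R g i x + ((\<psi> x)\<^sup>2 * (2 * a x * b x) * u x $ i) *\<^sub>R V x + (2 * \<psi> x * (a x)\<^sup>2 * u x $ i) *\<^sub>R D x" for i x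
    define T where "T x = (\<Sum>i\<in>UNIV. \<Phi> i x \<bullet> \<Phi> i x)" for x
    define E where "E x = (\<Sum>i\<in>UNIV. g i x \<bullet> \<Phi>' i x)" for x
    define P where "P x = norm (u x) powr (p + 1 + 2 * s) * (\<psi> x)\<^sup>2" for x
    define L where "L x = norm (u x) powr (2 + 2 * s) * (D x \<bullet> D x)" for x
    have a2: "(a x)\<^sup>2 = pw (2 * s) (u x)" for x
      using pw_mult[OF s s, of "u x"] by (simp add: a_def power2_eq_square)
    have ab2: "2 * a x * b x = 2 * s * norm (u x) powr (2 * s - 2)" for x
    proof (cases "s = 0 \<or> u x = 0")
      case False
      then have "norm (u x) powr s * norm (u x) powr (s - 2) = norm (u x) powr (2 * s - 2)" by (simp flip: powr_add)
      with False show ?thesis by (simp add: a_def b_def pw_def)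
    qed (auto simp: b_def)
    have bw: "b x * (u x \<bullet> u x) = s * a x" for x
    proof (cases "s = 0 \<or> u x = 0")
      case False
      then show ?thesis using norm_powr_mult_sq[of "u x" "s - 2"] by (simp add: a_def b_def pw_def power2_norm_eq_inner)
    qed (auto simp: b_def a_def pw_def)
    have a2w: "(a x)\<^sup>2 * (u x \<bullet> u x) = norm (u x) powr (2 + 2 * s)" for x
      using pw_mult_powr[of "2 * s" 2 "u x"] s unfolding a2 by (cases "u x = 0") (auto simp: powr_numeral power2_norm_eq_inner add.commute)
    have \<phi>: "C1_grad (\<lambda>x. \<phi> x $ i) (\<Phi> i)" for i
    proof -
      have "(\<lambda>x. \<psi> x *\<^sub>R (pw s (u x) *\<^sub>R g i x + (s * norm (u x) powr (s - 2) * u x $ i) *\<^sub>R V x) + (pw s (u x) * u x $ i) *\<^sub>R D x) = \<Phi> i"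
        by (simp add: \<Phi>_def a_def b_def fun_eq_iff scaleR_add_right mult_ac)
      moreover have "(\<lambda>x. \<psi> x * (pw s (u x) * u x $ i)) = (\<lambda>x. \<phi> x $ i)"
        by (simp add: \<phi>_def a_def fun_eq_iff)
      ultimately show ?thesis using C1_grad_mult[OF \<psi> C1_grad_pw_u[OF s], of i] by simp
    qed
    have \<phi>': "C1_grad (\<lambda>x. (\<psi> x)\<^sup>2 * (pw (2 * s) (u x) * u x $ i)) (\<Phi>' i)" for i
    proof -
      have "(\<lambda>x. (\<psi> x)\<^sup>2 *\<^sub>R (pw (2 * s) (u x) *\<^sub>R g i x + (2 * s * norm (u x) powr (2 * s - 2) * u x $ i) *\<^sub>R V x) + (pw (2 * s) (u x) * u x $ i) *\<^sub>R ((2 * \<psi> x) *\<^sub>R D x)) = \<Phi>' i"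
        unfolding \<Phi>'_def a2 ab2 by (simp add: fun_eq_iff scaleR_add_right mult_ac)
      moreover have "C1_grad (\<lambda>x. (\<psi> x)\<^sup>2) (\<lambda>x. (2 * \<psi> x) *\<^sub>R D x)"
        using C1_grad_power[OF \<psi>, of 2] by simp
      moreover have "2 * s \<ge> 0" using s by simp
      ultimately show ?thesis using C1_grad_mult[OF _ C1_grad_pw_u, of "\<lambda>x. (\<psi> x)\<^sup>2" "\<lambda>x. (2 * \<psi> x) *\<^sub>R D x" "2 * s" i] by simp
    qed
    have supp\<phi>: "norm x > r \<Longrightarrow> \<phi> x = 0" for x using supp by (simp add: \<phi>_def)
    have i\<Phi>: "integrable lborel (\<lambda>x. \<Phi> i x \<bullet> \<Phi> i x)" for i
      by (rule integrable_continuous_bounded_support[where r=r])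
        (auto simp: \<Phi>_def suppD supp intro!: continuous_intros C1_grad_continuous_grad[OF \<phi>, unfolded \<Phi>_def])
    have i\<Phi>': "integrable lborel (\<lambda>x. g i x \<bullet> \<Phi>' i x)" for i
      by (rule integrable_continuous_bounded_support[where r=r])
        (auto simp: \<Phi>'_def suppD supp intro!: continuous_intros g_cont C1_grad_continuous_grad[OF \<phi>', unfolded \<Phi>'_def])
    have iT: "integrable lborel T" unfolding T_def using i\<Phi> by simp
    have iE: "integrable lborel E" unfolding E_def using i\<Phi>' by simp
    have iP: "integrable lborel P" unfolding P_def using s p1
      by (intro integrable_continuous_bounded_support[where r=r]) (auto simp: supp intro!: continuous_intros cont norm_u_powr_cont)
    have iL: "integrable lborel L" unfolding L_def using s p1
      by (intro integrable_continuous_bounded_support[where r=r]) (auto simp: suppD intro!: continuous_intros cont norm_u_powr_cont)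
    have up: "norm (u x) powr (p - 1) * ((a x)\<^sup>2 * (u x \<bullet> u x)) = norm (u x) powr (p + 1 + 2 * s)" for x
      unfolding a2w using p1 s by (simp flip: powr_add add: add_ac)
    \<comment> \<open>As \<open>\<phi> x\<close> is a multiple of \<open>u x\<close>, Cauchy-Schwarz
      is an equality and both zero-order terms reduce to \<open>P x\<close>, with weights 1 and p -
      1. This is where the full factor p is gained.\<close>
    have Q: "Q_density p u \<phi> \<Phi> x = T x - p * P x" for x
    proof -
      have 1: "norm (u x) powr (p - 1) * (\<phi> x \<bullet> \<phi> x) = P x"
        unfolding P_def up[symmetric] by (simp add: \<phi>_def power2_eq_square mult_ac)
      have 2: "norm (u x) powr (p - 3) * (u x \<bullet> \<phi> x)\<^sup>2 = P x"
      proof (cases "u x = 0")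
        case False
        have "norm (u x) powr (p - 3) * (u x \<bullet> u x) = norm (u x) powr (p - 1)"
          using norm_powr_mult_sq[OF False, of "p - 3"] by (simp add: power2_norm_eq_inner)
        then have "norm (u x) powr (p - 3) * (u x \<bullet> \<phi> x)\<^sup>2 = norm (u x) powr (p - 1) * (\<phi> x \<bullet> \<phi> x)"
          by (simp add: \<phi>_def power2_eq_square mult_ac)
        then show ?thesis using 1 by simp
      qed (simp add: P_def)
      show ?thesis unfolding Q_density_def 1 2 T_def by (simp add: algebra_simps)
    qed
    have "integral\<^sup>L lborel (Q_density p u \<phi> \<Phi>) \<ge> 0"
      by (rule Qform_C1_nonneg[OF p1 u_cont _ \<phi> supp\<phi>, where ?R0.0=R0])
        (use stab supp0 in \<open>auto simp: stable_outside_def \<phi>_def\<close>)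
    then have PT: "p * integral\<^sup>L lborel P \<le> integral\<^sup>L lborel T"
      unfolding Q[abs_def] using iT iP by simp
    have EP: "integral\<^sup>L lborel E = integral\<^sup>L lborel P"
    proof -
      have iw: "integrable lborel (\<lambda>x. norm (u x) powr (p - 1) * u x $ i * ((\<psi> x)\<^sup>2 * (pw (2 * s) (u x) * u x $ i)))" for i
        using p1 by (intro integrable_continuous_bounded_support[where r=r])
          (auto simp: supp intro!: continuous_intros cont norm_u_powr_cont u_nth_cont C1_grad_continuous[OF C1_grad_pw_u] s)
      have "integral\<^sup>L lborel E = (\<Sum>i\<in>UNIV. (LBINT x. g i x \<bullet> \<Phi>' i x))"
        unfolding E_def using i\<Phi>' by simp
      also have "\<dots> = (\<Sum>i\<in>UNIV. (LBINT x. norm (u x) powr (p - 1) * u x $ i * ((\<psi> x)\<^sup>2 * (pw (2 * s) (u x) * u x $ i))))"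
        using supp by (intro sum.cong refl weak_form[OF \<phi>', where r=r]) simp
      also have "\<dots> = (LBINT x. (\<Sum>i\<in>UNIV. norm (u x) powr (p - 1) * u x $ i * ((\<psi> x)\<^sup>2 * (pw (2 * s) (u x) * u x $ i))))"
        using iw by simp
      also have "(\<lambda>x. \<Sum>i\<in>UNIV. norm (u x) powr (p - 1) * u x $ i * ((\<psi> x)\<^sup>2 * (pw (2 * s) (u x) * u x $ i))) = P"
        unfolding P_def[abs_def] up[symmetric] a2 by (simp add: inner_vec_def sum_distrib_left sum_distrib_right mult_ac)
      finally show ?thesis .
    qed
    have pt: "T x \<le> (\<kappa> + 2 * c * \<epsilon>) * E x + C * L x" for x
    proof -
      have Teq: "T x = (\<psi> x * a x)\<^sup>2 * Gsq x + (2 * (\<psi> x * a x) * (\<psi> x * b x) + (\<psi> x * b x)\<^sup>2 * (u x \<bullet> u x)) * (V x \<bullet> V x)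
        + (2 * (\<psi> x * a x) * a x + 2 * (\<psi> x * b x) * a x * (u x \<bullet> u x)) * (V x \<bullet> D x) + (a x)\<^sup>2 * (u x \<bullet> u x) * (D x \<bullet> D x)"
        unfolding T_def \<Phi>_def Gsq_def by (rule sum_inner_expand(1)) (simp add: V_def)
      have Eeq: "E x = ((\<psi> x)\<^sup>2 * (a x)\<^sup>2) * Gsq x + ((\<psi> x)\<^sup>2 * (2 * a x * b x)) * (V x \<bullet> V x) + (2 * \<psi> x * (a x)\<^sup>2) * (V x \<bullet> D x)"
        unfolding E_def \<Phi>'_def Gsq_def by (rule sum_inner_expand(2)) (simp add: V_def)
      show ?thesis
        unfolding Teq Eeq L_def a2w[symmetric] \<kappa>_def C_def c_def
        by (rule stability_algebra)
          (use s \<epsilon>0 bw V_bound in \<open>auto simp: a_def b_def pw_nonneg Gsq_nonneg Cauchy_Schwarz_ineq\<close>)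
    qed
    have "integral\<^sup>L lborel T \<le> (LBINT x. (\<kappa> + 2 * c * \<epsilon>) * E x + C * L x)"
      by (rule integral_mono[OF iT _ pt]) (intro Bochner_Integration.integrable_add integrable_mult_right iE iL)
    also have "\<dots> = (\<kappa> + 2 * c * \<epsilon>) * integral\<^sup>L lborel P + C * integral\<^sup>L lborel L"
      using iE iL EP by simp
    finally have "(p - \<kappa> - 2 * c * \<epsilon>) * integral\<^sup>L lborel P \<le> C * integral\<^sup>L lborel L"
      using PT by (simp add: algebra_simps)
    moreover have "((p - \<kappa>) / 2) * integral\<^sup>L lborel P \<le> (p - \<kappa> - 2 * c * \<epsilon>) * integral\<^sup>L lborel P"
      using \<epsilon>2 by (intro mult_right_mono Bochner_Integration.integral_nonneg) (auto simp: P_def field_simps)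
    ultimately have "((p - \<kappa>) / 2) * integral\<^sup>L lborel P \<le> C * integral\<^sup>L lborel L" by linarith
    then have "integral\<^sup>L lborel P \<le> 2 * C / (p - \<kappa>) * integral\<^sup>L lborel L"
      using pk by (simp add: field_simps)
    then show "(LBINT x. norm (u x) powr (p + 1 + 2 * s) * (\<psi> x)\<^sup>2) \<le> 2 * C / (p - \<kappa>) * (LBINT x. norm (u x) powr (2 + 2 * s) * (D x \<bullet> D x))"
      unfolding P_def[abs_def] L_def[abs_def] .
  qed
qed

end

text \<open>A cutoff that vanishes near the origin, as stability outside a ball demands, and far
  away. The inner radius \<rho> will stay fixed while \<open>R\<close> grows.\<close>

lemma C1_grad_ball_cutoff_pair:
  assumes "\<rho> > 0" "R > 0"
  defines "\<xi> \<equiv> \<lambda>x::'a::euclidean_space. (1 + (- 1) * ball_cutoff \<rho> x) * ball_cutoff R x"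
    and "D \<equiv> \<lambda>x. (1 + (- 1) * ball_cutoff \<rho> x) *\<^sub>R (ball_cutoff_slope R x *\<^sub>R x) + ball_cutoff R x *\<^sub>R (0 + (- 1) *\<^sub>R (ball_cutoff_slope \<rho> x *\<^sub>R x))"
  shows "C1_grad \<xi> D"
    and "norm (D x) \<le> 16 / R * indicator (cball 0 (2 * R)) x + 16 / \<rho> * indicator (cball 0 (2 * \<rho>)) x"
proof -
  show "C1_grad \<xi> D"
    unfolding \<xi>_def D_def by (intro C1_grad_mult C1_grad_add C1_grad_const C1_grad_cmult C1_grad_ball_cutoff)
  have "norm (D x) \<le> norm ((1 + (- 1) * ball_cutoff \<rho> x) *\<^sub>R (ball_cutoff_slope R x *\<^sub>R x)) + norm (ball_cutoff R x *\<^sub>R (0 + (- 1) *\<^sub>R (ball_cutoff_slope \<rho> x *\<^sub>R x)))"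
    unfolding D_def by (rule norm_triangle_ineq)
  also have "\<dots> = \<bar>1 - ball_cutoff \<rho> x\<bar> * (\<bar>ball_cutoff_slope R x\<bar> * norm x) + \<bar>ball_cutoff R x\<bar> * (\<bar>ball_cutoff_slope \<rho> x\<bar> * norm x)"
    by (simp add: abs_mult mult.assoc)
  also have "\<dots> \<le> 1 * (16 / R * indicator (cball 0 (2 * R)) x) + 1 * (16 / \<rho> * indicator (cball 0 (2 * \<rho>)) x)"
    using assms(1,2) ball_cutoff_bounds[of \<rho> x] ball_cutoff_bounds[of R x]
    by (intro add_mono mult_mono ball_cutoff_slope_norm_bound) auto
  finally show "norm (D x) \<le> 16 / R * indicator (cball 0 (2 * R)) x + 16 / \<rho> * indicator (cball 0 (2 * \<rho>)) x" by simp
qed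

lemma powr_sum_indicator_bound:
  fixes t a b \<mu> :: real
  assumes "0 \<le> t" "t \<le> a * indicator A x + b * indicator B x" "0 \<le> a" "0 \<le> b" "\<mu> > 0"
  shows "t powr \<mu> \<le> (2 * a) powr \<mu> * indicator A x + (2 * b) powr \<mu> * indicator B x"
proof -
  have "t \<le> max (2 * a * indicator A x) (2 * b * indicator B x)"
    using assms by (auto simp: indicator_def max_def)
  then have "t powr \<mu> \<le> (max (2 * a * indicator A x) (2 * b * indicator B x)) powr \<mu>"
    using assms by (intro powr_mono2) auto
  also have "\<dots> \<le> (2 * a * indicator A x) powr \<mu> + (2 * b * indicator B x) powr \<mu>"
    by (auto simp: max_def)
  also have "\<dots> = (2 * a) powr \<mu> * indicator A x + (2 * b) powr \<mu> * indicator B x"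
    by (auto simp: indicator_def)
  finally show ?thesis .
qed

text \<open>The power \<mu> of a gradient of size 1/R, integrated over a ball of radius 2 R, stays
  bounded for large R because \<mu> is at least the dimension. The number 32 is the bound 16 for the
  slope, doubled by \<open>powr_sum_indicator_bound\<close>.\<close>

lemma cutoff_energy_bound:
  assumes "real CARD('n) \<le> \<mu>" "R \<ge> 1"
  shows "(32 / R) powr \<mu> * integral\<^sup>L lborel (indicator (cball (0::real^'n) (2 * R))) \<le> 32 powr \<mu> * (unit_ball_vol (real CARD('n)) * 2 ^ CARD('n))"
proof -
  have R: "R > 0" using assms by simp
  have 1: "integral\<^sup>L lborel (indicator (cball (0::real^'n) (2 * R))) = unit_ball_vol (real CARD('n)) * (2 * R) ^ CARD('n)"
    using R by (intro integral_indicator_cball) simp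
  have "R ^ CARD('n) = R powr real CARD('n)" using R by (simp add: powr_realpow)
  also have "\<dots> \<le> R powr \<mu>" using assms by (intro powr_mono) auto
  finally have 2: "R ^ CARD('n) / R powr \<mu> \<le> 1" using R by simp
  have "(32 / R) powr \<mu> * (unit_ball_vol (real CARD('n)) * (2 * R) ^ CARD('n))
      = 32 powr \<mu> * (unit_ball_vol (real CARD('n)) * 2 ^ CARD('n)) * (R ^ CARD('n) / R powr \<mu>)"
    using R by (simp add: powr_divide power_mult_distrib)
  also have "\<dots> \<le> 32 powr \<mu> * (unit_ball_vol (real CARD('n)) * 2 ^ CARD('n)) * 1"
    using 2 by (intro mult_left_mono) (auto intro!: mult_nonneg_nonneg less_imp_le[OF unit_ball_vol_pos])
  finally show ?thesis unfolding 1 by simp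
qed

section \<open>Integrability of powers of the solution and of its gradient\<close>

context lane_emden
begin

text \<open>In the weighted estimate with \<psi> = \<xi>^k, Young's inequality absorbs half of the
  left-hand side and leaves the power \<mu> = 2 (p + 1 + 2 s) / (p - 1) of the gradient of \<xi>.
  The hypothesis on the dimension says that \<mu> is large enough for
  \<open>cutoff_energy_bound\<close>.\<close>

lemma stable_integrable:
  assumes stab: "stable_outside R0" and s: "s \<ge> 0" and ps: "(1 + s)\<^sup>2 / (1 + 2 * s) < p"
    and N: "real CARD('n) \<le> 2 * (p + 1 + 2 * s) / (p - 1)"
  shows "integrable lborel (\<lambda>x. norm (u x) powr (p + 1 + 2 * s))"
proof -
  define q where "q = p + 1 + 2 * s"
  define e where "e = 2 + 2 * s"
  have qe: "0 < e" "e < q" "q - e = p - 1" "q > 0" using s p1 by (auto simp: q_def e_def)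
  define \<mu> where "\<mu> = 2 * q / (q - e)"
  have \<mu>: "real CARD('n) \<le> \<mu>" using N unfolding \<mu>_def qe(3) by (simp add: q_def)
  have \<mu>0: "\<mu> > 0" using qe by (simp add: \<mu>_def)
  define k where "k = nat \<lceil>1 + e / (q - e)\<rceil>"
  have k: "real (2 * k) \<ge> 2 + 2 * e / (q - e)"
  proof -
    have "1 + e / (q - e) \<le> real k" unfolding k_def by linarith
    then show ?thesis by simp
  qed
  have k1: "k \<ge> 1"
  proof -
    have "2 * e / (q - e) \<ge> 0" using qe by simp
    then show ?thesis using k by linarith
  qed
  from stable_weighted_estimate[OF stab s ps] obtain C where C: "C > 0"
    and C_all: "\<forall>\<psi> D r. C1_grad \<psi> D \<longrightarrow> (\<forall>x. norm x > r \<longrightarrow> \<psi> x = 0) \<longrightarrow> (\<forall>x. norm x < R0 + 1 \<longrightarrow> \<psi> x = 0) \<longrightarrow>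
      (LBINT x. norm (u x) powr q * (\<psi> x)\<^sup>2) \<le> C * (LBINT x. norm (u x) powr e * (D x \<bullet> D x))"
    unfolding q_def[symmetric] e_def[symmetric] by (elim exE conjE)
  note C2 = C_all[THEN spec, THEN spec, THEN spec, THEN mp, THEN mp, THEN mp]
  have Ck: "C * (real k)\<^sup>2 > 0" using C k1 by simp
  obtain K where K: "K \<ge> 0" "\<And>w \<xi> t. 0 \<le> w \<Longrightarrow> 0 \<le> \<xi> \<Longrightarrow> \<xi> \<le> 1 \<Longrightarrow> 0 \<le> t \<Longrightarrow>
    C * (real k)\<^sup>2 * (w powr e * (\<xi> ^ (2 * k - 2) * t\<^sup>2)) \<le> (1 / 2) * (w powr q * \<xi> ^ (2 * k)) + K * t powr \<mu>"
    using young_cutoff[OF Ck qe(1,2) k] unfolding \<mu>_def by blast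
  \<comment> \<open>\<open>cutoff_energy_bound\<close> asks for a radius of at least 1, the weighted
    estimate for functions that vanish where \<open>norm x < R0 + 1\<close>.\<close>
  define \<rho> where "\<rho> = max 1 (R0 + 1)"
  have \<rho>: "\<rho> \<ge> 1" "\<rho> \<ge> R0 + 1" by (auto simp: \<rho>_def)
  define J where "J = 32 powr \<mu> * (unit_ball_vol (real CARD('n)) * 2 ^ CARD('n))"
  have cq: "continuous_on UNIV (\<lambda>x. norm (u x) powr q)" using qe by (intro norm_u_powr_cont) auto
  have ce: "continuous_on UNIV (\<lambda>x. norm (u x) powr e)" using qe by (intro norm_u_powr_cont) auto
  define A where "A = (LBINT x. norm (u x) powr q * indicator (cball 0 (2 * \<rho>)) x)"
  have "(LBINT x. norm (u x) powr q * indicator (cball 0 (real n)) x) \<le> A + 4 * K * J" if n: "n \<ge> 1" for n :: nat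
  proof -
    define R where "R = real n"
    have R: "R \<ge> 1" using n by (simp add: R_def)
    define \<xi> where "\<xi> x = (1 + (- 1) * ball_cutoff \<rho> x) * ball_cutoff R x" for x :: "real^'n"
    define D where "D x = (1 + (- 1) * ball_cutoff \<rho> x) *\<^sub>R (ball_cutoff_slope R x *\<^sub>R x) + ball_cutoff R x *\<^sub>R (0 + (- 1) *\<^sub>R (ball_cutoff_slope \<rho> x *\<^sub>R x))" for x :: "real^'n"
    have \<xi>: "C1_grad \<xi> D" and Db: "norm (D x) \<le> 16 / R * indicator (cball 0 (2 * R)) x + 16 / \<rho> * indicator (cball 0 (2 * \<rho>)) x" for x
      using C1_grad_ball_cutoff_pair[of \<rho> R] R \<rho> unfolding \<xi>_def[abs_def] D_def[abs_def] by auto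
    have \<xi>01: "0 \<le> \<xi> x" "\<xi> x \<le> 1" for x
      using ball_cutoff_bounds[of \<rho> x] ball_cutoff_bounds[of R x] by (auto simp: \<xi>_def mult_le_one)
    have \<xi>out: "\<xi> x = 0" if "norm x > 2 * R" for x
      using that R ball_cutoff_eq_0[of R x] by (simp add: \<xi>_def)
    have \<xi>in: "\<xi> x = 0" if "norm x < R0 + 1" for x
      using that \<rho> ball_cutoff_eq_1[of x \<rho>] by (simp add: \<xi>_def)
    have Dout: "D x = 0" if "norm x > 2 * R" for x
      by (rule C1_grad_eq_0_outside[OF \<xi> \<xi>out that])
    define \<psi> where "\<psi> x = \<xi> x ^ k" for x
    have \<psi>: "C1_grad \<psi> (\<lambda>x. (real k * \<xi> x ^ (k - 1)) *\<^sub>R D x)"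
      unfolding \<psi>_def by (rule C1_grad_power[OF \<xi>])
    have est: "(LBINT x. norm (u x) powr q * (\<psi> x)\<^sup>2)
      \<le> C * (LBINT x. norm (u x) powr e * (((real k * \<xi> x ^ (k - 1)) *\<^sub>R D x) \<bullet> ((real k * \<xi> x ^ (k - 1)) *\<^sub>R D x)))"
      by (rule C2[OF \<psi>, of "2 * R"]) (use \<xi>out \<xi>in k1 in \<open>auto simp: \<psi>_def power_0_left\<close>)
    define P where "P x = norm (u x) powr q * \<xi> x ^ (2 * k)" for x
    have P: "norm (u x) powr q * (\<psi> x)\<^sup>2 = P x" for x
      by (simp add: P_def \<psi>_def power_mult[symmetric] mult.commute)
    have iP: "integrable lborel P" unfolding P_def using k1
      by (intro integrable_continuous_bounded_support[where r="2 * R"])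
        (auto simp: \<xi>out power_0_left intro!: continuous_intros cq C1_grad_continuous[OF \<xi>])
    have L: "norm (u x) powr e * (((real k * \<xi> x ^ (k - 1)) *\<^sub>R D x) \<bullet> ((real k * \<xi> x ^ (k - 1)) *\<^sub>R D x))
      = (real k)\<^sup>2 * (norm (u x) powr e * (\<xi> x ^ (2 * k - 2) * (norm (D x))\<^sup>2))" for x
    proof -
      have "\<xi> x ^ (k - 1) * \<xi> x ^ (k - 1) = \<xi> x ^ (2 * k - 2)"
      proof -
        have "k - 1 + (k - 1) = 2 * k - 2" by simp
        then show ?thesis by (simp only: power_add[symmetric])
      qed
      then show ?thesis by (simp add: power2_norm_eq_inner power2_eq_square[of "real k"] mult_ac flip: mult.assoc[of "\<xi> x ^ (k - 1)" "\<xi> x ^ (k - 1)"])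
    qed
    have iL: "integrable lborel (\<lambda>x. norm (u x) powr e * (\<xi> x ^ (2 * k - 2) * (norm (D x))\<^sup>2))"
      by (rule integrable_continuous_bounded_support[where r="2 * R"])
        (auto simp: Dout intro!: continuous_intros ce C1_grad_continuous[OF \<xi>] C1_grad_continuous_grad[OF \<xi>])
    define B where "B x = (32 / R) powr \<mu> * indicator (cball 0 (2 * R)) x + (32 / \<rho>) powr \<mu> * indicator (cball 0 (2 * \<rho>)) x" for x :: "real^'n"
    have iB: "integrable lborel B"
      unfolding B_def by (intro Bochner_Integration.integrable_add integrable_mult_right integrable_indicator_cball)
    have B: "integral\<^sup>L lborel B \<le> J + J"
    proof -
      have "integral\<^sup>L lborel B = (32 / R) powr \<mu> * integral\<^sup>L lborel (indicator (cball (0::real^'n) (2 * R))) + (32 / \<rho>) powr \<mu> * integral\<^sup>L lborel (indicator (cball (0::real^'n) (2 * \<rho>)))"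
        unfolding B_def by (subst Bochner_Integration.integral_add) (auto intro!: integrable_mult_right integrable_indicator_cball)
      then show ?thesis
        using cutoff_energy_bound[OF \<mu> R] cutoff_energy_bound[OF \<mu> \<rho>(1)] unfolding J_def by linarith
    qed
    have pt: "C * (real k)\<^sup>2 * (norm (u x) powr e * (\<xi> x ^ (2 * k - 2) * (norm (D x))\<^sup>2)) \<le> (1 / 2) * P x + K * B x" for x
    proof -
      have "norm (D x) powr \<mu> \<le> B x"
        using powr_sum_indicator_bound[OF _ Db _ _ \<mu>0, of x] R \<rho> by (simp add: B_def)
      then have "K * norm (D x) powr \<mu> \<le> K * B x" using K by (intro mult_left_mono) auto
      then show ?thesis using K(2)[of "norm (u x)" "\<xi> x" "norm (D x)"] \<xi>01[of x] by (simp add: P_def)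
    qed
    have "integral\<^sup>L lborel P \<le> C * ((real k)\<^sup>2 * (LBINT x. norm (u x) powr e * (\<xi> x ^ (2 * k - 2) * (norm (D x))\<^sup>2)))"
      using est unfolding P L integral_mult_right_zero .
    also have "\<dots> = (LBINT x. C * (real k)\<^sup>2 * (norm (u x) powr e * (\<xi> x ^ (2 * k - 2) * (norm (D x))\<^sup>2)))"
      by (simp only: integral_mult_right_zero mult.assoc)
    also have "\<dots> \<le> (LBINT x. (1 / 2) * P x + K * B x)"
      by (rule integral_mono[OF integrable_mult_right[OF iL] _ pt]) (intro Bochner_Integration.integrable_add integrable_mult_right iP iB)
    also have "\<dots> = (1 / 2) * integral\<^sup>L lborel P + K * integral\<^sup>L lborel B"
      using iP iB by (subst Bochner_Integration.integral_add) auto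
    also have "\<dots> \<le> (1 / 2) * integral\<^sup>L lborel P + K * (J + J)"
      using B K by (intro add_left_mono mult_left_mono) auto
    finally have PJ: "integral\<^sup>L lborel P \<le> 4 * K * J" by simp
    have "(LBINT x. norm (u x) powr q * indicator (cball 0 (real n)) x) \<le> (LBINT x. norm (u x) powr q * indicator (cball 0 (2 * \<rho>)) x + P x)"
    proof (rule integral_mono)
      fix x
      show "norm (u x) powr q * indicator (cball 0 (real n)) x \<le> norm (u x) powr q * indicator (cball 0 (2 * \<rho>)) x + P x"
      proof (cases "norm x \<le> real n \<and> norm x > 2 * \<rho>")
        case True
        then have "\<xi> x = 1" using \<rho> ball_cutoff_eq_1[of x R] ball_cutoff_eq_0[of \<rho> x] by (simp add: \<xi>_def R_def)
        then show ?thesis using True by (simp add: P_def)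
      next
        case False
        moreover have "P x \<ge> 0" using \<xi>01 by (simp add: P_def)
        ultimately show ?thesis by (auto simp: indicator_def)
      qed
    qed (intro Bochner_Integration.integrable_add integrable_cball cq iP)+
    also have "\<dots> = A + integral\<^sup>L lborel P"
      unfolding A_def by (intro Bochner_Integration.integral_add integrable_cball cq iP)
    finally show ?thesis using PJ by simp
  qed
  then have "integrable lborel (\<lambda>x. norm (u x) powr q)"
    by (rule integrable_bounded_balls[OF cq powr_ge_zero])
  then show ?thesis by (simp add: q_def)
qed

lemma u_sq_powr: "u x \<bullet> u x = norm (u x) powr 2"
  using p1 by (cases "u x = 0") (auto simp: powr_numeral power2_norm_eq_inner)

lemma caccioppoli_ball:
  assumes R: "R > 0"
  shows "(LBINT x. Gsq x * indicator (cball 0 R) x) \<le> 2 * (LBINT x. (ball_cutoff R x)\<^sup>2 * S x)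
    + 4 * (LBINT x. norm (u x) powr 2 * (\<bar>ball_cutoff_slope R x\<bar> * norm x)\<^sup>2)"
proof -
  have out: "ball_cutoff R x = 0" if "norm x > 2 * R" for x :: "real^'n" using that R ball_cutoff_eq_0[of R x] by simp
  have "(LBINT x. Gsq x * indicator (cball 0 R) x) \<le> (LBINT x. (ball_cutoff R x)\<^sup>2 * Gsq x)"
  proof (rule integral_mono)
    show "integrable lborel (\<lambda>x. (ball_cutoff R x)\<^sup>2 * Gsq x)"
      by (rule integrable_continuous_bounded_support[where r="2 * R"])
        (auto simp: out intro!: continuous_intros Gsq_cont C1_grad_continuous[OF C1_grad_ball_cutoff])
    show "Gsq x * indicator (cball 0 R) x \<le> (ball_cutoff R x)\<^sup>2 * Gsq x" for x
      using ball_cutoff_eq_1[of x R] Gsq_nonneg[of x] by (auto simp: indicator_def)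
  qed (rule integrable_cball[OF Gsq_cont])
  also have "\<dots> \<le> 2 * (LBINT x. (ball_cutoff R x)\<^sup>2 * S x) + 4 * (LBINT x. (u x \<bullet> u x) * ((ball_cutoff_slope R x *\<^sub>R x) \<bullet> (ball_cutoff_slope R x *\<^sub>R x)))"
    by (rule caccioppoli[OF C1_grad_ball_cutoff, of "2 * R"]) (rule out)
  also have "(\<lambda>x. (u x \<bullet> u x) * ((ball_cutoff_slope R x *\<^sub>R x) \<bullet> (ball_cutoff_slope R x *\<^sub>R x))) = (\<lambda>x. norm (u x) powr 2 * (\<bar>ball_cutoff_slope R x\<bar> * norm x)\<^sup>2)"
    unfolding u_sq_powr by (simp add: power_mult_distrib power2_norm_eq_inner power2_eq_square[of "ball_cutoff_slope R _"] mult.assoc)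
  finally show ?thesis .
qed

lemma integrable_ball_cutoff_slope:
  assumes R: "R > 0"
  shows "integrable lborel (\<lambda>x. norm (u x) powr 2 * (\<bar>ball_cutoff_slope R x\<bar> * norm x)\<^sup>2)"
proof -
  have c: "continuous_on UNIV (\<lambda>x::real^'n. \<bar>ball_cutoff_slope R x\<bar> * norm x)"
    by (intro continuous_intros ball_cutoff_slope_continuous)
  show ?thesis
    by (rule integrable_continuous_bounded_support[where r="2 * R"])
      (auto simp: ball_cutoff_slope_eq_0 R intro!: continuous_intros norm_u_powr_cont c u_cont)
qed

lemma integral_ball_cutoff_slope_le:
  assumes R: "R > 0"
  shows "(LBINT x. norm (u x) powr 2 * (\<bar>ball_cutoff_slope R x\<bar> * norm x)\<^sup>2) \<le> 256 * (R powr (- 2) * (LBINT x. norm (u x) powr 2 * indicator (cball 0 (2 * R)) x))"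
proof -
  have "(LBINT x. norm (u x) powr 2 * (\<bar>ball_cutoff_slope R x\<bar> * norm x)\<^sup>2) \<le> (LBINT x. 256 * R powr (- 2) * (norm (u x) powr 2 * indicator (cball 0 (2 * R)) x))"
  proof (rule integral_mono[OF integrable_ball_cutoff_slope[OF R]])
    show "integrable lborel (\<lambda>x. 256 * R powr (- 2) * (norm (u x) powr 2 * indicator (cball 0 (2 * R)) x))"
      by (intro integrable_mult_right integrable_cball norm_u_powr_cont) auto
    fix x :: "real^'n"
    have "(\<bar>ball_cutoff_slope R x\<bar> * norm x)\<^sup>2 \<le> ((16 / R) * indicator (cball 0 (2 * R)) x)\<^sup>2"
      by (intro power_mono ball_cutoff_slope_norm_bound R) auto
    also have "\<dots> = 256 * R powr (- 2) * indicator (cball 0 (2 * R)) x"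
      using R by (auto simp: indicator_def powr_minus power_divide divide_inverse power_inverse)
    finally have "norm (u x) powr 2 * (\<bar>ball_cutoff_slope R x\<bar> * norm x)\<^sup>2 \<le> norm (u x) powr 2 * (256 * R powr (- 2) * indicator (cball 0 (2 * R)) x)"
      by (rule mult_left_mono) auto
    then show "norm (u x) powr 2 * (\<bar>ball_cutoff_slope R x\<bar> * norm x)\<^sup>2 \<le> 256 * R powr (- 2) * (norm (u x) powr 2 * indicator (cball 0 (2 * R)) x)"
      by (simp only: mult_ac)
  qed
  also have "\<dots> = 256 * (R powr (- 2) * (LBINT x. norm (u x) powr 2 * indicator (cball 0 (2 * R)) x))"
    by (simp only: integral_mult_right_zero mult.assoc)
  finally show ?thesis .
qed

text \<open>Young's inequality splits the cutoff term of the Caccioppoli inequality into half of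
  \<open>S\<close> and a power of the slope with exponent at least the dimension, whose integral is
  bounded independently of the radius.\<close>

lemma Gsq_integrable:
  assumes iS: "integrable lborel S" and N: "real CARD('n) \<le> 2 * (p + 1) / (p - 1)"
  shows "integrable lborel Gsq"
proof -
  define \<mu> where "\<mu> = 2 * (p + 1) / (p + 1 - 2)"
  have \<mu>: "real CARD('n) \<le> \<mu>" using N by (simp add: \<mu>_def)
  have \<mu>0: "\<mu> > 0" using p1 by (simp add: \<mu>_def)
  \<comment> \<open>Any value admissible in \<open>young_cutoff\<close> will do, since that
    inequality is applied with \<xi> = 1.\<close>
  define k where "k = nat \<lceil>1 + 2 / (p - 1)\<rceil>"
  have k: "real (2 * k) \<ge> 2 + 2 * 2 / (p + 1 - 2)"
  proof -
    have "1 + 2 / (p - 1) \<le> real k" unfolding k_def by linarith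
    then show ?thesis by simp
  qed
  obtain K where K: "K \<ge> 0" "\<And>w \<xi> t. 0 \<le> w \<Longrightarrow> 0 \<le> \<xi> \<Longrightarrow> \<xi> \<le> 1 \<Longrightarrow> 0 \<le> t \<Longrightarrow>
    1 * (w powr 2 * (\<xi> ^ (2 * k - 2) * t\<^sup>2)) \<le> (1 / 2) * (w powr (p + 1) * \<xi> ^ (2 * k)) + K * t powr \<mu>"
    using young_cutoff[of 1 2 "p + 1", OF _ _ _ k] p1 unfolding \<mu>_def by auto
  define J where "J = 32 powr \<mu> * (unit_ball_vol (real CARD('n)) * 2 ^ CARD('n))"
  have "(LBINT x. Gsq x * indicator (cball 0 (real n)) x) \<le> 4 * integral\<^sup>L lborel S + 4 * (K * J)" if n: "n \<ge> 1" for n :: nat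
  proof -
    define R where "R = real n"
    have R: "R \<ge> 1" "R > 0" using n by (auto simp: R_def)
    have 1: "(LBINT x. (ball_cutoff R x)\<^sup>2 * S x) \<le> integral\<^sup>L lborel S"
    proof (rule integral_mono[OF _ iS])
      show "integrable lborel (\<lambda>x. (ball_cutoff R x)\<^sup>2 * S x)"
        by (rule integrable_continuous_bounded_support[where r="2 * R"])
          (auto simp: ball_cutoff_eq_0 R intro!: continuous_intros S_cont C1_grad_continuous[OF C1_grad_ball_cutoff])
      show "(ball_cutoff R x)\<^sup>2 * S x \<le> S x" for x
        using ball_cutoff_bounds[of R x] S_nonneg[of x] by (simp add: mult_left_le_one_le power_le_one)
    qed
    define B where "B x = (32 / R) powr \<mu> * indicator (cball 0 (2 * R)) x" for x :: "real^'n"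
    have iB: "integrable lborel B" unfolding B_def by (intro integrable_mult_right integrable_indicator_cball)
    have B: "integral\<^sup>L lborel B \<le> J"
      using cutoff_energy_bound[OF \<mu> R(1)] unfolding B_def J_def integral_mult_right_zero .
    have "(LBINT x. norm (u x) powr 2 * (\<bar>ball_cutoff_slope R x\<bar> * norm x)\<^sup>2) \<le> (LBINT x. (1 / 2) * S x + K * B x)"
    proof (rule integral_mono[OF integrable_ball_cutoff_slope[OF R(2)]])
      fix x :: "real^'n"
      have "\<bar>ball_cutoff_slope R x\<bar> * norm x \<le> 16 / R * indicator (cball 0 (2 * R)) x + 0 * indicator (cball 0 0) x"
        using ball_cutoff_slope_norm_bound[OF R(2), of x] by simp
      from powr_sum_indicator_bound[OF _ this _ _ \<mu>0] have "(\<bar>ball_cutoff_slope R x\<bar> * norm x) powr \<mu> \<le> B x"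
        using R by (simp add: B_def)
      then have "K * (\<bar>ball_cutoff_slope R x\<bar> * norm x) powr \<mu> \<le> K * B x" using K by (intro mult_left_mono) auto
      then show "norm (u x) powr 2 * (\<bar>ball_cutoff_slope R x\<bar> * norm x)\<^sup>2 \<le> (1 / 2) * S x + K * B x"
        using K(2)[of "norm (u x)" 1 "\<bar>ball_cutoff_slope R x\<bar> * norm x"] by (simp add: S_def)
    qed (intro Bochner_Integration.integrable_add integrable_mult_right iS iB)
    also have "\<dots> = (1 / 2) * integral\<^sup>L lborel S + K * integral\<^sup>L lborel B"
      using iS iB by (subst Bochner_Integration.integral_add) auto
    also have "\<dots> \<le> (1 / 2) * integral\<^sup>L lborel S + K * J"
      using B K by (intro add_left_mono mult_left_mono) auto
    finally show ?thesis using caccioppoli_ball[OF R(2)] 1 unfolding R_def by linarith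
  qed
  then show ?thesis
    using integrable_bounded_balls[OF Gsq_cont Gsq_nonneg, of 1] by blast
qed

section \<open>The subcritical and critical cases\<close>

text \<open>\<open>ball_average_tendsto_0\<close> with e = 2 and q = p + 1. The hypothesis on the
  dimension makes the exponent n (1 - 2 / (p + 1)) at most 2, so the factor R^(-2) decays fast
  enough.\<close>

lemma u_sq_decay:
  assumes iS: "integrable lborel S" and N: "real CARD('n) \<le> 2 * (p + 1) / (p - 1)"
  shows "((\<lambda>R. R powr (- 2) * (LBINT x. norm (u x) powr 2 * indicator (cball 0 (2 * R)) x)) \<longlongrightarrow> 0) at_top"
proof (rule Lim_null_comparison)
  let ?I = "\<lambda>R. (LBINT x. norm (u x) powr 2 * indicator (cball 0 (2 * R)) x)"
  show "((\<lambda>R. R powr (- (real CARD('n) * (1 - 2 / (p + 1)))) * ?I R) \<longlongrightarrow> 0) at_top"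
    by (rule ball_average_tendsto_0) (use p1 iS in \<open>auto simp: S_def[abs_def] intro!: continuous_intros u_cont\<close>)
  have le2: "real CARD('n) * (1 - 2 / (p + 1)) \<le> 2"
  proof -
    have "real CARD('n) * (1 - 2 / (p + 1)) = real CARD('n) * ((p - 1) / (p + 1))" using p1 by (simp add: field_simps)
    also have "\<dots> \<le> 2 * (p + 1) / (p - 1) * ((p - 1) / (p + 1))" using N p1 by (intro mult_right_mono) auto
    also have "\<dots> = 2" using p1 by (simp add: divide_eq_eq)
    finally show ?thesis .
  qed
  show "\<forall>\<^sub>F R in at_top. norm (R powr (- 2) * ?I R) \<le> R powr (- (real CARD('n) * (1 - 2 / (p + 1)))) * ?I R"
    using eventually_ge_at_top[of 1]
  proof eventually_elim
    case (elim R)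
    have "?I R \<ge> 0" by (intro Bochner_Integration.integral_nonneg) auto
    then show ?case using elim le2 by (auto intro!: mult_right_mono powr_mono)
  qed
qed

lemma integral_ball_cutoff_tendsto:
  assumes f: "integrable lborel f"
  shows "((\<lambda>R. integral\<^sup>L lborel (\<lambda>x::real^'n. ball_cutoff R x * f x)) \<longlongrightarrow> integral\<^sup>L lborel f) at_top"
proof (rule integral_dominated_convergence_at_top[where w="\<lambda>x. norm (f x)"])
  have cm: "ball_cutoff R \<in> borel_measurable (borel :: (real^'n) measure)" for R
    by (rule borel_measurable_continuous_onI[OF C1_grad_continuous[OF C1_grad_ball_cutoff]])
  show "(\<lambda>x. ball_cutoff R x * f x) \<in> borel_measurable lborel" for R :: real
    using cm f by auto
  show "AE x in lborel. ((\<lambda>R. ball_cutoff R x * f x) \<longlongrightarrow> f x) at_top"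
  proof (rule AE_I2, rule tendsto_eventually)
    fix x :: "real^'n"
    show "\<forall>\<^sub>F R in at_top. ball_cutoff R x * f x = f x"
      using eventually_ge_at_top[of "norm x"] by eventually_elim (simp add: ball_cutoff_eq_1)
  qed
  show "\<forall>\<^sub>F R in at_top. AE x in lborel. norm (ball_cutoff R x * f x) \<le> norm (f x)"
    by (intro always_eventually allI AE_I2) (simp add: abs_mult abs_of_nonneg[OF ball_cutoff_bounds(1)] mult_left_le_one_le ball_cutoff_bounds)
qed (use f in auto)

text \<open>The cross term of the energy identity lives where |x| >= R. There it is bounded by the
  tail of \<open>Gsq\<close> and by the scaled mass of |u|^2 from \<open>u_sq_decay\<close>, and
  both vanish in the limit.\<close>

lemma finite_energy_identity:
  assumes iS: "integrable lborel S" and iG: "integrable lborel Gsq" and N: "real CARD('n) \<le> 2 * (p + 1) / (p - 1)"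
  shows "integral\<^sup>L lborel Gsq = integral\<^sup>L lborel S"
proof -
  have ic: "integrable lborel (\<lambda>x. ball_cutoff R x * Gsq x)" "integrable lborel (\<lambda>x. V x \<bullet> (ball_cutoff_slope R x *\<^sub>R x))" if R: "R > 0" for R
  proof -
    have "continuous_on UNIV (\<lambda>x. ball_cutoff R x * Gsq x)"
      by (intro continuous_on_mult Gsq_cont C1_grad_continuous[OF C1_grad_ball_cutoff])
    then show "integrable lborel (\<lambda>x. ball_cutoff R x * Gsq x)"
      by (rule integrable_continuous_bounded_support[where r="2 * R"]) (simp add: ball_cutoff_eq_0 R)
    have "continuous_on UNIV (\<lambda>x. V x \<bullet> (ball_cutoff_slope R x *\<^sub>R x))"
      by (intro continuous_on_inner V_cont C1_grad_continuous_grad[OF C1_grad_ball_cutoff])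
    then show "integrable lborel (\<lambda>x. V x \<bullet> (ball_cutoff_slope R x *\<^sub>R x))"
      by (rule integrable_continuous_bounded_support[where r="2 * R"]) (simp add: ball_cutoff_slope_eq_0 R)
  qed
  have id: "(LBINT x. ball_cutoff R x * Gsq x) + (LBINT x. V x \<bullet> (ball_cutoff_slope R x *\<^sub>R x)) = (LBINT x. ball_cutoff R x * S x)" if R: "R > 0" for R
  proof -
    have "(LBINT x. ball_cutoff R x * Gsq x + V x \<bullet> (ball_cutoff_slope R x *\<^sub>R x)) = (LBINT x. ball_cutoff R x * S x)"
      by (rule energy_identity[OF C1_grad_ball_cutoff, of "2 * R"]) (simp add: ball_cutoff_eq_0 R)
    then show ?thesis using Bochner_Integration.integral_add[OF ic[OF R]] by simp
  qed
  have X: "((\<lambda>R. (LBINT x. V x \<bullet> (ball_cutoff_slope R x *\<^sub>R x))) \<longlongrightarrow> 0) at_top"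
  proof (rule Lim_null_comparison)
    let ?b = "\<lambda>R. (LBINT x. Gsq x * indicator {x. R \<le> norm x} x) + (1 / 4) * (256 * (R powr (- 2) * (LBINT x. norm (u x) powr 2 * indicator (cball 0 (2 * R)) x)))"
    have "(?b \<longlongrightarrow> 0 + (1 / 4) * (256 * 0)) at_top"
      by (intro tendsto_add tendsto_mult tendsto_const integral_outside_ball_tendsto_0 iG u_sq_decay[OF iS N])
    then show "(?b \<longlongrightarrow> 0) at_top" by simp
    show "\<forall>\<^sub>F R in at_top. norm ((LBINT x. V x \<bullet> (ball_cutoff_slope R x *\<^sub>R x))) \<le> ?b R"
      using eventually_gt_at_top[of 0]
    proof eventually_elim
      case (elim R)
      have iG': "integrable lborel (\<lambda>x. Gsq x * indicator {x. R \<le> norm x} x)"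
        using iG by (intro integrable_real_mult_indicator) auto
      have "norm ((LBINT x. V x \<bullet> (ball_cutoff_slope R x *\<^sub>R x))) \<le> (LBINT x. norm (V x \<bullet> (ball_cutoff_slope R x *\<^sub>R x)))"
        by (rule integral_norm_bound)
      also have "\<dots> \<le> (LBINT x. Gsq x * indicator {x. R \<le> norm x} x + (1 / 4) * (norm (u x) powr 2 * (\<bar>ball_cutoff_slope R x\<bar> * norm x)\<^sup>2))"
      proof (rule integral_mono)
        fix x
        show "norm (V x \<bullet> (ball_cutoff_slope R x *\<^sub>R x)) \<le> Gsq x * indicator {x. R \<le> norm x} x + (1 / 4) * (norm (u x) powr 2 * (\<bar>ball_cutoff_slope R x\<bar> * norm x)\<^sup>2)"
        proof (cases "R \<le> norm x")
          case True
          have "\<bar>V x \<bullet> (ball_cutoff_slope R x *\<^sub>R x)\<bar> \<le> 1 * Gsq x + (norm (u x) powr 2 * (\<bar>ball_cutoff_slope R x\<bar> * norm x)\<^sup>2) / (4 * 1)"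
          proof (rule abs_le_weighted_sum)
            have "(V x \<bullet> (ball_cutoff_slope R x *\<^sub>R x))\<^sup>2 \<le> (V x \<bullet> V x) * ((ball_cutoff_slope R x *\<^sub>R x) \<bullet> (ball_cutoff_slope R x *\<^sub>R x))" by (rule Cauchy_Schwarz_ineq)
            also have "\<dots> \<le> ((u x \<bullet> u x) * Gsq x) * ((ball_cutoff_slope R x *\<^sub>R x) \<bullet> (ball_cutoff_slope R x *\<^sub>R x))"
              by (intro mult_right_mono V_bound inner_ge_zero)
            also have "(ball_cutoff_slope R x *\<^sub>R x) \<bullet> (ball_cutoff_slope R x *\<^sub>R x) = (\<bar>ball_cutoff_slope R x\<bar> * norm x)\<^sup>2"
              by (simp add: power_mult_distrib power2_norm_eq_inner power2_eq_square[of "ball_cutoff_slope R x"] mult.assoc)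
            finally show "(V x \<bullet> (ball_cutoff_slope R x *\<^sub>R x))\<^sup>2 \<le> Gsq x * (norm (u x) powr 2 * (\<bar>ball_cutoff_slope R x\<bar> * norm x)\<^sup>2)"
              unfolding u_sq_powr by (simp only: mult_ac)
          qed (auto simp: Gsq_nonneg)
          then show ?thesis using True by simp
        next
          case False
          then show ?thesis using ball_cutoff_slope_eq_0[OF elim, of x] by simp
        qed
      qed (intro integrable_norm ic elim Bochner_Integration.integrable_add integrable_mult_right iG' integrable_ball_cutoff_slope)+
      also have "\<dots> = (LBINT x. Gsq x * indicator {x. R \<le> norm x} x) + (1 / 4) * (LBINT x. norm (u x) powr 2 * (\<bar>ball_cutoff_slope R x\<bar> * norm x)\<^sup>2)"
        by (subst Bochner_Integration.integral_add[OF iG' integrable_mult_right[OF integrable_ball_cutoff_slope[OF elim]]])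
          (simp only: integral_mult_right_zero)
      also have "\<dots> \<le> ?b R" using integral_ball_cutoff_slope_le[OF elim] by simp
      finally show ?case .
    qed
  qed
  have "((\<lambda>R. (LBINT x. ball_cutoff R x * Gsq x) + (LBINT x. V x \<bullet> (ball_cutoff_slope R x *\<^sub>R x))) \<longlongrightarrow> integral\<^sup>L lborel Gsq + 0) at_top"
    by (intro tendsto_add integral_ball_cutoff_tendsto iG X)
  moreover have "\<forall>\<^sub>F R in at_top. (LBINT x. ball_cutoff R x * Gsq x) + (LBINT x. V x \<bullet> (ball_cutoff_slope R x *\<^sub>R x)) = (LBINT x. ball_cutoff R x * S x)"
    using eventually_gt_at_top[of 0] by eventually_elim (rule id)
  ultimately have "((\<lambda>R. (LBINT x. ball_cutoff R x * S x)) \<longlongrightarrow> integral\<^sup>L lborel Gsq + 0) at_top"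
    using tendsto_cong by fastforce
  from tendsto_unique[OF _ this integral_ball_cutoff_tendsto[OF iS]] show ?thesis by simp
qed

section \<open>Pohozaev's identity in the limit and the vanishing of the solution\<close>

definition Y where "Y x = (\<Sum>i\<in>UNIV. (x \<bullet> g i x)\<^sup>2)"

lemma Y_nonneg: "Y x \<ge> 0" by (simp add: Y_def sum_nonneg)

lemma Y_le: "Y x \<le> (x \<bullet> x) * Gsq x"
  unfolding Y_def Gsq_def sum_distrib_left by (intro sum_mono Cauchy_Schwarz_ineq)

lemma sum_radial: "(\<Sum>i\<in>UNIV. (x \<bullet> g i x) * (g i x \<bullet> (c *\<^sub>R x))) = c * Y x"
  by (simp add: Y_def sum_distrib_left power2_eq_square inner_commute[of "g _ x" x] mult_ac)

lemma Y_cont: "continuous_on UNIV Y"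
  unfolding Y_def by (intro continuous_intros g_cont)

lemma eq_0_if_integral_S_eq_0:
  assumes "integrable lborel S" "integral\<^sup>L lborel S \<le> 0"
  shows "u x = 0"
proof -
  have "integral\<^sup>L lborel S \<ge> 0" by (simp add: S_nonneg)
  then have "AE x in lborel. S x = 0"
    using integral_nonneg_eq_0_iff_AE[OF assms(1) AE_I2[OF S_nonneg]] assms(2) by simp
  from AE_eq_0_imp_eq_0[OF S_cont this] have "S x = 0" .
  then show ?thesis by (simp add: S_def)
qed

text \<open>Cutoff and radial cutoff derivative are bounded independently of \<open>R\<close>, so
  the two integrands are dominated by multiples of \<open>Gsq\<close> and \<open>S\<close>; finite
  energy alone makes the boundary terms disappear.\<close>

lemma pohozaev_limit:
  assumes iS: "integrable lborel S" and iG: "integrable lborel Gsq"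
  shows "(1 - real CARD('n) / 2) * integral\<^sup>L lborel Gsq = - (1 / (p + 1)) * (real CARD('n) * integral\<^sup>L lborel S)"
proof -
  define N where "N = real CARD('n)"
  have N: "N > 0" by (simp add: N_def)
  define F where "F R x = (\<Sum>i\<in>UNIV. (x \<bullet> g i x) * (g i x \<bullet> (ball_cutoff_slope R x *\<^sub>R x))) + ball_cutoff R x * Gsq x
      - (1 / 2) * (Gsq x * (N * ball_cutoff R x + x \<bullet> (ball_cutoff_slope R x *\<^sub>R x)))" for R x
  define K where "K R x = S x * (N * ball_cutoff R x + x \<bullet> (ball_cutoff_slope R x *\<^sub>R x))" for R x
  have FK: "integral\<^sup>L lborel (F R) = - (1 / (p + 1)) * integral\<^sup>L lborel (K R)" if R: "R > 0" for R
    unfolding F_def K_def N_def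
    by (rule pohozaev_identity[OF C1_grad_ball_cutoff, of "2 * R"]) (simp add: ball_cutoff_eq_0 R)
  have Fc: "continuous_on UNIV (F R)" for R unfolding F_def
    by (intro continuous_intros g_cont ball_cutoff_slope_continuous Gsq_cont C1_grad_continuous[OF C1_grad_ball_cutoff])
  have Kc: "continuous_on UNIV (K R)" for R unfolding K_def
    by (intro continuous_intros S_cont ball_cutoff_slope_continuous C1_grad_continuous[OF C1_grad_ball_cutoff])
  have b: "\<bar>N * ball_cutoff R x + x \<bullet> (ball_cutoff_slope R x *\<^sub>R x)\<bar> \<le> N + 32" if R: "R > 0" for R and x :: "real^'n"
  proof -
    have "\<bar>N * ball_cutoff R x\<bar> \<le> N" using N ball_cutoff_bounds[of R x] by (simp add: abs_mult mult_left_le)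
    moreover have "\<bar>x \<bullet> (ball_cutoff_slope R x *\<^sub>R x)\<bar> \<le> 32"
    proof -
      have "\<bar>ball_cutoff_slope R x\<bar> * (x \<bullet> x) \<le> 32"
        by (rule order_trans[OF ball_cutoff_slope_inner_bound[OF R]]) (simp add: indicator_def)
      then show ?thesis by (simp add: abs_mult)
    qed
    ultimately show ?thesis by linarith
  qed
  have bF: "\<bar>F R x\<bar> \<le> (33 + (N + 32) / 2) * Gsq x" if R: "R > 0" for R x
  proof -
    have "\<bar>ball_cutoff_slope R x * Y x\<bar> \<le> \<bar>ball_cutoff_slope R x\<bar> * ((x \<bullet> x) * Gsq x)"
      using Y_le Y_nonneg by (simp add: abs_mult mult_left_mono)
    also have "\<dots> \<le> 32 * Gsq x"
    proof -
      have "\<bar>ball_cutoff_slope R x\<bar> * (x \<bullet> x) \<le> 32"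
        by (rule order_trans[OF ball_cutoff_slope_inner_bound[OF R]]) (simp add: indicator_def)
      from mult_right_mono[OF this Gsq_nonneg[of x]] show ?thesis by (simp add: mult.assoc)
    qed
    finally have 1: "\<bar>ball_cutoff_slope R x * Y x\<bar> \<le> 32 * Gsq x" .
    have 2: "\<bar>ball_cutoff R x * Gsq x\<bar> \<le> Gsq x"
      using ball_cutoff_bounds[of R x] Gsq_nonneg[of x] by (simp add: abs_mult mult_left_le_one_le)
    have "\<bar>Gsq x * (N * ball_cutoff R x + x \<bullet> (ball_cutoff_slope R x *\<^sub>R x))\<bar> \<le> Gsq x * (N + 32)"
      using b[OF R, of x] Gsq_nonneg[of x] unfolding abs_mult by (intro mult_mono) auto
    then have "\<bar>F R x\<bar> \<le> 32 * Gsq x + Gsq x + (1 / 2) * (Gsq x * (N + 32))"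
      unfolding F_def sum_radial using 1 2 by linarith
    then show ?thesis by (simp add: algebra_simps add_divide_distrib)
  qed
  have bK: "\<bar>K R x\<bar> \<le> (N + 32) * S x" if R: "R > 0" for R x
    using mult_left_mono[OF b[OF R, of x] S_nonneg[of x]] S_nonneg[of x] by (simp add: K_def abs_mult mult.commute)
  have ev: "\<forall>\<^sub>F R in at_top. ball_cutoff R x = 1 \<and> ball_cutoff_slope R x = 0 \<and> R > 0" for x :: "real^'n"
    using eventually_gt_at_top[of "norm x"] eventually_gt_at_top[of 0] by eventually_elim (auto simp: ball_cutoff_eq_1 ball_cutoff_slope_eq_0)
  have limF: "((\<lambda>R. integral\<^sup>L lborel (F R)) \<longlongrightarrow> (LBINT x. (1 - N / 2) * Gsq x)) at_top"
  proof (rule integral_dominated_convergence_at_top[where w="\<lambda>x. (33 + (N + 32) / 2) * Gsq x"])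
    show "F R \<in> borel_measurable lborel" for R using borel_measurable_continuous_onI[OF Fc] by simp
    show "AE x in lborel. ((\<lambda>R. F R x) \<longlongrightarrow> (1 - N / 2) * Gsq x) at_top"
    proof (rule AE_I2, rule tendsto_eventually)
      fix x
      show "\<forall>\<^sub>F R in at_top. F R x = (1 - N / 2) * Gsq x"
        using ev[of x] by eventually_elim (simp add: F_def algebra_simps)
    qed
    show "\<forall>\<^sub>F R in at_top. AE x in lborel. norm (F R x) \<le> (33 + (N + 32) / 2) * Gsq x"
      using eventually_gt_at_top[of 0] by eventually_elim (use bF in auto)
  qed (use iG borel_measurable_continuous_onI[OF Gsq_cont] in auto)
  have "((\<lambda>R. integral\<^sup>L lborel (K R)) \<longlongrightarrow> (LBINT x. N * S x)) at_top"
  proof (rule integral_dominated_convergence_at_top[where w="\<lambda>x. (N + 32) * S x"])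
    show "K R \<in> borel_measurable lborel" for R using borel_measurable_continuous_onI[OF Kc] by simp
    show "AE x in lborel. ((\<lambda>R. K R x) \<longlongrightarrow> N * S x) at_top"
    proof (rule AE_I2, rule tendsto_eventually)
      fix x
      show "\<forall>\<^sub>F R in at_top. K R x = N * S x"
        using ev[of x] by eventually_elim (simp add: K_def)
    qed
    show "\<forall>\<^sub>F R in at_top. AE x in lborel. norm (K R x) \<le> (N + 32) * S x"
      using eventually_gt_at_top[of 0] by eventually_elim (use bK in auto)
  qed (use iS borel_measurable_continuous_onI[OF S_cont] in auto)
  then have limK: "((\<lambda>R. - (1 / (p + 1)) * integral\<^sup>L lborel (K R)) \<longlongrightarrow> - (1 / (p + 1)) * (LBINT x. N * S x)) at_top"
    by (rule tendsto_mult_left)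
  have "\<forall>\<^sub>F R in at_top. integral\<^sup>L lborel (F R) = - (1 / (p + 1)) * integral\<^sup>L lborel (K R)"
    using eventually_gt_at_top[of 0] by eventually_elim (rule FK)
  from tendsto_cong[OF this] limF have "((\<lambda>R. - (1 / (p + 1)) * integral\<^sup>L lborel (K R)) \<longlongrightarrow> (LBINT x. (1 - N / 2) * Gsq x)) at_top"
    by (rule iffD1)
  from tendsto_unique[OF trivial_limit_at_top_linorder this limK]
  have "(LBINT x. (1 - N / 2) * Gsq x) = - (1 / (p + 1)) * (LBINT x. N * S x)" .
  then show ?thesis unfolding integral_mult_right_zero by (simp add: N_def)
qed

lemma critical_exponent_bound:
  assumes "real CARD('n) > 2" "p \<le> (real CARD('n) + 2) / (real CARD('n) - 2)"
  shows "real CARD('n) \<le> 2 * (p + 1) / (p - 1)"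
proof -
  have "p * (real CARD('n) - 2) \<le> real CARD('n) + 2" using assms by (simp add: le_divide_eq)
  then have "real CARD('n) * (p - 1) \<le> 2 * (p + 1)" by (simp add: algebra_simps)
  then show ?thesis using p1 by (simp add: le_divide_eq)
qed

lemma finite_energy:
  assumes "real CARD('n) > 2" "p \<le> (real CARD('n) + 2) / (real CARD('n) - 2)" "stable_outside R0"
  shows "integrable lborel S" "integrable lborel Gsq" "integral\<^sup>L lborel Gsq = integral\<^sup>L lborel S"
proof -
  note N = critical_exponent_bound[OF assms(1,2)]
  show S: "integrable lborel S"
    using stable_integrable[OF assms(3), of 0] p1 N by (simp add: S_def[abs_def])
  show "integrable lborel Gsq" by (rule Gsq_integrable[OF S N])
  then show "integral\<^sup>L lborel Gsq = integral\<^sup>L lborel S" by (rule finite_energy_identity[OF S _ N])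
qed

lemma subcritical_eq_0:
  assumes N: "real CARD('n) > 2" and p: "p < (real CARD('n) + 2) / (real CARD('n) - 2)" and stab: "stable_outside R0"
  shows "u x = 0"
proof -
  note fe = finite_energy[OF N less_imp_le[OF p] stab]
  define I where "I = integral\<^sup>L lborel S"
  define n where "n = real CARD('n)"
  have n: "n > 2" using N by (simp add: n_def)
  have "(1 - n / 2) * I = - (1 / (p + 1)) * (n * I)"
    using pohozaev_limit[OF fe(1,2)] fe(3) by (simp add: I_def n_def)
  then have "(p + 1) * ((1 - n / 2) * I) = (p + 1) * (- (1 / (p + 1)) * (n * I))" by simp
  also have "\<dots> = - (n * I)" using p1 by simp
  finally have "((n + 2) - p * (n - 2)) * I = 0" by (simp add: algebra_simps)
  moreover have "p * (n - 2) < n + 2" using p n by (simp add: n_def less_divide_eq)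
  ultimately have "I = 0" by simp
  then show ?thesis using eq_0_if_integral_S_eq_0[OF fe(1)] by (simp add: I_def)
qed

text \<open>For radius -1 the condition \<open>norm x < - 1 + 1\<close> is empty, so
  \<open>ball_cutoff R\<close> itself enters the weighted estimate with s = 0. Its right-hand side
  tends to 0 by \<open>u_sq_decay\<close>, because \<open>S\<close> is already known to be
  integrable.\<close>

lemma critical_stable_eq_0:
  assumes N: "real CARD('n) > 2" and p: "p \<le> (real CARD('n) + 2) / (real CARD('n) - 2)" and stab: "stable_outside (- 1)"
  shows "u x = 0"
proof -
  note iS = finite_energy(1)[OF N p stab]
  have "(1 + 0)\<^sup>2 / (1 + 2 * 0) < p" using p1 by simp
  from stable_weighted_estimate[OF stab order_refl this] obtain C where C: "C > 0"
    and C_all: "\<forall>\<psi> D r. C1_grad \<psi> D \<longrightarrow> (\<forall>x. norm x > r \<longrightarrow> \<psi> x = 0) \<longrightarrow> (\<forall>x. norm x < - 1 + 1 \<longrightarrow> \<psi> x = 0) \<longrightarrow>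
      (LBINT x. norm (u x) powr (p + 1 + 2 * 0) * (\<psi> x)\<^sup>2) \<le> C * (LBINT x. norm (u x) powr (2 + 2 * 0) * (D x \<bullet> D x))"
    by (elim exE conjE)
  note C2 = C_all[THEN spec, THEN spec, THEN spec, THEN mp, THEN mp, THEN mp]
  let ?b = "\<lambda>R. C * (256 * (R powr (- 2) * (LBINT x. norm (u x) powr 2 * indicator (cball 0 (2 * R)) x)))"
  have est: "(LBINT x. ball_cutoff R x * (ball_cutoff R x * S x)) \<le> ?b R" if R: "R > 0" for R
  proof -
    have "(LBINT x. norm (u x) powr (p + 1 + 2 * 0) * (ball_cutoff R x)\<^sup>2)
      \<le> C * (LBINT x. norm (u x) powr (2 + 2 * 0) * ((ball_cutoff_slope R x *\<^sub>R x) \<bullet> (ball_cutoff_slope R x *\<^sub>R x)))"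
      by (rule C2[OF C1_grad_ball_cutoff, of "2 * R"]) (auto simp: ball_cutoff_eq_0 R)
    moreover have "(ball_cutoff_slope R x *\<^sub>R x) \<bullet> (ball_cutoff_slope R x *\<^sub>R x) = (\<bar>ball_cutoff_slope R x\<bar> * norm x)\<^sup>2" for x :: "real^'n"
      by (simp add: power_mult_distrib power2_norm_eq_inner power2_eq_square[of "ball_cutoff_slope R x"] mult.assoc)
    moreover have "norm (u x) powr (p + 1 + 2 * 0) * (ball_cutoff R x)\<^sup>2 = ball_cutoff R x * (ball_cutoff R x * S x)" for x
      by (simp add: S_def power2_eq_square)
    ultimately have "(LBINT x. ball_cutoff R x * (ball_cutoff R x * S x)) \<le> C * (LBINT x. norm (u x) powr 2 * (\<bar>ball_cutoff_slope R x\<bar> * norm x)\<^sup>2)"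
      by simp
    also have "\<dots> \<le> ?b R" using integral_ball_cutoff_slope_le[OF R] C by (intro mult_left_mono) auto
    finally show ?thesis .
  qed
  have lim: "((\<lambda>R. (LBINT x. ball_cutoff R x * (ball_cutoff R x * S x))) \<longlongrightarrow> integral\<^sup>L lborel S) at_top"
  proof (rule integral_dominated_convergence_at_top[where w=S])
    have cc: "continuous_on UNIV (\<lambda>x. ball_cutoff R x * (ball_cutoff R x * S x))" for R
      by (intro continuous_on_mult S_cont C1_grad_continuous[OF C1_grad_ball_cutoff])
    show "(\<lambda>x. ball_cutoff R x * (ball_cutoff R x * S x)) \<in> borel_measurable lborel" for R :: real
      using borel_measurable_continuous_onI[OF cc] by simp
    show "AE x in lborel. ((\<lambda>R. ball_cutoff R x * (ball_cutoff R x * S x)) \<longlongrightarrow> S x) at_top"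
    proof (rule AE_I2, rule tendsto_eventually)
      fix x :: "real^'n"
      show "\<forall>\<^sub>F R in at_top. ball_cutoff R x * (ball_cutoff R x * S x) = S x"
        using eventually_ge_at_top[of "norm x"] by eventually_elim (simp add: ball_cutoff_eq_1)
    qed
    have "norm (ball_cutoff R x * (ball_cutoff R x * S x)) \<le> S x" for R x
    proof -
      have "ball_cutoff R x * (ball_cutoff R x * S x) \<le> 1 * (1 * S x)"
        using ball_cutoff_bounds[of R x] S_nonneg[of x] by (intro mult_mono) auto
      then show ?thesis using ball_cutoff_bounds[of R x] S_nonneg[of x] by simp
    qed
    then show "\<forall>\<^sub>F R in at_top. AE x in lborel. norm (ball_cutoff R x * (ball_cutoff R x * S x)) \<le> S x"
      by (intro always_eventually allI AE_I2)
  qed (use iS borel_measurable_continuous_onI[OF S_cont] in auto)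
  have "(?b \<longlongrightarrow> C * (256 * 0)) at_top"
    by (intro tendsto_mult tendsto_const u_sq_decay iS critical_exponent_bound[OF N p])
  moreover have "\<forall>\<^sub>F R in at_top. (LBINT x. ball_cutoff R x * (ball_cutoff R x * S x)) \<le> ?b R"
    using eventually_gt_at_top[of 0] by eventually_elim (rule est)
  ultimately have "integral\<^sup>L lborel S \<le> C * (256 * 0)"
    using tendsto_le[OF _ _ lim] trivial_limit_at_top_linorder by blast
  then show ?thesis using eq_0_if_integral_S_eq_0[OF iS] by simp
qed

end

section \<open>Weighted cutoffs for the supercritical case\<close>

text \<open>A function of t = |x|^2 that cuts off at radii of order R and also at radii of order
  1/R, keeping away from the origin where |x|^a is singular.\<close>

definition annulus_cutoff :: "real \<Rightarrow> real \<Rightarrow> real" where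
  "annulus_cutoff R t = cutoff (t / R\<^sup>2) * (1 - cutoff (t * R\<^sup>2))"

definition annulus_cutoff' :: "real \<Rightarrow> real \<Rightarrow> real" where
  "annulus_cutoff' R t = cutoff' (t / R\<^sup>2) / R\<^sup>2 * (1 - cutoff (t * R\<^sup>2)) - cutoff (t / R\<^sup>2) * (cutoff' (t * R\<^sup>2) * R\<^sup>2)"

text \<open>As t is |x|^2, the exponents \<open>a / 2\<close> and \<open>a / 2 - 1\<close> used
  below stand for the weights |x|^a and |x|^(a - 2).\<close>

definition annulus_weight :: "real \<Rightarrow> real \<Rightarrow> real \<Rightarrow> real" where
  "annulus_weight b R t = t powr b * annulus_cutoff R t"

definition annulus_weight' :: "real \<Rightarrow> real \<Rightarrow> real \<Rightarrow> real" where
  "annulus_weight' b R t = t powr b * annulus_cutoff' R t + b * t powr (b - 1) * annulus_cutoff R t"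

lemma cutoff_continuous: "continuous_on S cutoff"
  by (meson cutoff_DERIV DERIV_isCont continuous_at_imp_continuous_on)

lemma annulus_cutoff_DERIV: "(annulus_cutoff R has_real_derivative annulus_cutoff' R t) (at t)"
proof -
  have 1: "((\<lambda>t. cutoff (t / R\<^sup>2)) has_real_derivative cutoff' (t / R\<^sup>2) / R\<^sup>2) (at t)"
    using DERIV_chain2[OF cutoff_DERIV DERIV_cdivide[OF DERIV_ident, of "R\<^sup>2"]] by simp
  have "((\<lambda>t. t * R\<^sup>2) has_real_derivative R\<^sup>2) (at t)" by (auto intro!: derivative_eq_intros)
  from DERIV_diff[OF DERIV_const[of 1] DERIV_chain2[OF cutoff_DERIV this]]
  have 2: "((\<lambda>t. 1 - cutoff (t * R\<^sup>2)) has_real_derivative - (cutoff' (t * R\<^sup>2) * R\<^sup>2)) (at t)" by simp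
  show ?thesis
    unfolding annulus_cutoff_def[abs_def] annulus_cutoff'_def using DERIV_mult[OF 1 2] by (simp add: algebra_simps)
qed

lemma annulus_cutoff_small: "t * R\<^sup>2 \<le> 1 \<Longrightarrow> annulus_cutoff R t = 0 \<and> annulus_cutoff' R t = 0"
  by (simp add: annulus_cutoff_def annulus_cutoff'_def cutoff_eq_1 cutoff'_eq_0)

lemma annulus_cutoff_large: "R > 0 \<Longrightarrow> t \<ge> 2 * R\<^sup>2 \<Longrightarrow> annulus_cutoff R t = 0 \<and> annulus_cutoff' R t = 0"
  by (simp add: annulus_cutoff_def annulus_cutoff'_def cutoff_eq_0 cutoff'_eq_0 le_divide_eq)

lemma annulus_cutoff_eq_1: "R > 0 \<Longrightarrow> 2 \<le> t * R\<^sup>2 \<Longrightarrow> t \<le> R\<^sup>2 \<Longrightarrow> annulus_cutoff R t = 1"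
  by (simp add: annulus_cutoff_def cutoff_eq_0 cutoff_eq_1 divide_le_eq)

lemma annulus_cutoff_bounds: "0 \<le> annulus_cutoff R t" "annulus_cutoff R t \<le> 1"
  using cutoff_bounds[of "t / R\<^sup>2"] cutoff_bounds[of "t * R\<^sup>2"] by (auto simp: annulus_cutoff_def mult_le_one)

lemma cutoff'_mult_bound: "\<bar>cutoff' z * z\<bar> \<le> 8 * indicator {1..2} z"
proof (cases "1 \<le> z \<and> z \<le> 2")
  case True
  then have "\<bar>cutoff' z\<bar> * \<bar>z\<bar> \<le> 4 * 2" using cutoff'_bound[of z] by (intro mult_mono) auto
  then show ?thesis using True by (simp add: abs_mult)
qed (auto simp: cutoff'_eq_0)

text \<open>The left-hand side is half the derivative with respect to log |x|, hence bounded
  independently of R; the two indicators mark the outer and the inner transition layer.\<close>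

lemma annulus_cutoff'_bound:
  assumes "R > 0"
  shows "\<bar>t * annulus_cutoff' R t\<bar> \<le> 8 * indicator {1..2} (t / R\<^sup>2) + 8 * indicator {1..2} (t * R\<^sup>2)"
proof -
  have "t * annulus_cutoff' R t = (cutoff' (t / R\<^sup>2) * (t / R\<^sup>2)) * (1 - cutoff (t * R\<^sup>2)) - cutoff (t / R\<^sup>2) * (cutoff' (t * R\<^sup>2) * (t * R\<^sup>2))"
    by (simp add: annulus_cutoff'_def algebra_simps)
  also have "\<bar>\<dots>\<bar> \<le> \<bar>cutoff' (t / R\<^sup>2) * (t / R\<^sup>2)\<bar> * \<bar>1 - cutoff (t * R\<^sup>2)\<bar> + \<bar>cutoff (t / R\<^sup>2)\<bar> * \<bar>cutoff' (t * R\<^sup>2) * (t * R\<^sup>2)\<bar>"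
    by (rule order_trans[OF abs_triangle_ineq4]) (simp only: abs_mult)
  also have "\<dots> \<le> (8 * indicator {1..2} (t / R\<^sup>2)) * 1 + 1 * (8 * indicator {1..2} (t * R\<^sup>2))"
    using cutoff_bounds[of "t / R\<^sup>2"] cutoff_bounds[of "t * R\<^sup>2"] by (intro add_mono mult_mono cutoff'_mult_bound) auto
  finally show ?thesis by simp
qed

lemma annulus_weight_DERIV:
  assumes R: "R > 0"
  shows "(annulus_weight b R has_real_derivative annulus_weight' b R t) (at t)"
proof (cases "t > 0")
  case True
  have "((\<lambda>t. t powr b * annulus_cutoff R t) has_real_derivative t powr b * annulus_cutoff' R t + b * t powr (b - 1) * annulus_cutoff R t) (at t)"
    using DERIV_mult[OF has_real_derivative_powr[OF True, of b] annulus_cutoff_DERIV[of R t]] by (simp add: algebra_simps)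
  then show ?thesis by (simp add: annulus_weight_def[abs_def] annulus_weight'_def)
next
  case False
  \<comment> \<open>The power itself need not be differentiable here, but the cutoff vanishes for
    all t up to 1 / R^2.\<close>
  have R2: "R\<^sup>2 > 0" using R by simp
  have "((\<lambda>t. 0) has_real_derivative annulus_weight' b R t) (at t)"
  proof -
    have "t * R\<^sup>2 \<le> 0" using False R2 by (intro mult_nonpos_nonneg) auto
    then show ?thesis using annulus_cutoff_small[of t R] by (simp add: annulus_weight'_def)
  qed
  then show ?thesis
  proof (rule has_field_derivative_transform_within_open[of _ _ _ "{..<1 / R\<^sup>2}"])
    fix s assume "s \<in> {..<1 / R\<^sup>2}"
    then have "s * R\<^sup>2 \<le> 1" using R2 by (simp add: less_divide_eq)
    then show "0 = annulus_weight b R s" using annulus_cutoff_small[of s R] by (simp add: annulus_weight_def)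
  next
    have "0 < 1 / R\<^sup>2" using R2 by simp
    with False have "t < 1 / R\<^sup>2" by linarith
    then show "t \<in> {..<1 / R\<^sup>2}" by simp
  qed simp
qed

lemma annulus_weight'_cont:
  assumes R: "R > 0"
  shows "continuous_on UNIV (annulus_weight' b R)"
proof -
  have R2: "R\<^sup>2 > 0" using R by simp
  have "continuous_on {..1 / R\<^sup>2} (annulus_weight' b R)"
  proof (rule continuous_on_eq[of _ "\<lambda>_. 0"])
    fix t assume "t \<in> {..1 / R\<^sup>2}"
    then have "t * R\<^sup>2 \<le> 1" using R2 by (simp add: le_divide_eq)
    then show "0 = annulus_weight' b R t" using annulus_cutoff_small[of t R] by (simp add: annulus_weight'_def)
  qed simp
  moreover have "continuous_on {1 / R\<^sup>2..} (annulus_weight' b R)"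
  proof -
    have ne: "t \<noteq> 0" if "t \<in> {1 / R\<^sup>2..}" for t
    proof -
      have "0 < 1 / R\<^sup>2" using R2 by simp
      with that show ?thesis by auto
    qed
    have c: "continuous_on {1 / R\<^sup>2..} (\<lambda>t. cutoff (t * c))" "continuous_on {1 / R\<^sup>2..} (\<lambda>t. cutoff' (t * c))" for c
      by (rule continuous_on_compose2[OF cutoff_continuous[of UNIV]] continuous_on_compose2[OF cutoff'_cont[of UNIV]];
          auto intro!: continuous_intros)+
    have "continuous_on {1 / R\<^sup>2..} (\<lambda>t. t powr b * (cutoff' (t * inverse (R\<^sup>2)) * inverse (R\<^sup>2) * (1 - cutoff (t * R\<^sup>2)) - cutoff (t * inverse (R\<^sup>2)) * (cutoff' (t * R\<^sup>2) * R\<^sup>2))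
      + b * t powr (b - 1) * (cutoff (t * inverse (R\<^sup>2)) * (1 - cutoff (t * R\<^sup>2))))"
      by (intro continuous_intros c) (use ne in auto)
    then show ?thesis unfolding annulus_weight'_def[abs_def] annulus_cutoff_def annulus_cutoff'_def divide_inverse .
  qed
  ultimately have "continuous_on ({..1 / R\<^sup>2} \<union> {1 / R\<^sup>2..}) (annulus_weight' b R)"
    by (intro continuous_on_closed_Un) auto
  moreover have "{..1 / R\<^sup>2} \<union> {1 / R\<^sup>2..} = UNIV" by auto
  ultimately show ?thesis by simp
qed

lemma C1_grad_annulus_weight:
  assumes "R > 0"
  shows "C1_grad (\<lambda>x::'a::euclidean_space. annulus_weight b R (x \<bullet> x)) (\<lambda>x. (2 * annulus_weight' b R (x \<bullet> x)) *\<^sub>R x)"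
  using C1_grad_compose_real[OF C1_grad_norm_sq annulus_weight_DERIV[OF assms] annulus_weight'_cont[OF assms]] by (simp add: mult.commute)

lemma annulus_weight_eq_0:
  assumes "R > 0" "norm x > 2 * R"
  shows "annulus_weight b R (x \<bullet> x) = 0"
proof -
  have "(x \<bullet> x) / R\<^sup>2 \<ge> 2" using assms by (intro two_le_inner_div) auto
  then have "x \<bullet> x \<ge> 2 * R\<^sup>2" using assms by (simp add: le_divide_eq)
  then show ?thesis using annulus_cutoff_large[OF assms(1)] by (simp add: annulus_weight_def)
qed

text \<open>Here \<tau> is |x|^2, \<open>m\<close> is |x|^(a - 2), \<open>h\<close> the cutoff, and
  \<open>y\<close>, \<open>Z\<close>, \<open>w\<close> are \<open>Y x\<close>,
  \<open>x \<bullet> V x\<close>, |u|^2. Pohozaev's identity plus \<alpha> times the energy identity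
  amounts to testing with x . grad u + \<alpha> u, the generator of the scaling; a \<alpha> times
  the scaling identity is added. The relation for \<open>n\<close> completes the square in the terms
  with \<open>h\<close>, and the one for \<beta> cancels \<open>S\<close> there.\<close>

lemma emden_fowler_algebra:
  fixes m \<tau> h h' a \<alpha> \<beta> n y G S Z w :: real
  assumes n: "n = 2 * \<alpha> + 2 - a" and \<beta>: "\<beta> * (2 * \<alpha> + 2) = \<alpha>"
  shows "(2 * (m * \<tau> * h' + a / 2 * m * h)) * y + m * \<tau> * h * G - (1 / 2) * (G * (n * (m * \<tau> * h) + 2 * (m * \<tau> * h' + a / 2 * m * h) * \<tau>))
     + \<beta> * (S * (n * (m * \<tau> * h) + 2 * (m * \<tau> * h' + a / 2 * m * h) * \<tau>))
     + \<alpha> * (m * \<tau> * h * G + 2 * (m * \<tau> * h' + a / 2 * m * h) * Z) - \<alpha> * (m * \<tau> * h * S)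
     + a * \<alpha> * (m * h * Z) + a * \<alpha> / 2 * (w * (n * (m * h) + 2 * (m * \<tau> * h' + (a / 2 - 1) * m * h)))
    = a * (m * h) * (y + 2 * \<alpha> * Z + \<alpha>\<^sup>2 * w) + m * (\<tau> * h') * (2 * y - \<tau> * G + 2 * \<beta> * \<tau> * S + 2 * \<alpha> * Z + a * \<alpha> * w)"
    (is "?L = ?R")
proof -
  have "?L - ?R = S * m * \<tau> * h * (\<beta> * (2 * \<alpha> + 2) - \<alpha>)"
    unfolding n by (simp add: field_simps power2_eq_square)
  then show ?thesis using \<beta> by simp
qed

section \<open>The supercritical case\<close>

text \<open>For this s, 16 ((1 + s)^2 - p (1 + 2 s)) is a quadratic polynomial in x = p - 1 with the
  factors (n - 2 + 2 r) x - 4 and (n - 2 - 2 r) x - 4, where n = N - 2 and r = sqrt (N - 1). The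
  lower bound on p makes the first factor positive, the upper bound makes the second
  negative.\<close>

lemma joseph_lundgren_bound:
  fixes N :: nat and p :: real
  assumes N: "N \<ge> 3" and p1: "p > 1" and lower: "(real N + 2) / (real N - 2) < p" and upper: "ereal p < p_c N"
  defines "s \<equiv> (real N * (p - 1) / 2 - p - 1) / 2"
  shows "s > 0" "(1 + s)\<^sup>2 / (1 + 2 * s) < p"
proof -
  define n where "n = real N - 2"
  define x where "x = p - 1"
  define r where "r = sqrt (n + 1)"
  have n: "n \<ge> 1" using N by (simp add: n_def)
  have x: "x > 0" using p1 by (simp add: x_def)
  have r: "r \<ge> 1" "r\<^sup>2 = n + 1" using n by (auto simp: r_def)
  have "n + 4 < p * n" using lower n by (simp add: n_def divide_less_eq)
  then have nx: "n * x > 4" by (simp add: x_def algebra_simps)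
  have s: "4 * s = n * x - 4"
    by (simp add: s_def n_def x_def field_simps)
  show s0: "s > 0" using s nx by simp
  have b1: "(n - 2 + 2 * r) * x > 4"
  proof -
    have "n * x \<le> (n - 2 + 2 * r) * x" using r x by (intro mult_right_mono) auto
    with nx show ?thesis by simp
  qed
  have b2: "(n - 2 - 2 * r) * x < 4"
  proof (cases "N \<le> 10")
    case True
    then have "n \<le> 8" by (simp add: n_def)
    have "r\<^sup>2 \<le> 3\<^sup>2" using r \<open>n \<le> 8\<close> by simp
    then have r3: "r \<le> 3" using power2_le_imp_le[of r 3] by simp
    \<comment> \<open>Up to dimension 10 the coefficient is not positive, so no upper bound on p
      arises: this is why \<open>p_c\<close> is infinite there.\<close>
    have "n - 2 - 2 * r = (r - 3) * (r + 1)" using r(2) by (simp add: algebra_simps power2_eq_square)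
    also have "\<dots> \<le> 0" using r3 r(1) by (simp add: mult_nonpos_nonneg)
    finally have "(n - 2 - 2 * r) * x \<le> 0" using x by (simp add: mult_nonpos_nonneg)
    then show ?thesis by simp
  next
    case False
    then have n9: "n \<ge> 9" by (simp add: n_def)
    have "p < ((real N - 2)\<^sup>2 - 4 * real N + 8 * sqrt (real N - 1)) / ((real N - 2) * (real N - 10))"
      using upper False by (simp add: p_c_def)
    also have "(real N - 2)\<^sup>2 - 4 * real N + 8 * sqrt (real N - 1) = n\<^sup>2 - 4 * (n + 2) + 8 * r"
      by (simp add: n_def r_def)
    also have "(real N - 2) * (real N - 10) = n * (n - 8)" by (simp add: n_def)
    finally have up: "p < (n\<^sup>2 - 4 * (n + 2) + 8 * r) / (n * (n - 8))" .
    have pos: "n * (n - 8) > 0" using n9 by simp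
    have "p * (n * (n - 8)) < n\<^sup>2 - 4 * (n + 2) + 8 * r" using up pos by (simp add: less_divide_eq)
    then have "n * (n - 8) * x < 4 * (n - 2 + 2 * r)"
      by (simp add: x_def algebra_simps power2_eq_square)
    \<comment> \<open>After cancelling the common factor, \<open>p < p_c N\<close> reads p - 1 < 4 /
      (n - 2 - 2 r).\<close>
    moreover have "n * (n - 8) = (n - 2 + 2 * r) * (n - 2 - 2 * r)"
    proof -
      have "(n - 2 + 2 * r) * (n - 2 - 2 * r) = (n - 2)\<^sup>2 - 4 * r\<^sup>2" by (simp add: algebra_simps power2_eq_square)
      then show ?thesis unfolding r(2) by (simp add: algebra_simps power2_eq_square)
    qed
    ultimately have "(n - 2 + 2 * r) * ((n - 2 - 2 * r) * x) < (n - 2 + 2 * r) * 4"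
      by (simp add: mult_ac)
    moreover have "n - 2 + 2 * r > 0" using n9 r by simp
    ultimately show ?thesis by (meson mult_less_cancel_left_pos)
  qed
  have "((n - 2 + 2 * r) * x - 4) * ((n - 2 - 2 * r) * x - 4) < 0"
    using b1 b2 by (intro mult_pos_neg) auto
  moreover have "((n - 2 + 2 * r) * x - 4) * ((n - 2 - 2 * r) * x - 4) = ((n - 2)\<^sup>2 - 4 * r\<^sup>2) * x\<^sup>2 - 8 * (n - 2) * x + 16"
    by (simp add: algebra_simps power2_eq_square)
  ultimately have q: "((n - 2)\<^sup>2 - 4 * (n + 1)) * x\<^sup>2 - 8 * (n - 2) * x + 16 < 0" unfolding r(2) by simp
  have ss: "s = (n * x - 4) / 4" using s by simp
  have "16 * ((1 + s)\<^sup>2 - p * (1 + 2 * s)) = ((n - 2)\<^sup>2 - 4 * (n + 1)) * x\<^sup>2 - 8 * (n - 2) * x + 16"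
    unfolding ss by (simp add: x_def field_simps power2_eq_square)
  with q have "(1 + s)\<^sup>2 < p * (1 + 2 * s)" by simp
  then show "(1 + s)\<^sup>2 / (1 + 2 * s) < p" using s0 by (simp add: divide_less_eq)
qed

section \<open>The Emden-Fowler energy of a supercritical solution\<close>

context lane_emden
begin

text \<open>The scaling exponent: the equation is invariant under replacing u by l^\<alpha> u(l x)
  for l > 0.\<close>

definition \<alpha> where "\<alpha> = 2 / (p - 1)"
definition a where "a = 2 * \<alpha> + 2 - real CARD('n)"

text \<open>By \<open>W_eq\<close> this is |x|^(-2 \<alpha>) |w_t|^2 for w = |x|^\<alpha> u and t =
  log |x|, so it measures the failure of Euler's equation for homogeneity of degree -\<alpha>. With
  the weight |x|^(a - 2) its integral becomes that of |w_t|^2 over t and the sphere.\<close>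

definition W where "W x = Y x + 2 * \<alpha> * (x \<bullet> V x) + \<alpha>\<^sup>2 * (u x \<bullet> u x)"

text \<open>Collects the terms of the combined identity that contain the derivative of the cutoff.\<close>

definition transition_density where "transition_density R x = (x \<bullet> x) powr (a / 2 - 1) * ((x \<bullet> x) * annulus_cutoff' R (x \<bullet> x)) *
  (2 * Y x - (x \<bullet> x) * Gsq x + 2 * (1 / (p + 1)) * (x \<bullet> x) * S x + 2 * \<alpha> * (x \<bullet> V x) + a * \<alpha> * (u x \<bullet> u x))"

lemma alpha_pos: "\<alpha> > 0" using p1 by (simp add: \<alpha>_def)

lemma alpha_eq: "1 / (p + 1) * (2 * \<alpha> + 2) = \<alpha>"
proof -
  have "\<alpha> * (p - 1) = 2" using nonzero_eq_divide_eq[of "p - 1" \<alpha> 2] p1 by (simp add: \<alpha>_def)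
  then have "2 * \<alpha> + 2 = (p + 1) * \<alpha>" by (simp add: algebra_simps)
  then show ?thesis using p1 by simp
qed

lemma W_eq: "W x = (\<Sum>i\<in>UNIV. (\<alpha> * u x $ i + x \<bullet> g i x)\<^sup>2)"
proof -
  have "(\<alpha> * u x $ i + x \<bullet> g i x)\<^sup>2 = (x \<bullet> g i x)\<^sup>2 + 2 * \<alpha> * (u x $ i * (x \<bullet> g i x)) + \<alpha>\<^sup>2 * (u x $ i * u x $ i)" for i
    by (simp add: power2_eq_square algebra_simps)
  then show ?thesis
    by (simp add: W_def Y_def V_def inner_sum_right inner_vec_def[of "u x"] sum.distrib sum_distrib_left)
qed

lemma W_cont: "continuous_on UNIV W"
  unfolding W_def by (intro continuous_intros Y_cont V_cont u_cont)

lemma annulus_weight_continuous: "R > 0 \<Longrightarrow> continuous_on UNIV (\<lambda>x::real^'n. annulus_weight b R (x \<bullet> x))"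
  by (rule C1_grad_continuous[OF C1_grad_annulus_weight])

lemma emden_fowler_pointwise:
  assumes R: "R > 0"
  shows "((\<Sum>i\<in>UNIV. (x \<bullet> g i x) * (g i x \<bullet> ((2 * annulus_weight' (a / 2) R (x \<bullet> x)) *\<^sub>R x))) + annulus_weight (a / 2) R (x \<bullet> x) * Gsq x
      - (1 / 2) * (Gsq x * (real CARD('n) * annulus_weight (a / 2) R (x \<bullet> x) + x \<bullet> ((2 * annulus_weight' (a / 2) R (x \<bullet> x)) *\<^sub>R x))))
    + (1 / (p + 1)) * (S x * (real CARD('n) * annulus_weight (a / 2) R (x \<bullet> x) + x \<bullet> ((2 * annulus_weight' (a / 2) R (x \<bullet> x)) *\<^sub>R x)))
    + \<alpha> * (annulus_weight (a / 2) R (x \<bullet> x) * Gsq x + V x \<bullet> ((2 * annulus_weight' (a / 2) R (x \<bullet> x)) *\<^sub>R x)) - \<alpha> * (annulus_weight (a / 2) R (x \<bullet> x) * S x)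
    + a * \<alpha> * (annulus_weight (a / 2 - 1) R (x \<bullet> x) * (x \<bullet> V x))
    + a * \<alpha> / 2 * ((u x \<bullet> u x) * (real CARD('n) * annulus_weight (a / 2 - 1) R (x \<bullet> x) + x \<bullet> ((2 * annulus_weight' (a / 2 - 1) R (x \<bullet> x)) *\<^sub>R x)))
    = a * annulus_weight (a / 2 - 1) R (x \<bullet> x) * W x + transition_density R x"
proof (cases "x = 0")
  case True
  then show ?thesis using annulus_cutoff_small[of 0 R] by (simp add: annulus_weight_def annulus_weight'_def transition_density_def Y_def)
next
  case False
  define \<tau> where "\<tau> = x \<bullet> x"
  have \<tau>: "\<tau> > 0" using False by (simp add: \<tau>_def)
  define m where "m = \<tau> powr (a / 2 - 1)"
  define h where "h = annulus_cutoff R \<tau>"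
  define h' where "h' = annulus_cutoff' R \<tau>"
  have m1: "\<tau> powr (a / 2) = m * \<tau>"
    using \<tau> powr_add[of \<tau> "a / 2 - 1" 1] by (simp add: m_def)
  have m2: "\<tau> powr (a / 2 - 1 - 1) * \<tau> = m"
    using \<tau> powr_add[of \<tau> "a / 2 - 1 - 1" 1] by (simp add: m_def)
  have e1: "annulus_weight (a / 2) R \<tau> = m * \<tau> * h" by (simp add: annulus_weight_def m1 h_def)
  have e2: "annulus_weight (a / 2 - 1) R \<tau> = m * h" by (simp add: annulus_weight_def m_def h_def)
  have e3: "annulus_weight' (a / 2) R \<tau> = m * \<tau> * h' + a / 2 * m * h" by (simp add: annulus_weight'_def m1 h_def h'_def m_def)
  have e4: "annulus_weight' (a / 2 - 1) R \<tau> * \<tau> = m * \<tau> * h' + (a / 2 - 1) * m * h"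
  proof -
    have "annulus_weight' (a / 2 - 1) R \<tau> * \<tau> = m * \<tau> * h' + (a / 2 - 1) * (\<tau> powr (a / 2 - 1 - 1) * \<tau>) * h"
      by (simp add: annulus_weight'_def m_def h_def h'_def algebra_simps)
    then show ?thesis unfolding m2 .
  qed
  have r1: "x \<bullet> ((2 * c) *\<^sub>R x) = 2 * c * \<tau>" "V x \<bullet> ((2 * c) *\<^sub>R x) = 2 * c * (x \<bullet> V x)" for c
    by (simp_all add: \<tau>_def inner_commute)
  have "2 * annulus_weight' (a / 2 - 1) R \<tau> * \<tau> = 2 * (m * \<tau> * h' + (a / 2 - 1) * m * h)"
    using e4 by simp
  note e4' = this
  have B: "transition_density R x = m * (\<tau> * h') * (2 * Y x - \<tau> * Gsq x + 2 * (1 / (p + 1)) * \<tau> * S x + 2 * \<alpha> * (x \<bullet> V x) + a * \<alpha> * (u x \<bullet> u x))"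
    by (simp add: transition_density_def m_def h'_def \<tau>_def)
  have n: "real CARD('n) = 2 * \<alpha> + 2 - a" by (simp add: a_def)
  show ?thesis
    unfolding sum_radial r1 \<tau>_def[symmetric] e4' unfolding e1 e2 e3 B W_def
    by (rule emden_fowler_algebra[OF n alpha_eq])
qed

text \<open>The integrated combination of the three identities is 0. What is left balances the
  damping term, weighted by the cutoff, against the transition layers; the bracket in
  \<open>transition_density\<close> is |x|^(-2 \<alpha>) times twice the Emden-Fowler energy
  density.\<close>

lemma emden_fowler_identity:
  assumes R: "R > 0"
  shows "integrable lborel (\<lambda>x. annulus_weight (a / 2 - 1) R (x \<bullet> x) * W x)" "integrable lborel (transition_density R)"
    "- a * (LBINT x. annulus_weight (a / 2 - 1) R (x \<bullet> x) * W x) = integral\<^sup>L lborel (transition_density R)"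
proof -
  let ?\<eta> = "\<lambda>x::real^'n. annulus_weight (a / 2) R (x \<bullet> x)"
  let ?E = "\<lambda>x::real^'n. (2 * annulus_weight' (a / 2) R (x \<bullet> x)) *\<^sub>R x"
  let ?\<zeta> = "\<lambda>x::real^'n. annulus_weight (a / 2 - 1) R (x \<bullet> x)"
  let ?Z = "\<lambda>x::real^'n. (2 * annulus_weight' (a / 2 - 1) R (x \<bullet> x)) *\<^sub>R x"
  let ?N = "real CARD('n)"
  have \<eta>: "C1_grad ?\<eta> ?E" and \<zeta>: "C1_grad ?\<zeta> ?Z" using C1_grad_annulus_weight[OF R] by auto
  have out: "annulus_weight b R (x \<bullet> x) = 0" if "norm x > 2 * R" for b and x :: "real^'n"
    by (rule annulus_weight_eq_0[OF R that])
  have outE: "?E x = 0" if "norm x > 2 * R" for x by (rule C1_grad_eq_0_outside[OF \<eta> out that])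
  have outZ: "?Z x = 0" if "norm x > 2 * R" for x by (rule C1_grad_eq_0_outside[OF \<zeta> out that])
  note cont = C1_grad_continuous[OF \<eta>] C1_grad_continuous[OF \<zeta>] C1_grad_continuous_grad[OF \<eta>] C1_grad_continuous_grad[OF \<zeta>]
    Gsq_cont S_cont V_cont u_cont g_cont
  define f2 where "f2 x = (\<Sum>i\<in>UNIV. (x \<bullet> g i x) * (g i x \<bullet> ?E x)) + ?\<eta> x * Gsq x - (1 / 2) * (Gsq x * (?N * ?\<eta> x + x \<bullet> ?E x))" for x
  define h2 where "h2 x = S x * (?N * ?\<eta> x + x \<bullet> ?E x)" for x
  define f1 where "f1 x = ?\<eta> x * Gsq x + V x \<bullet> ?E x" for x
  define h1 where "h1 x = ?\<eta> x * S x" for x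
  define f3 where "f3 x = ?\<zeta> x * (x \<bullet> V x)" for x
  define h3 where "h3 x = (u x \<bullet> u x) * (?N * ?\<zeta> x + x \<bullet> ?Z x)" for x
  have I: "integral\<^sup>L lborel f2 = - (1 / (p + 1)) * integral\<^sup>L lborel h2" "integral\<^sup>L lborel f1 = integral\<^sup>L lborel h1"
    "integral\<^sup>L lborel f3 = - (1 / 2) * integral\<^sup>L lborel h3"
    unfolding f1_def f2_def f3_def h1_def h2_def h3_def
    by (rule pohozaev_identity[OF \<eta> out] energy_identity[OF \<eta> out] scaling_identity[OF \<zeta> out]; assumption)+
  have ic: "integrable lborel f" if "continuous_on UNIV f" "\<And>x. norm x > 2 * R \<Longrightarrow> f x = 0" for f :: "real^'n \<Rightarrow> real"
    by (rule integrable_continuous_bounded_support[OF that])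
  have c: "continuous_on UNIV f2" "continuous_on UNIV h2" "continuous_on UNIV f1" "continuous_on UNIV h1" "continuous_on UNIV f3" "continuous_on UNIV h3"
    unfolding f1_def[abs_def] f2_def[abs_def] f3_def[abs_def] h1_def[abs_def] h2_def[abs_def] h3_def[abs_def]
    by (intro continuous_on_add continuous_on_diff continuous_on_mult continuous_on_inner continuous_on_sum continuous_on_const continuous_on_id cont)+
  have i: "integrable lborel f2" "integrable lborel h2" "integrable lborel f1" "integrable lborel h1" "integrable lborel f3" "integrable lborel h3"
    using c by (auto intro!: ic simp only: f1_def f2_def f3_def h1_def h2_def h3_def out outE outZ) simp_all
  show iW: "integrable lborel (\<lambda>x. ?\<zeta> x * W x)"
    by (intro ic continuous_on_mult cont W_cont) (simp add: out)
  have pt: "f2 x + (1 / (p + 1)) * h2 x + \<alpha> * f1 x - \<alpha> * h1 x + a * \<alpha> * f3 x + a * \<alpha> / 2 * h3 x = a * ?\<zeta> x * W x + transition_density R x" for x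
    unfolding f1_def f2_def f3_def h1_def h2_def h3_def by (rule emden_fowler_pointwise[OF R])
  have B: "transition_density R = (\<lambda>x. f2 x + (1 / (p + 1)) * h2 x + \<alpha> * f1 x - \<alpha> * h1 x + a * \<alpha> * f3 x + a * \<alpha> / 2 * h3 x - a * (?\<zeta> x * W x))"
    using pt by (simp add: fun_eq_iff mult.assoc)
  have i': "integrable lborel (\<lambda>x. f2 x + (1 / (p + 1)) * h2 x + \<alpha> * f1 x - \<alpha> * h1 x + a * \<alpha> * f3 x + a * \<alpha> / 2 * h3 x)"
    by (intro Bochner_Integration.integrable_add Bochner_Integration.integrable_diff integrable_mult_right i)
  show "integrable lborel (transition_density R)"
    unfolding B by (intro Bochner_Integration.integrable_diff i' integrable_mult_right iW)
  have "(LBINT x. f2 x + (1 / (p + 1)) * h2 x + \<alpha> * f1 x - \<alpha> * h1 x + a * \<alpha> * f3 x + a * \<alpha> / 2 * h3 x)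
    = integral\<^sup>L lborel f2 + (1 / (p + 1)) * integral\<^sup>L lborel h2 + \<alpha> * integral\<^sup>L lborel f1 - \<alpha> * integral\<^sup>L lborel h1 + a * \<alpha> * integral\<^sup>L lborel f3 + a * \<alpha> / 2 * integral\<^sup>L lborel h3"
    by (simp only: Bochner_Integration.integral_add Bochner_Integration.integral_diff integral_mult_right_zero
        Bochner_Integration.integrable_add Bochner_Integration.integrable_diff integrable_mult_right i)
  also have "\<dots> = 0" unfolding I by simp
  finally have 0: "(LBINT x. f2 x + (1 / (p + 1)) * h2 x + \<alpha> * f1 x - \<alpha> * h1 x + a * \<alpha> * f3 x + a * \<alpha> / 2 * h3 x) = 0" .
  show "- a * (LBINT x. ?\<zeta> x * W x) = integral\<^sup>L lborel (transition_density R)"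
    unfolding B Bochner_Integration.integral_diff[OF i' integrable_mult_right[OF iW]] 0 by simp
qed

lemma transition_density_bound:
  assumes R: "R > 0" and a0: "a < 0"
  shows "\<bar>transition_density R x\<bar> \<le> 8 * (3 + \<alpha> + \<bar>a\<bar> * \<alpha>) *
    ((R powr a * (Gsq x + S x) + R powr (a - 2) * norm (u x) powr 2) * indicator (cball 0 (2 * R)) x
    + (R powr (- a) * (Gsq x + S x) + R powr (2 - a) * norm (u x) powr 2) * indicator (cball 0 (2 / R)) x)"
proof (cases "x = 0")
  case True
  then have "transition_density R x = 0" using annulus_cutoff_small[of 0 R] by (simp add: transition_density_def)
  moreover have "0 \<le> 8 * (3 + \<alpha> + \<bar>a\<bar> * \<alpha>) *
    ((R powr a * (Gsq x + S x) + R powr (a - 2) * norm (u x) powr 2) * indicator (cball 0 (2 * R)) x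
    + (R powr (- a) * (Gsq x + S x) + R powr (2 - a) * norm (u x) powr 2) * indicator (cball 0 (2 / R)) x)"
    using alpha_pos Gsq_nonneg[of x] S_nonneg[of x] by (intro mult_nonneg_nonneg add_nonneg_nonneg) auto
  ultimately show ?thesis by simp
next
  case False
  define \<tau> where "\<tau> = x \<bullet> x"
  define w where "w = norm (u x) powr 2"
  have w: "u x \<bullet> u x = w" by (simp add: w_def u_sq_powr)
  have \<tau>: "\<tau> > 0" using False by (simp add: \<tau>_def)
  have w0: "w \<ge> 0" by (simp add: w_def)
  have nx: "norm x = \<tau> powr (1 / 2)"
    using \<tau> by (simp add: \<tau>_def powr_half_sqrt norm_eq_sqrt_inner)
  define m where "m = \<tau> powr (a / 2 - 1)"
  define C where "C = 3 + \<alpha> + \<bar>a\<bar> * \<alpha>"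
  have C0: "C \<ge> 0" using alpha_pos by (simp add: C_def)
  have m1: "m * \<tau> = \<tau> powr (a / 2)"
    using \<tau> powr_add[of \<tau> "a / 2 - 1" 1] by (simp add: m_def)
  have Z: "\<bar>x \<bullet> V x\<bar> \<le> (1 / 2) * w + \<tau> * Gsq x / (4 * (1 / 2))"
  proof (rule abs_le_weighted_sum)
    have "(x \<bullet> V x)\<^sup>2 \<le> (x \<bullet> x) * (V x \<bullet> V x)" by (rule Cauchy_Schwarz_ineq)
    also have "\<dots> \<le> (x \<bullet> x) * ((u x \<bullet> u x) * Gsq x)" by (intro mult_left_mono V_bound inner_ge_zero)
    finally show "(x \<bullet> V x)\<^sup>2 \<le> w * (\<tau> * Gsq x)" unfolding w \<tau>_def[symmetric] by (simp only: mult_ac)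
  qed (use w0 \<tau> Gsq_nonneg[of x] in auto)
  define T where "T = 2 * Y x - \<tau> * Gsq x + 2 * (1 / (p + 1)) * \<tau> * S x + 2 * \<alpha> * (x \<bullet> V x) + a * \<alpha> * w"
  have T: "\<bar>T\<bar> \<le> C * (\<tau> * (Gsq x + S x) + w)"
  proof -
    have 1: "0 \<le> 2 * Y x" "2 * Y x \<le> 2 * (\<tau> * Gsq x)" using Y_nonneg[of x] Y_le[of x] by (auto simp: \<tau>_def)
    have G0: "0 \<le> \<tau> * Gsq x" and S0: "0 \<le> \<tau> * S x" using \<tau> Gsq_nonneg[of x] S_nonneg[of x] by auto
    have "2 * (1 / (p + 1)) \<le> 1" "0 \<le> 2 * (1 / (p + 1))" using p1 by auto
    from mult_right_mono[OF this(1) S0] mult_nonneg_nonneg[OF this(2) S0]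
    have 2: "2 * (1 / (p + 1)) * (\<tau> * S x) \<le> 1 * (\<tau> * S x)" "0 \<le> 2 * (1 / (p + 1)) * (\<tau> * S x)" .
    have 3: "\<bar>2 * \<alpha> * (x \<bullet> V x)\<bar> \<le> \<alpha> * (w + \<tau> * Gsq x)"
      using mult_left_mono[OF Z, of "2 * \<alpha>"] alpha_pos by (simp add: abs_mult algebra_simps)
    have 4: "\<bar>a * \<alpha> * w\<bar> = \<bar>a\<bar> * \<alpha> * w" using alpha_pos w0 by (simp add: abs_mult)
    have "2 * (1 / (p + 1)) * \<tau> * S x = 2 * (1 / (p + 1)) * (\<tau> * S x)" by simp
    then have "\<bar>T\<bar> \<le> 3 * (\<tau> * Gsq x) + \<tau> * S x + \<alpha> * (w + \<tau> * Gsq x) + \<bar>a\<bar> * \<alpha> * w"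
      unfolding T_def using 1 2 3 4 G0 by linarith
    also have "\<dots> \<le> C * (\<tau> * (Gsq x + S x) + w)"
    proof -
      have "C * (\<tau> * (Gsq x + S x) + w) - (3 * (\<tau> * Gsq x) + \<tau> * S x + \<alpha> * (w + \<tau> * Gsq x) + \<bar>a\<bar> * \<alpha> * w)
        = \<bar>a\<bar> * \<alpha> * (\<tau> * Gsq x) + (2 + \<alpha> + \<bar>a\<bar> * \<alpha>) * (\<tau> * S x) + 3 * w"
        by (simp add: C_def algebra_simps)
      also have "\<dots> \<ge> 0" using alpha_pos w0 by (intro add_nonneg_nonneg mult_nonneg_nonneg[OF _ G0] mult_nonneg_nonneg[OF _ S0]) auto
      finally show ?thesis by simp
    qed
    finally show ?thesis .
  qed
  have key: "m * (\<tau> * (Gsq x + S x) + w) * (indicator {1..2} (\<tau> / R\<^sup>2) + indicator {1..2} (\<tau> * R\<^sup>2))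
    \<le> (R powr a * (Gsq x + S x) + R powr (a - 2) * w) * indicator (cball 0 (2 * R)) x
    + (R powr (- a) * (Gsq x + S x) + R powr (2 - a) * w) * indicator (cball 0 (2 / R)) x"
  proof -
    have GS: "Gsq x + S x \<ge> 0" using Gsq_nonneg[of x] S_nonneg[of x] by simp
    \<comment> \<open>Serves both layers, with \<open>Q\<close> equal to R on the outer and to 1/R
      on the inner one. As a < 0, all powers of \<tau> involved are decreasing, so a lower bound for
      \<tau> suffices.\<close>
    have gen: "m * (\<tau> * (Gsq x + S x) + w) \<le> Q powr a * (Gsq x + S x) + Q powr (a - 2) * w" if Q: "Q > 0" "Q\<^sup>2 \<le> \<tau>" for Q
    proof -
      have "\<tau> powr b \<le> Q powr (2 * b)" if "b \<le> 0" for b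
      proof -
        have "\<tau> powr b \<le> (Q\<^sup>2) powr b" using Q that by (intro powr_mono2') auto
        also have "(Q\<^sup>2) powr b = (Q powr 2) powr b" using Q by (simp add: powr_numeral)
        also have "\<dots> = Q powr (2 * b)" by (simp only: powr_powr)
        finally show ?thesis .
      qed
      from this[of "a / 2"] this[of "a / 2 - 1"] a0 have "m * \<tau> \<le> Q powr a" "m \<le> Q powr (a - 2)"
        unfolding m1 by (simp_all add: m_def)
      then have "(m * \<tau>) * (Gsq x + S x) + m * w \<le> Q powr a * (Gsq x + S x) + Q powr (a - 2) * w"
        using GS w0 by (intro add_mono mult_right_mono) auto
      then show ?thesis by (simp add: algebra_simps)
    qed
    have o: "m * (\<tau> * (Gsq x + S x) + w) * indicator {1..2} (\<tau> / R\<^sup>2) \<le> (R powr a * (Gsq x + S x) + R powr (a - 2) * w) * indicator (cball 0 (2 * R)) x"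
    proof (cases "\<tau> / R\<^sup>2 \<in> {1..2}")
      case True
      then have t: "R\<^sup>2 \<le> \<tau>" "\<tau> \<le> 2 * R\<^sup>2" using R by (auto simp: le_divide_eq divide_le_eq)
      have "2 * R\<^sup>2 \<le> (2 * R)\<^sup>2" by (simp add: power_mult_distrib)
      with t(2) have "(norm x)\<^sup>2 \<le> (2 * R)\<^sup>2" by (simp only: power2_norm_eq_inner \<tau>_def[symmetric])
      then have "norm x \<le> 2 * R" by (rule power2_le_imp_le) (use R in simp)
      then show ?thesis using gen[OF R t(1)] True by simp
    next
      case False
      then show ?thesis using GS w0 by simp
    qed
    have i: "m * (\<tau> * (Gsq x + S x) + w) * indicator {1..2} (\<tau> * R\<^sup>2) \<le> (R powr (- a) * (Gsq x + S x) + R powr (2 - a) * w) * indicator (cball 0 (2 / R)) x"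
    proof (cases "\<tau> * R\<^sup>2 \<in> {1..2}")
      case True
      then have t: "(1 / R)\<^sup>2 \<le> \<tau>" "\<tau> \<le> 2 / R\<^sup>2" using R by (auto simp: power_divide le_divide_eq divide_le_eq)
      have "2 / R\<^sup>2 \<le> (2 / R)\<^sup>2" using R by (simp add: power_divide divide_right_mono)
      then have "(norm x)\<^sup>2 \<le> (2 / R)\<^sup>2" using t(2) by (simp add: power2_norm_eq_inner \<tau>_def[symmetric])
      then have "norm x \<le> 2 / R" by (rule power2_le_imp_le) (use R in simp)
      moreover have "(1 / R) powr b = R powr (- b)" for b using R by (simp add: powr_divide powr_minus_divide)
      ultimately show ?thesis using gen[OF _ t(1)] R True by simp
    next
      case False
      then show ?thesis using GS w0 by simp
    qed
    show ?thesis using o i by (simp add: distrib_left)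
  qed
  have "\<bar>transition_density R x\<bar> = m * \<bar>\<tau> * annulus_cutoff' R \<tau>\<bar> * \<bar>T\<bar>"
    unfolding transition_density_def w T_def \<tau>_def[symmetric] m_def[symmetric] abs_mult by (simp add: m_def)
  also have "\<dots> \<le> m * (8 * indicator {1..2} (\<tau> / R\<^sup>2) + 8 * indicator {1..2} (\<tau> * R\<^sup>2)) * (C * (\<tau> * (Gsq x + S x) + w))"
    by (intro mult_mono mult_left_mono T annulus_cutoff'_bound R mult_nonneg_nonneg) (auto simp: m_def)
  also have "\<dots> = 8 * C * (m * (\<tau> * (Gsq x + S x) + w) * (indicator {1..2} (\<tau> / R\<^sup>2) + indicator {1..2} (\<tau> * R\<^sup>2)))"
    by (simp add: algebra_simps)
  also have "\<dots> \<le> 8 * C * ((R powr a * (Gsq x + S x) + R powr (a - 2) * w) * indicator (cball 0 (2 * R)) x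
    + (R powr (- a) * (Gsq x + S x) + R powr (2 - a) * w) * indicator (cball 0 (2 / R)) x)"
    by (rule mult_left_mono[OF key]) (use C0 in simp)
  finally show ?thesis unfolding C_def w_def .
qed

text \<open>With q = n (p - 1) / 2 = n / \<alpha>, the factors R^a and R^(a - 2) of the outer layer
  are exactly the normalisations in \<open>ball_average_tendsto_0\<close> for the powers p + 1 and
  2. The inner layer is controlled by its small volume and local bounds on \<open>u\<close> and its
  gradient.\<close>

lemma emden_fowler_energy_tendsto_0:
  assumes s: "s > 0" "(1 + s)\<^sup>2 / (1 + 2 * s) < p" and sN: "real CARD('n) * (p - 1) / 2 = p + 1 + 2 * s"
    and stab: "stable_outside R0"
  shows "a < 0" "((\<lambda>R. (LBINT x. annulus_weight (a / 2 - 1) R (x \<bullet> x) * W x)) \<longlongrightarrow> 0) at_top"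
proof -
  define q where "q = p + 1 + 2 * s"
  define N where "N = real CARD('n)"
  have q: "p + 1 < q" "2 < q" "q > 0" using s p1 by (auto simp: q_def)
  have \<alpha>2: "\<alpha> * (p - 1) = 2" using nonzero_eq_divide_eq[of "p - 1" \<alpha> 2] p1 by (simp add: \<alpha>_def)
  then have \<alpha>3: "2 * \<alpha> + 2 = (p + 1) * \<alpha>" by (simp add: algebra_simps)
  have Nq: "N = \<alpha> * q"
  proof -
    have "q = N * (p - 1) / 2" using sN by (simp only: q_def N_def)
    then have "\<alpha> * q = (\<alpha> * (p - 1)) * N / 2" by simp
    then show ?thesis using \<alpha>2 by simp
  qed
  have ex1: "- (N * (1 - (p + 1) / q)) = a"
  proof -
    have "N * (1 - (p + 1) / q) = N - (p + 1) * \<alpha>" unfolding Nq using q by (simp add: field_simps)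
    then show ?thesis using \<alpha>3 by (simp add: a_def N_def)
  qed
  have ex2: "- (N * (1 - 2 / q)) = a - 2"
  proof -
    have "N * (1 - 2 / q) = N - 2 * \<alpha>" unfolding Nq using q by (simp add: field_simps)
    then show ?thesis by (simp add: a_def N_def)
  qed
  show a0: "a < 0"
  proof -
    have "\<alpha> * (p + 1) < \<alpha> * q" using alpha_pos q by (intro mult_strict_left_mono) auto
    then show ?thesis using Nq \<alpha>3 by (simp add: a_def N_def mult.commute)
  qed
  have "integrable lborel (\<lambda>x. norm (u x) powr (p + 1 + 2 * s))"
  proof (rule stable_integrable[OF stab _ s(2)])
    have "real CARD('n) * (p - 1) \<le> 2 * (p + 1 + 2 * s)" using sN by simp
    then show "real CARD('n) \<le> 2 * (p + 1 + 2 * s) / (p - 1)" using p1 by (simp add: le_divide_eq)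
  qed (use s in simp)
  then have iq: "integrable lborel (\<lambda>x. norm (u x) powr q)" by (simp add: q_def)
  have cn: "continuous_on UNIV (\<lambda>x. norm (u x))" by (intro continuous_intros u_cont)
  define IS where "IS R = (LBINT x. S x * indicator (cball 0 R) x)" for R
  define IG where "IG R = (LBINT x. Gsq x * indicator (cball 0 R) x)" for R
  define Iw where "Iw R = (LBINT x. norm (u x) powr 2 * indicator (cball 0 R) x)" for R
  have LS: "((\<lambda>R. R powr a * IS (c * R)) \<longlongrightarrow> 0) at_top" if "c > 0" for c
    using ball_average_tendsto_0[OF cn norm_ge_zero _ q(1) iq that] p1
    unfolding IS_def S_def N_def[symmetric] ex1 by simp
  have Lw: "((\<lambda>R. R powr (a - 2) * Iw (c * R)) \<longlongrightarrow> 0) at_top" if "c > 0" for c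
    using ball_average_tendsto_0[OF cn norm_ge_zero _ q(2) iq that]
    unfolding Iw_def N_def[symmetric] ex2 by simp
  \<comment> \<open>The gradient is not covered by the averages of |u|; the Caccioppoli inequality
    on the doubled ball reduces it to them.\<close>
  have LG: "((\<lambda>R. R powr a * IG (2 * R)) \<longlongrightarrow> 0) at_top"
  proof (rule Lim_null_comparison)
    have "((\<lambda>R. 2 * (R powr a * IS (4 * R)) + 256 * (R powr (a - 2) * Iw (4 * R))) \<longlongrightarrow> 2 * 0 + 256 * 0) at_top"
      by (intro tendsto_add tendsto_mult tendsto_const LS Lw) auto
    then show "((\<lambda>R. 2 * (R powr a * IS (4 * R)) + 256 * (R powr (a - 2) * Iw (4 * R))) \<longlongrightarrow> 0) at_top" by simp
    show "\<forall>\<^sub>F R in at_top. norm (R powr a * IG (2 * R)) \<le> 2 * (R powr a * IS (4 * R)) + 256 * (R powr (a - 2) * Iw (4 * R))"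
      using eventually_gt_at_top[of 0]
    proof eventually_elim
      case (elim R)
      have R2: "2 * R > 0" using elim by simp
      have "(LBINT x. (ball_cutoff (2 * R) x)\<^sup>2 * S x) \<le> IS (4 * R)"
        unfolding IS_def
      proof (rule integral_mono[OF _ integrable_cball[OF S_cont]])
        show "integrable lborel (\<lambda>x. (ball_cutoff (2 * R) x)\<^sup>2 * S x)"
          by (rule integrable_continuous_bounded_support[where r="4 * R"])
            (use elim in \<open>auto simp: ball_cutoff_eq_0 intro!: continuous_intros S_cont C1_grad_continuous[OF C1_grad_ball_cutoff]\<close>)
        show "(ball_cutoff (2 * R) x)\<^sup>2 * S x \<le> S x * indicator (cball 0 (4 * R)) x" for x
          using ball_cutoff_bounds[of "2 * R" x] S_nonneg[of x] ball_cutoff_eq_0[OF R2, of x]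
          by (cases "norm x \<le> 4 * R") (auto simp: mult_left_le_one_le power_le_one)
      qed
      moreover have "(LBINT x. norm (u x) powr 2 * (\<bar>ball_cutoff_slope (2 * R) x\<bar> * norm x)\<^sup>2) \<le> 64 * (R powr (- 2) * Iw (4 * R))"
      proof -
        have e: "(2 * R) powr (- 2) = R powr (- 2) / 4"
        proof -
          have "(2::real) powr (- 2) = 1 / 4" by (subst powr_minus_divide) simp
          moreover have "(2 * R) powr (- 2) = 2 powr (- 2) * R powr (- 2)" by (rule powr_mult)
          ultimately show ?thesis by simp
        qed
        show ?thesis using integral_ball_cutoff_slope_le[OF R2] unfolding e Iw_def by simp
      qed
      ultimately have "IG (2 * R) \<le> 2 * IS (4 * R) + 256 * (R powr (- 2) * Iw (4 * R))"
        using caccioppoli_ball[OF R2] unfolding IG_def by linarith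
      then have "R powr a * IG (2 * R) \<le> R powr a * (2 * IS (4 * R) + 256 * (R powr (- 2) * Iw (4 * R)))"
        by (intro mult_left_mono) auto
      also have "\<dots> = 2 * (R powr a * IS (4 * R)) + 256 * ((R powr a * R powr (- 2)) * Iw (4 * R))"
        by (simp only: distrib_left mult_ac)
      also have "R powr a * R powr (- 2) = R powr (a - 2)" by (simp flip: powr_add)
      finally have "R powr a * IG (2 * R) \<le> 2 * (R powr a * IS (4 * R)) + 256 * (R powr (a - 2) * Iw (4 * R))" .
      moreover have "IG (2 * R) \<ge> 0"
        unfolding IG_def by (intro Bochner_Integration.integral_nonneg) (simp add: Gsq_nonneg)
      ultimately show ?case by simp
    qed
  qed
  define Jin where "Jin R = (LBINT x. (R powr (- a) * (Gsq x + S x) + R powr (2 - a) * norm (u x) powr 2) * indicator (cball 0 (2 / R)) x)" for R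
  have cGS: "continuous_on UNIV (\<lambda>x. Gsq x + S x)" by (intro continuous_intros Gsq_cont S_cont)
  have cw: "continuous_on UNIV (\<lambda>x. norm (u x) powr 2)" by (rule norm_u_powr_cont) simp
  have Ljin: "(Jin \<longlongrightarrow> 0) at_top"
  proof -
    obtain M1 where M1: "M1 > 0" "\<And>x. norm x \<le> 2 \<Longrightarrow> norm (Gsq x + S x) \<le> M1" by (rule bounded_on_ball[OF cGS]) blast
    obtain M2 where M2: "M2 > 0" "\<And>x. norm x \<le> 2 \<Longrightarrow> norm (norm (u x) powr 2) \<le> M2" by (rule bounded_on_ball[OF cw]) blast
    define \<omega> where "\<omega> = unit_ball_vol N * 2 ^ CARD('n)"
    \<comment> \<open>The volume factor R^(-n) turns R^(-a) and R^(2 - a) into these two powers,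
      which decay because \<alpha> > 0.\<close>
    let ?b = "\<lambda>R. (R powr (- (2 * \<alpha> + 2)) * M1 + R powr (- (2 * \<alpha>)) * M2) * \<omega>"
    show ?thesis
    proof (rule Lim_null_comparison)
      have "(?b \<longlongrightarrow> (0 * M1 + 0 * M2) * \<omega>) at_top"
        using alpha_pos by (intro tendsto_add tendsto_mult tendsto_const tendsto_neg_powr filterlim_ident) auto
      then show "(?b \<longlongrightarrow> 0) at_top" by simp
      show "\<forall>\<^sub>F R in at_top. norm (Jin R) \<le> ?b R"
        using eventually_ge_at_top[of 1]
      proof eventually_elim
        case (elim R)
        have R: "R > 0" using elim by simp
        have r2: "2 / R \<le> 2" using elim by (simp add: divide_le_eq)
        have "Jin R \<le> integral\<^sup>L lborel (\<lambda>x::real^'n. (R powr (- a) * M1 + R powr (2 - a) * M2) * indicator (cball 0 (2 / R)) x)"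
          unfolding Jin_def
        proof (rule integral_mono)
          show "integrable lborel (\<lambda>x. (R powr (- a) * (Gsq x + S x) + R powr (2 - a) * norm (u x) powr 2) * indicator (cball 0 (2 / R)) x)"
            by (intro integrable_cball continuous_on_add continuous_on_mult continuous_on_const Gsq_cont S_cont cw)
          show "integrable lborel (\<lambda>x::real^'n. (R powr (- a) * M1 + R powr (2 - a) * M2) * indicator (cball 0 (2 / R)) x)"
            by (intro integrable_mult_right integrable_indicator_cball)
          fix x
          show "(R powr (- a) * (Gsq x + S x) + R powr (2 - a) * norm (u x) powr 2) * indicator (cball 0 (2 / R)) x
            \<le> (R powr (- a) * M1 + R powr (2 - a) * M2) * indicator (cball 0 (2 / R)) x"
          proof (cases "norm x \<le> 2 / R")
            case True
            then have "norm x \<le> 2" using r2 by linarith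
            then have "Gsq x + S x \<le> M1" "norm (u x) powr 2 \<le> M2" using M1(2)[of x] M2(2)[of x] by auto
            then have "R powr (- a) * (Gsq x + S x) + R powr (2 - a) * norm (u x) powr 2 \<le> R powr (- a) * M1 + R powr (2 - a) * M2"
              by (intro add_mono mult_left_mono) auto
            with True show ?thesis by simp
          qed simp
        qed
        also have "\<dots> = (R powr (- a) * M1 + R powr (2 - a) * M2) * (unit_ball_vol N * (2 / R) ^ CARD('n))"
          unfolding integral_mult_right_zero N_def using R by (subst integral_indicator_cball) auto
        also have "(2 / R) ^ CARD('n) = 2 ^ CARD('n) * R powr (- N)"
          using R by (simp add: power_divide powr_minus powr_realpow N_def divide_inverse power_inverse)
        also have "(R powr (- a) * M1 + R powr (2 - a) * M2) * (unit_ball_vol N * (2 ^ CARD('n) * R powr (- N)))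
          = ((R powr (- a) * R powr (- N)) * M1 + (R powr (2 - a) * R powr (- N)) * M2) * \<omega>"
          by (simp add: \<omega>_def algebra_simps)
        also have "R powr (- a) * R powr (- N) = R powr (- (2 * \<alpha> + 2))"
          by (simp add: a_def N_def flip: powr_add)
        also have "R powr (2 - a) * R powr (- N) = R powr (- (2 * \<alpha>))"
          by (simp add: a_def N_def flip: powr_add)
        finally have "Jin R \<le> ?b R" .
        moreover have "Jin R \<ge> 0"
          unfolding Jin_def using Gsq_nonneg S_nonneg by (intro Bochner_Integration.integral_nonneg mult_nonneg_nonneg add_nonneg_nonneg) auto
        ultimately show ?case by simp
      qed
    qed
  qed
  define C where "C = 8 * (3 + \<alpha> + \<bar>a\<bar> * \<alpha>)"
  have C0: "C \<ge> 0" using alpha_pos by (simp add: C_def)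
  let ?b = "\<lambda>R. (1 / (- a)) * (C * ((R powr a * IG (2 * R) + R powr a * IS (2 * R) + R powr (a - 2) * Iw (2 * R)) + Jin R))"
  show "((\<lambda>R. (LBINT x. annulus_weight (a / 2 - 1) R (x \<bullet> x) * W x)) \<longlongrightarrow> 0) at_top"
  proof (rule Lim_null_comparison)
    have "(?b \<longlongrightarrow> (1 / (- a)) * (C * ((0 + 0 + 0) + 0))) at_top"
      by (intro tendsto_add tendsto_mult tendsto_const LG LS Lw Ljin) auto
    then show "(?b \<longlongrightarrow> 0) at_top" by simp
    show "\<forall>\<^sub>F R in at_top. norm ((LBINT x. annulus_weight (a / 2 - 1) R (x \<bullet> x) * W x)) \<le> ?b R"
      using eventually_gt_at_top[of 0]
    proof eventually_elim
      case (elim R)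
      define U1 where "U1 x = R powr a * (Gsq x * indicator (cball 0 (2 * R)) x) + R powr a * (S x * indicator (cball 0 (2 * R)) x)
        + R powr (a - 2) * (norm (u x) powr 2 * indicator (cball 0 (2 * R)) x)" for x
      define U2 where "U2 x = (R powr (- a) * (Gsq x + S x) + R powr (2 - a) * norm (u x) powr 2) * indicator (cball 0 (2 / R)) x" for x
      have i1: "integrable lborel U1"
        unfolding U1_def by (intro Bochner_Integration.integrable_add integrable_mult_right integrable_cball Gsq_cont S_cont cw)
      have i2: "integrable lborel U2"
        unfolding U2_def by (intro integrable_cball continuous_on_add continuous_on_mult continuous_on_const Gsq_cont S_cont cw)
      have I1: "integral\<^sup>L lborel U1 = R powr a * IG (2 * R) + R powr a * IS (2 * R) + R powr (a - 2) * Iw (2 * R)"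
        unfolding U1_def IG_def IS_def Iw_def
        by (simp only: Bochner_Integration.integral_add integral_mult_right_zero
          Bochner_Integration.integrable_add integrable_mult_right integrable_cball Gsq_cont S_cont cw)
      have I2: "integral\<^sup>L lborel U2 = Jin R" unfolding U2_def Jin_def ..
      have "- a * \<bar>(LBINT x. annulus_weight (a / 2 - 1) R (x \<bullet> x) * W x)\<bar> = \<bar>integral\<^sup>L lborel (transition_density R)\<bar>"
        unfolding emden_fowler_identity(3)[OF elim, symmetric] using a0 by (simp add: abs_mult)
      also have "\<dots> \<le> (LBINT x. \<bar>transition_density R x\<bar>)"
        by (rule integral_abs_bound)
      also have "\<dots> \<le> (LBINT x. C * (U1 x + U2 x))"
      proof (rule integral_mono)
        show "integrable lborel (\<lambda>x. \<bar>transition_density R x\<bar>)" using emden_fowler_identity(2)[OF elim] by (rule integrable_abs)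
        show "integrable lborel (\<lambda>x. C * (U1 x + U2 x))"
          by (intro integrable_mult_right Bochner_Integration.integrable_add i1 i2)
        show "\<bar>transition_density R x\<bar> \<le> C * (U1 x + U2 x)" for x
        proof -
          have "U1 x = (R powr a * (Gsq x + S x) + R powr (a - 2) * norm (u x) powr 2) * indicator (cball 0 (2 * R)) x"
            by (simp add: U1_def algebra_simps)
          then show ?thesis using transition_density_bound[OF elim a0, of x] by (simp only: C_def U2_def)
        qed
      qed
      also have "\<dots> = C * (integral\<^sup>L lborel U1 + integral\<^sup>L lborel U2)"
        using i1 i2 by simp
      finally have "- a * \<bar>(LBINT x. annulus_weight (a / 2 - 1) R (x \<bullet> x) * W x)\<bar> \<le> C * (integral\<^sup>L lborel U1 + integral\<^sup>L lborel U2)" .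
      then have "(1 / (- a)) * (- a * \<bar>(LBINT x. annulus_weight (a / 2 - 1) R (x \<bullet> x) * W x)\<bar>)
        \<le> (1 / (- a)) * (C * (integral\<^sup>L lborel U1 + integral\<^sup>L lborel U2))"
        by (rule mult_left_mono) (use a0 in simp)
      moreover have "(1 / (- a)) * (- a * X) = X" for X using a0 by simp
      ultimately show ?case unfolding I1 I2 real_norm_def by (simp only:)
    qed
  qed
qed

text \<open>The integrand is nonnegative and the cutoffs eventually increase, so the weighted
  integral for a fixed cutoff is bounded by a limit that is 0.\<close>

lemma W_eq_0:
  assumes a0: "a < 0" and lim: "((\<lambda>R. (LBINT x. annulus_weight (a / 2 - 1) R (x \<bullet> x) * W x)) \<longlongrightarrow> 0) at_top"
    and x: "x \<noteq> 0"
  shows "W x = 0"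
proof -
  have W0: "W y \<ge> 0" for y by (simp add: W_eq sum_nonneg)
  define \<tau> where "\<tau> = x \<bullet> x"
  have \<tau>: "\<tau> > 0" using x by (simp add: \<tau>_def)
  \<comment> \<open>Being at least 1, |x|^2 and 2 / |x|^2, the radius \<open>r\<close> puts
    \<open>x\<close> where its cutoff equals 1.\<close>
  define r where "r = max 1 (max \<tau> (2 / \<tau>))"
  have r: "r \<ge> 1" "\<tau> \<le> r" "2 / \<tau> \<le> r" by (auto simp: r_def)
  have rr: "r \<le> r\<^sup>2" using r(1) by (simp add: power2_eq_square)
  have cut1: "annulus_cutoff r \<tau> = 1"
  proof (rule annulus_cutoff_eq_1)
    have "2 / \<tau> \<le> r\<^sup>2" using r(3) rr by linarith
    then show "2 \<le> \<tau> * r\<^sup>2" using \<tau> by (simp add: divide_le_eq mult.commute)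
  qed (use r rr in auto)
  \<comment> \<open>From R = 2 r on, the cutoff for \<open>R\<close> equals 1 wherever the cutoff
    for \<open>r\<close> is nonzero.\<close>
  have mono: "annulus_weight b r t \<le> annulus_weight b R t" if "R \<ge> 2 * r" for b R t
  proof (cases "annulus_cutoff r t = 0")
    case True
    then show ?thesis using annulus_cutoff_bounds[of R t] by (simp add: annulus_weight_def)
  next
    case False
    have "r > 0" using r by simp
    then have t: "t * r\<^sup>2 > 1" "t < 2 * r\<^sup>2" using False annulus_cutoff_small[of t r] annulus_cutoff_large[of r t] by (meson not_le)+
    have "(2 * r)\<^sup>2 \<le> R\<^sup>2" using that r by (intro power_mono) auto
    then have R2: "4 * r\<^sup>2 \<le> R\<^sup>2" by (simp add: power_mult_distrib)
    have t0: "t > 0" using t(1) r by (smt (verit) mult_nonpos_nonneg zero_le_power2)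
    have "annulus_cutoff R t = 1"
    proof (rule annulus_cutoff_eq_1)
      show "R > 0" using that r by simp
      have "t * (4 * r\<^sup>2) \<le> t * R\<^sup>2" using t0 R2 by (intro mult_left_mono) auto
      then show "2 \<le> t * R\<^sup>2" using t(1) by simp
      show "t \<le> R\<^sup>2" using t(2) R2 t0 by simp
    qed
    then show ?thesis using annulus_cutoff_bounds[of r t] by (simp add: annulus_weight_def mult_left_le)
  qed
  have r0: "r > 0" using r by simp
  note iW = emden_fowler_identity(1)
  have "\<forall>\<^sub>F R in at_top. (LBINT x. annulus_weight (a / 2 - 1) r (x \<bullet> x) * W x) \<le> (LBINT x. annulus_weight (a / 2 - 1) R (x \<bullet> x) * W x)"
    using eventually_ge_at_top[of "2 * r"]
  proof eventually_elim
    case (elim R)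
    then have "R > 0" using r0 by simp
    then show ?case using mono[OF elim] W0 by (intro integral_mono iW r0 mult_right_mono) auto
  qed
  then have "(LBINT x. annulus_weight (a / 2 - 1) r (x \<bullet> x) * W x) \<le> 0"
    by (rule tendsto_lowerbound[OF lim]) simp
  moreover have nn: "annulus_weight (a / 2 - 1) r (x \<bullet> x) * W x \<ge> 0" for x :: "real^'n"
    using W0 annulus_cutoff_bounds by (simp add: annulus_weight_def)
  ultimately have "(LBINT x. annulus_weight (a / 2 - 1) r (x \<bullet> x) * W x) = 0"
    by (intro antisym Bochner_Integration.integral_nonneg)
  then have "AE x in lborel. annulus_weight (a / 2 - 1) r (x \<bullet> x) * W x = 0"
    using integral_nonneg_eq_0_iff_AE[OF iW[OF r0] AE_I2[OF nn]] by simp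
  from AE_eq_0_imp_eq_0[OF continuous_on_mult[OF annulus_weight_continuous[OF r0] W_cont] this, of x]
  show ?thesis using cut1 \<tau> by (simp add: annulus_weight_def \<tau>_def)
qed

text \<open>The Euler equation says that \<open>t powr \<alpha> * u (t x)\<close> does not depend on \<open>t > 0\<close>, and it tends to \<open>0\<close> with \<open>t\<close>.\<close>

lemma eq_0_if_W_eq_0:
  assumes W0: "\<And>x. x \<noteq> 0 \<Longrightarrow> W x = 0"
  shows "u x $ i = 0"
proof -
  have euler: "\<alpha> * u x $ i + x \<bullet> g i x = 0" if "x \<noteq> 0" for x
    using W0[OF that] by (simp add: W_eq sum_nonneg_eq_0_iff)
  have nz: "u x $ i = 0" if x: "x \<noteq> 0" for x
  proof -
    define f where "f t = t powr \<alpha> * u (t *\<^sub>R x) $ i" for t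
    have "\<exists>c. \<forall>t\<in>{0<..}. f t = c"
    proof (rule has_field_derivative_zero_constant)
      fix t :: real assume "t \<in> {0<..}"
      then have t: "t > 0" by simp
      have "((\<lambda>t. u (0 + t *\<^sub>R x) $ i) has_real_derivative g i (0 + t *\<^sub>R x) \<bullet> x) (at t)"
        by (rule C1_grad_has_vector_derivative[OF u])
      then have 1: "((\<lambda>t. u (t *\<^sub>R x) $ i) has_real_derivative g i (t *\<^sub>R x) \<bullet> x) (at t)" by simp
      have 2: "((\<lambda>t. t powr \<alpha>) has_real_derivative \<alpha> * t powr (\<alpha> - 1)) (at t)"
        by (rule has_real_derivative_powr[OF t])
      have "t powr \<alpha> = t powr (\<alpha> - 1) * t" using t powr_add[of t "\<alpha> - 1" 1] by simp
      then have "\<alpha> * t powr (\<alpha> - 1) * u (t *\<^sub>R x) $ i + g i (t *\<^sub>R x) \<bullet> x * t powr \<alpha>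
        = t powr (\<alpha> - 1) * (\<alpha> * u (t *\<^sub>R x) $ i + (t *\<^sub>R x) \<bullet> g i (t *\<^sub>R x))"
        by (simp add: algebra_simps inner_commute)
      also have "\<dots> = 0" using euler[of "t *\<^sub>R x"] t x by simp
      finally have "(f has_real_derivative 0) (at t)"
        unfolding f_def[abs_def] using DERIV_mult[OF 2 1] by simp
      then show "(f has_real_derivative 0) (at t within {0<..})"
        by (rule has_field_derivative_at_within)
    qed simp
    then obtain c where c: "\<And>t. t > 0 \<Longrightarrow> f t = c" by auto
    then have cu: "c = u x $ i" using c[of 1] by (simp add: f_def)
    obtain M where M: "M > 0" "\<And>y. norm y \<le> norm x \<Longrightarrow> norm (u y $ i) \<le> M"
      by (rule bounded_on_ball[OF u_nth_cont]) blast
    have "((\<lambda>R. R powr (- \<alpha>) * M) \<longlongrightarrow> 0 * M) at_top"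
      using alpha_pos by (intro tendsto_mult tendsto_const tendsto_neg_powr filterlim_ident) simp
    moreover have "\<forall>\<^sub>F R in at_top. \<bar>c\<bar> \<le> R powr (- \<alpha>) * M"
      using eventually_ge_at_top[of 1]
    proof eventually_elim
      case (elim R)
      then have R: "R > 0" by simp
      have "norm ((1 / R) *\<^sub>R x) \<le> norm x" using elim mult_left_mono[OF elim norm_ge_zero[of x]] by (simp add: divide_le_eq)
      then have "\<bar>u ((1 / R) *\<^sub>R x) $ i\<bar> \<le> M" using M(2) by (metis real_norm_def)
      then have "(1 / R) powr \<alpha> * \<bar>u ((1 / R) *\<^sub>R x) $ i\<bar> \<le> (1 / R) powr \<alpha> * M"
        by (intro mult_left_mono) auto
      moreover have "(1 / R) powr \<alpha> = R powr (- \<alpha>)" using R by (simp add: powr_divide powr_minus_divide)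
      moreover have "c = (1 / R) powr \<alpha> * u ((1 / R) *\<^sub>R x) $ i" using c[of "1 / R"] R by (simp add: f_def)
      ultimately show ?case by (simp add: abs_mult)
    qed
    ultimately have "\<bar>c\<bar> \<le> 0 * M"
      by (intro tendsto_lowerbound[of "\<lambda>R. R powr (- \<alpha>) * M" _ at_top]) auto
    then show ?thesis using cu by simp
  qed
  have "AE y in lborel. y \<noteq> (0 :: real^'n)" by (rule AE_lborel_singleton)
  then have "AE y in lborel. u y $ i = 0" by eventually_elim (rule nz)
  from AE_eq_0_imp_eq_0[OF u_nth_cont this] show ?thesis .
qed

end

section \<open>Assembly of the ranges of p\<close>

theorem theorem2p1:
  fixes u :: "real^'n \<Rightarrow> real^'m" and p :: real
  assumes n3: "CARD('n) \<ge> 3"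
    and p1: "p > 1"
    and sol: "classical_solution p u"
    and fmi: "finite_morse_index p u"
  shows "((p < (real CARD('n) + 2) / (real CARD('n) - 2) \<or>
           ((real CARD('n) + 2) / (real CARD('n) - 2) < p \<and> ereal p < p_c CARD('n)))
          \<longrightarrow> (\<forall>i x. u x $ i = 0))
       \<and> (p = (real CARD('n) + 2) / (real CARD('n) - 2) \<longrightarrow>
            integrable lborel (\<lambda>x. norm (u x) powr (p + 1))
          \<and> (\<forall>i. integrable lborel (\<lambda>x. grad_sq (\<lambda>y. u y $ i) x))
          \<and> integral\<^sup>L lborel (\<lambda>x. norm (u x) powr (p + 1))
              = (\<Sum>i\<in>UNIV. integral\<^sup>L lborel (\<lambda>x. grad_sq (\<lambda>y. u y $ i) x))
          \<and> (stable p u \<longrightarrow> (\<forall>i x. u x $ i = 0)))"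
proof -
  from classical_solution_lane_emden[OF p1 sol] obtain g H where "lane_emden u g H p" by blast
  then interpret lane_emden u g H p .
  have N2: "real CARD('n) > 2" using n3 by simp
  from finite_morse_index_stable_outside[OF p1 u_cont fmi] obtain R0 where stab: "stable_outside R0"
    unfolding stable_outside_def by blast
  have sub: "u x $ i = 0" if "p < (real CARD('n) + 2) / (real CARD('n) - 2)" for i x
    using subcritical_eq_0[OF N2 that stab, of x] by simp
  have super: "u x $ i = 0" if lo: "(real CARD('n) + 2) / (real CARD('n) - 2) < p" and up: "ereal p < p_c CARD('n)" for i x
  proof -
    note jl = joseph_lundgren_bound[OF n3 p1 lo up]
    have "real CARD('n) * (p - 1) / 2 = p + 1 + 2 * ((real CARD('n) * (p - 1) / 2 - p - 1) / 2)" by (simp add: field_simps)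
    note lim = emden_fowler_energy_tendsto_0[OF jl this stab]
    show ?thesis by (rule eq_0_if_W_eq_0) (rule W_eq_0[OF lim])
  qed
  have crit: "integrable lborel (\<lambda>x. norm (u x) powr (p + 1))
      \<and> (\<forall>i. integrable lborel (\<lambda>x. grad_sq (\<lambda>y. u y $ i) x))
      \<and> (LBINT x. norm (u x) powr (p + 1)) = (\<Sum>i\<in>UNIV. (LBINT x. grad_sq (\<lambda>y. u y $ i) x))
      \<and> (stable p u \<longrightarrow> (\<forall>i x. u x $ i = 0))"
    if "p = (real CARD('n) + 2) / (real CARD('n) - 2)"
  proof -
    have p: "p \<le> (real CARD('n) + 2) / (real CARD('n) - 2)" using that by simp
    note fe = finite_energy[OF N2 p stab]
    have gs: "grad_sq (\<lambda>y. u y $ i) x = g i x \<bullet> g i x" for i x by (rule C1_grad_grad_sq[OF u])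
    have ig: "integrable lborel (\<lambda>x. g i x \<bullet> g i x)" for i
    proof (rule Bochner_Integration.integrable_bound[OF fe(2)])
      have "continuous_on UNIV (\<lambda>x. g i x \<bullet> g i x)" by (intro continuous_intros g_cont)
      then show "(\<lambda>x. g i x \<bullet> g i x) \<in> borel_measurable lborel"
        using borel_measurable_continuous_onI by simp
      show "AE x in lborel. norm (g i x \<bullet> g i x) \<le> norm (Gsq x)"
      proof (rule AE_I2)
        fix x
        have "g i x \<bullet> g i x \<le> Gsq x"
          unfolding Gsq_def by (rule member_le_sum) auto
        then show "norm (g i x \<bullet> g i x) \<le> norm (Gsq x)" by simp
      qed
    qed
    have "(\<Sum>i\<in>UNIV. (LBINT x. g i x \<bullet> g i x)) = integral\<^sup>L lborel Gsq"
      unfolding Gsq_def using ig by simp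
    then have "(LBINT x. norm (u x) powr (p + 1)) = (\<Sum>i\<in>UNIV. (LBINT x. grad_sq (\<lambda>y. u y $ i) x))"
      unfolding gs using fe(3) by (simp add: S_def[abs_def])
    moreover have "u x $ i = 0" if "stable p u" for i x
    proof -
      have "stable_outside (- 1)" using that by (simp add: stable_outside_def stable_def)
      from critical_stable_eq_0[OF N2 p this, of x] show ?thesis by simp
    qed
    ultimately show ?thesis using fe(1) ig by (simp add: gs S_def[abs_def])
  qed
  show ?thesis using sub super crit by blast
qed

end
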